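(* Let $n\geq 3$, let $A^{(1)},\dots,A^{(n)}$ be finite-dimensional complex vector spaces, and let $T\in A^{(1)}\otimes\cdots\otimes A^{(n)}$. For all integers $0\le r<n$: $\mathrm{GR}(T)\leq r$ if and only if there exists $i\in\{1,\dots,n\}$ such that $T(A^{(i)*})$ has bounded geometric rank $r$ as a space of $(n-1)$-part tensors.
   Context: For $k\geq 2$ and a tensor $S\in V_1\otimes\cdots\otimes V_k$ (finite-dimensional complex vector spaces), regarded as a multilinear function $S:V_1^*\times\cdots\times V_k^*\to\mathbb{C}$, the geometric rank is $$\mathrm{GR}(S):=\mathrm{codim}\{(x_1,\dots,x_{k-1})\in V_1^*\times\cdots\times V_{k-1}^*\mid S(x_1,\dots,x_{k-1},x_k)=0\ \forall x_k\in V_k^*\}.$$ For $k=2$ this is the matrix rank. For each $i$, $T$ is regarded as a linear map $A^{(i)*}\to\bigotimes_{j\neq i}A^{(j)}$ (contraction in the $i$-th factor), and $T(A^{(i)*})$ is its image. A linear subspace of a tensor product of vector spaces has bounded geometric rank $r$ if every element of it has geometric rank at most $r$. *)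

theory Defs
  imports Complex_Main "HOL-Library.FuncSet" "HOL-Library.Extended_Nat"
begin

text \<open>
  The factors \<open>A i\<close> are finite-dimensional subspaces of one complex vector space with carrier type
  \<open>'v\<close> and scalar multiplication \<open>smul\<close>, indexed by a finite set \<open>J\<close> of natural numbers in their
  usual order; any finite family of vector spaces embeds in such an ambient space.
  Using index sets rather than \<open>{1..k}\<close> lets a factor be removed without renumbering the others.
\<close>

definition fd_subspace :: "(complex \<Rightarrow> 'v::ab_group_add \<Rightarrow> 'v) \<Rightarrow> 'v set \<Rightarrow> bool" where
  "fd_subspace smul V \<longleftrightarrow> (\<exists>B. finite B \<and> V = module.span smul B)"

text \<open>Functionals are extended by 0 outside \<open>V\<close>, so that the vector space operations of the dual
  are the pointwise ones.\<close>

definition dual_space :: "(complex \<Rightarrow> 'v::ab_group_add \<Rightarrow> 'v) \<Rightarrow> 'v set \<Rightarrow> ('v \<Rightarrow> complex) set" where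
  "dual_space smul V = {f. (\<forall>u\<in>V. \<forall>v\<in>V. f (u + v) = f u + f v) \<and>
     (\<forall>c. \<forall>v\<in>V. f (smul c v) = c * f v) \<and> (\<forall>v. v \<notin> V \<longrightarrow> f v = 0)}"

definition dual_prod ::
  "(complex \<Rightarrow> 'v::ab_group_add \<Rightarrow> 'v) \<Rightarrow> (nat \<Rightarrow> 'v set) \<Rightarrow> nat set \<Rightarrow> (nat \<Rightarrow> 'v \<Rightarrow> complex) set" where
  "dual_prod smul A J = (\<Pi>\<^sub>E j\<in>J. dual_space smul (A j))"

text \<open>Elements of the tensor product of the \<open>A j\<close>, \<open>j \<in> J\<close>, are multilinear functions on the
  product of the duals. Values outside \<open>dual_prod smul A J\<close> are irrelevant.\<close>

definition is_tensor ::
  "(complex \<Rightarrow> 'v::ab_group_add \<Rightarrow> 'v) \<Rightarrow> (nat \<Rightarrow> 'v set) \<Rightarrow> nat set \<Rightarrow>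
   ((nat \<Rightarrow> 'v \<Rightarrow> complex) \<Rightarrow> complex) \<Rightarrow> bool" where
  "is_tensor smul A J S \<longleftrightarrow>
     (\<forall>x\<in>dual_prod smul A J. \<forall>j\<in>J. \<forall>f\<in>dual_space smul (A j). \<forall>g\<in>dual_space smul (A j). \<forall>c.
        S (x(j := (\<lambda>v. f v + g v))) = S (x(j := f)) + S (x(j := g)) \<and>
        S (x(j := (\<lambda>v. c * f v))) = c * S (x(j := f)))"

text \<open>The linear functionals on \<open>dual_space smul V\<close> are the evaluations at vectors of \<open>V\<close>, so the
  following functions, restricted to \<open>dual_prod smul A J\<close>, form its coordinate ring.\<close>

inductive_set polyfuns :: "(nat \<Rightarrow> 'v set) \<Rightarrow> nat set \<Rightarrow> ((nat \<Rightarrow> 'v \<Rightarrow> complex) \<Rightarrow> complex) set"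
  for A :: "nat \<Rightarrow> 'v set" and J :: "nat set" where
  const: "(\<lambda>x. c) \<in> polyfuns A J"
| coord: "j \<in> J \<Longrightarrow> v \<in> A j \<Longrightarrow> (\<lambda>x. x j v) \<in> polyfuns A J"
| add: "p \<in> polyfuns A J \<Longrightarrow> q \<in> polyfuns A J \<Longrightarrow> (\<lambda>x. p x + q x) \<in> polyfuns A J"
| mult: "p \<in> polyfuns A J \<Longrightarrow> q \<in> polyfuns A J \<Longrightarrow> (\<lambda>x. p x * q x) \<in> polyfuns A J"

definition zariski_closed ::
  "(complex \<Rightarrow> 'v::ab_group_add \<Rightarrow> 'v) \<Rightarrow> (nat \<Rightarrow> 'v set) \<Rightarrow> nat set \<Rightarrow>
   (nat \<Rightarrow> 'v \<Rightarrow> complex) set \<Rightarrow> bool" where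
  "zariski_closed smul A J Z \<longleftrightarrow>
     (\<exists>P\<subseteq>polyfuns A J. Z = {x \<in> dual_prod smul A J. \<forall>p\<in>P. p x = 0})"

definition irreducible_closed ::
  "(complex \<Rightarrow> 'v::ab_group_add \<Rightarrow> 'v) \<Rightarrow> (nat \<Rightarrow> 'v set) \<Rightarrow> nat set \<Rightarrow>
   (nat \<Rightarrow> 'v \<Rightarrow> complex) set \<Rightarrow> bool" where
  "irreducible_closed smul A J Z \<longleftrightarrow> zariski_closed smul A J Z \<and> Z \<noteq> {} \<and>
     (\<forall>Y Y'. zariski_closed smul A J Y \<longrightarrow> zariski_closed smul A J Y' \<longrightarrow>
        Z \<subseteq> Y \<union> Y' \<longrightarrow> Z \<subseteq> Y \<or> Z \<subseteq> Y')"

text \<open>Krull dimension of a nonempty Zariski closed set (the empty set would get dimension 0).\<close>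

definition zariski_dim ::
  "(complex \<Rightarrow> 'v::ab_group_add \<Rightarrow> 'v) \<Rightarrow> (nat \<Rightarrow> 'v set) \<Rightarrow> nat set \<Rightarrow>
   (nat \<Rightarrow> 'v \<Rightarrow> complex) set \<Rightarrow> enat" where
  "zariski_dim smul A J X = Sup {enat m | m. \<exists>C :: nat \<Rightarrow> (nat \<Rightarrow> 'v \<Rightarrow> complex) set.
     (\<forall>l\<le>m. irreducible_closed smul A J (C l) \<and> C l \<subseteq> X) \<and> (\<forall>l<m. C l \<subset> C (Suc l))}"

text \<open>The subtraction never truncates: \<open>zariski_dim\<close> is bounded by the linear dimension of the
  ambient space.\<close>

definition zariski_codim ::
  "(complex \<Rightarrow> 'v::ab_group_add \<Rightarrow> 'v) \<Rightarrow> (nat \<Rightarrow> 'v set) \<Rightarrow> nat set \<Rightarrow>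
   (nat \<Rightarrow> 'v \<Rightarrow> complex) set \<Rightarrow> enat" where
  "zariski_codim smul A J X =
     enat (\<Sum>j\<in>J. vector_space.dim smul (A j)) - zariski_dim smul A J X"

definition geometric_rank ::
  "(complex \<Rightarrow> 'v::ab_group_add \<Rightarrow> 'v) \<Rightarrow> (nat \<Rightarrow> 'v set) \<Rightarrow> nat set \<Rightarrow>
   ((nat \<Rightarrow> 'v \<Rightarrow> complex) \<Rightarrow> complex) \<Rightarrow> enat" where
  "geometric_rank smul A J S = (let k = Max J in
     zariski_codim smul A (J - {k})
       {x \<in> dual_prod smul A (J - {k}). \<forall>f\<in>dual_space smul (A k). S (x(k := f)) = 0})"

definition contract ::
  "nat \<Rightarrow> ((nat \<Rightarrow> 'v \<Rightarrow> complex) \<Rightarrow> complex) \<Rightarrow> ('v \<Rightarrow> complex) \<Rightarrow>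
   (nat \<Rightarrow> 'v \<Rightarrow> complex) \<Rightarrow> complex" where
  "contract i T f = (\<lambda>x. T (x(i := f)))"

definition bounded_geometric_rank ::
  "(complex \<Rightarrow> 'v::ab_group_add \<Rightarrow> 'v) \<Rightarrow> (nat \<Rightarrow> 'v set) \<Rightarrow> nat set \<Rightarrow>
   ((nat \<Rightarrow> 'v \<Rightarrow> complex) \<Rightarrow> complex) set \<Rightarrow> nat \<Rightarrow> bool" where
  "bounded_geometric_rank smul A J L r \<longleftrightarrow> (\<forall>S\<in>L. geometric_rank smul A J S \<le> enat r)"

lemma contract_is_tensor:
  assumes "is_tensor smul A J T" "i \<in> J" "f \<in> dual_space smul (A i)"
  shows "is_tensor smul A (J - {i}) (contract i T f)"
  unfolding is_tensor_def
proof (intro ballI allI)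
  fix x j g h c
  assume x: "x \<in> dual_prod smul A (J - {i})" and j: "j \<in> J - {i}"
    and gh: "g \<in> dual_space smul (A j)" "h \<in> dual_space smul (A j)"
  have "x(i := f) \<in> dual_prod smul A J"
    using x assms(2,3) by (auto simp: dual_prod_def PiE_iff extensional_def)
  moreover have "(x(j := u))(i := f) = (x(i := f))(j := u)" for u
    using j by (auto simp: fun_eq_iff)
  ultimately show "contract i T f (x(j := (\<lambda>v. g v + h v))) =
        contract i T f (x(j := g)) + contract i T f (x(j := h)) \<and>
      contract i T f (x(j := (\<lambda>v. c * g v))) = c * contract i T f (x(j := g))"
    using assms(1) j gh by (simp add: is_tensor_def contract_def)
qed

end

theory Submission
  imports Defs "HOL-Analysis.Analysis" "HOL-Computational_Algebra.Fundamental_Theorem_Algebra"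
begin

text \<open>
  The dimension of a closed set is measured by the number of coordinates that are algebraically independent
  on it. By growth of Hilbert functions and the Nullstellensatz this agrees with the Krull dimension.

  Let \<open>X\<close> be the kernel variety of \<open>T\<close>, a subset of the product of the first \<open>n - 1\<close> factors. Its
  fibre over a vector \<open>x\<close> of the \<open>i\<close>-th factor is the kernel variety of the contraction of \<open>T\<close> with \<open>x\<close>. If all these
  fibres have codimension at most \<open>r\<close>, then so has \<open>X\<close>; for \<open>i = n\<close> one first exchanges the last two factors,
  which does not change the geometric rank.

  Conversely, let \<open>Z\<close> be a component of \<open>X\<close> of codimension at most \<open>r\<close>. If its projection to some factor \<open>i\<close> is
  dominant, then generic fibres over that factor have codimension at most \<open>r\<close>, and by semicontinuity all of
  them. Otherwise \<open>Z\<close> lies in a product of \<open>n - 1\<close> hypersurfaces, so \<open>r = n - 1\<close> and \<open>Z\<close> is this product. The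
  contractions with vectors of the last factor vanish on it, and since a hypersurface spans a subspace
  of codimension at most 1, one more equation on the product of the first \<open>n - 2\<close> hypersurfaces suffices for
  their kernel varieties.
\<close>

section \<open>Polynomial functions\<close>

text \<open>The obstacle is semicontinuity. For general affine varieties a special fibre may be
  smaller than the generic one, or empty. Here multilinearity makes every fibre a cone: it contains
  the origin, and its dimension is the least number of linear forms whose only common zero on it is
  the origin. By compactness this last condition persists in nearby fibres, so the dimension can
  only jump up at special points.

  The bound \<open>r < n\<close> enters by counting. If a component dominates no factor, independent
  coordinates on it never include all coordinates of one of the first \<open>n - 1\<close> factors,
  so at least \<open>n - 1\<close> coordinates are missed. With codimension at most
  \<open>r \<le> n - 1\<close> there is no slack: exactly one is missed in each factor. The
  contraction then gets codimension at most \<open>n - 2\<close> from the remaining factors, plus 1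
  from one extra equation.

  Independent coordinates suit projections: there are only finitely many sets of coordinates, so one
  of them serves for the fibres over a dense set of base points, and the numbers for base and fibre
  add up.\<close>

inductive has_poly_deg :: "'i set \<Rightarrow> nat \<Rightarrow> (('i \<Rightarrow> complex) \<Rightarrow> complex) \<Rightarrow> bool" for V :: "'i set" where
  const: "has_poly_deg V s (\<lambda>x. c)"
| var: "i \<in> V \<Longrightarrow> has_poly_deg V s p \<Longrightarrow> has_poly_deg V (Suc s) (\<lambda>x. x i * p x)"
| add: "has_poly_deg V s p \<Longrightarrow> has_poly_deg V s q \<Longrightarrow> has_poly_deg V s (\<lambda>x. p x + q x)"

text \<open>Functions stand for polynomials, which is faithful because the complex numbers are
  infinite. The number \<open>s\<close> bounds the total degree.\<close>

definition poly_deg :: "'i set \<Rightarrow> nat \<Rightarrow> (('i \<Rightarrow> complex) \<Rightarrow> complex) set" where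
  "poly_deg V s = Collect (has_poly_deg V s)"

lemma poly_deg_const: "(\<lambda>x. c) \<in> poly_deg V s"
  by (simp add: poly_deg_def has_poly_deg.const)

lemma poly_deg_var: "i \<in> V \<Longrightarrow> p \<in> poly_deg V s \<Longrightarrow> (\<lambda>x. x i * p x) \<in> poly_deg V (Suc s)"
  by (simp add: poly_deg_def has_poly_deg.var)

lemma poly_deg_add: "p \<in> poly_deg V s \<Longrightarrow> q \<in> poly_deg V s \<Longrightarrow> (\<lambda>x. p x + q x) \<in> poly_deg V s"
  by (simp add: poly_deg_def has_poly_deg.add)

lemma poly_deg_induct [consumes 1, case_names const var add]:
  assumes "p \<in> poly_deg V s" and "\<And>c s. Q s (\<lambda>x. c)"
    and "\<And>i s p. i \<in> V \<Longrightarrow> p \<in> poly_deg V s \<Longrightarrow> Q s p \<Longrightarrow> Q (Suc s) (\<lambda>x. x i * p x)"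
    and "\<And>s p q. p \<in> poly_deg V s \<Longrightarrow> q \<in> poly_deg V s \<Longrightarrow> Q s p \<Longrightarrow> Q s q \<Longrightarrow> Q s (\<lambda>x. p x + q x)"
  shows "Q s p"
proof -
  have "has_poly_deg V s p" using assms(1) by (simp add: poly_deg_def)
  then show ?thesis by induction (use assms in \<open>auto simp: poly_deg_def\<close>)
qed

lemmas poly_deg_intros = poly_deg_const poly_deg_var poly_deg_add

lemma poly_deg_mono_deg: "p \<in> poly_deg V s \<Longrightarrow> s \<le> t \<Longrightarrow> p \<in> poly_deg V t"
proof (induction arbitrary: t rule: poly_deg_induct)
  case (var i s p)
  then show ?case by (cases t) (auto intro: poly_deg_var)
qed (auto intro: poly_deg_intros)

lemma poly_deg_mono: "p \<in> poly_deg V s \<Longrightarrow> V \<subseteq> W \<Longrightarrow> p \<in> poly_deg W s"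
  by (induction rule: poly_deg_induct) (auto intro: poly_deg_intros)

lemma poly_deg_cmult: "p \<in> poly_deg V s \<Longrightarrow> (\<lambda>x. c * p x) \<in> poly_deg V s"
proof (induction rule: poly_deg_induct)
  case (var i s p)
  then show ?case using poly_deg_var[OF var(1,3)] by (simp add: mult.left_commute)
next
  case (add s p q)
  then show ?case using poly_deg_add[OF add(3,4)] by (simp add: distrib_left)
qed (auto intro: poly_deg_intros)

lemma poly_deg_mult: "p \<in> poly_deg V s \<Longrightarrow> q \<in> poly_deg V t \<Longrightarrow> (\<lambda>x. p x * q x) \<in> poly_deg V (s + t)"
proof (induction rule: poly_deg_induct)
  case (const c s)
  show ?case by (rule poly_deg_mono_deg[OF poly_deg_cmult[OF const]]) simp
next
  case (var i s p)
  then show ?case using poly_deg_var[OF var(1) var(3)] by (simp add: mult.assoc)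
next
  case (add s p q)
  then show ?case using poly_deg_add[of _ V "s + t"] by (simp add: distrib_right)
qed

lemma poly_deg_coord: "i \<in> V \<Longrightarrow> (\<lambda>x. x i) \<in> poly_deg V (Suc 0)"
  using poly_deg_var[OF _ poly_deg_const[of 1 V 0], of i] by simp

definition poly_fun :: "'i set \<Rightarrow> (('i \<Rightarrow> complex) \<Rightarrow> complex) set" where
  "poly_fun V = (\<Union>s. poly_deg V s)"

lemma poly_deg_PF: "p \<in> poly_deg V s \<Longrightarrow> p \<in> poly_fun V"
  by (auto simp: poly_fun_def)

lemma poly_fun_const [simp]: "(\<lambda>x. c) \<in> poly_fun V"
  by (auto simp: poly_fun_def intro: poly_deg_const)

lemma poly_fun_coord [simp]: "i \<in> V \<Longrightarrow> (\<lambda>x. x i) \<in> poly_fun V"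
  by (rule poly_deg_PF[OF poly_deg_coord])

lemma poly_fun_add: "p \<in> poly_fun V \<Longrightarrow> q \<in> poly_fun V \<Longrightarrow> (\<lambda>x. p x + q x) \<in> poly_fun V"
proof -
  assume "p \<in> poly_fun V" "q \<in> poly_fun V"
  then obtain s t where "p \<in> poly_deg V s" "q \<in> poly_deg V t" by (auto simp: poly_fun_def)
  then have "p \<in> poly_deg V (max s t)" "q \<in> poly_deg V (max s t)" by (auto intro: poly_deg_mono_deg)
  then show ?thesis by (rule poly_deg_PF[OF poly_deg_add])
qed

lemma poly_fun_mult: "p \<in> poly_fun V \<Longrightarrow> q \<in> poly_fun V \<Longrightarrow> (\<lambda>x. p x * q x) \<in> poly_fun V"
  unfolding poly_fun_def by (elim UN_E, rule UN_I[OF UNIV_I], rule poly_deg_mult)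

lemma poly_fun_uminus: "p \<in> poly_fun V \<Longrightarrow> (\<lambda>x. - p x) \<in> poly_fun V"
  using poly_fun_mult[OF poly_fun_const[of "-1"], of p V] by simp

lemma poly_fun_diff: "p \<in> poly_fun V \<Longrightarrow> q \<in> poly_fun V \<Longrightarrow> (\<lambda>x. p x - q x) \<in> poly_fun V"
  using poly_fun_add[OF _ poly_fun_uminus, of p V q] by simp

lemma poly_fun_sum: "(\<And>k. k \<in> K \<Longrightarrow> p k \<in> poly_fun V) \<Longrightarrow> (\<lambda>x. \<Sum>k\<in>K. p k x) \<in> poly_fun V"
  by (induction K rule: infinite_finite_induct) (auto intro: poly_fun_add)

lemma poly_fun_prod: "(\<And>k. k \<in> K \<Longrightarrow> p k \<in> poly_fun V) \<Longrightarrow> (\<lambda>x. \<Prod>k\<in>K. p k x) \<in> poly_fun V"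
  by (induction K rule: infinite_finite_induct) (auto intro: poly_fun_mult)

lemma poly_fun_power: "p \<in> poly_fun V \<Longrightarrow> (\<lambda>x. p x ^ k) \<in> poly_fun V"
  by (induction k) (auto intro: poly_fun_mult)

lemma poly_fun_mono: "p \<in> poly_fun V \<Longrightarrow> V \<subseteq> W \<Longrightarrow> p \<in> poly_fun W"
  unfolding poly_fun_def by (elim UN_E, rule UN_I[OF UNIV_I], rule poly_deg_mono)

lemma poly_fun_induct [consumes 1, case_names const var add]:
  assumes "p \<in> poly_fun V" and "\<And>c. Q (\<lambda>x. c)"
    and "\<And>i p. i \<in> V \<Longrightarrow> p \<in> poly_fun V \<Longrightarrow> Q p \<Longrightarrow> Q (\<lambda>x. x i * p x)"
    and "\<And>p q. p \<in> poly_fun V \<Longrightarrow> q \<in> poly_fun V \<Longrightarrow> Q p \<Longrightarrow> Q q \<Longrightarrow> Q (\<lambda>x. p x + q x)"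
  shows "Q p"
proof -
  obtain s where "p \<in> poly_deg V s" using assms(1) by (auto simp: poly_fun_def)
  then show ?thesis by (induction rule: poly_deg_induct) (auto intro: assms poly_deg_PF)
qed

lemma poly_fun_cong: "p \<in> poly_fun V \<Longrightarrow> (\<And>i. i \<in> V \<Longrightarrow> x i = y i) \<Longrightarrow> p x = p y"
  by (induction rule: poly_fun_induct) auto

lemma poly_fun_subst:
  "p \<in> poly_fun V \<Longrightarrow> (\<And>i. i \<in> V \<Longrightarrow> (\<lambda>x. q x i) \<in> poly_fun W) \<Longrightarrow> (\<lambda>x. p (q x)) \<in> poly_fun W"
  by (induction rule: poly_fun_induct) (auto intro: poly_fun_add poly_fun_mult)

text \<open>Reduces several variables to one by restriction to a polynomially parametrized curve;
  below, the curve is a line.\<close>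

lemma poly_fun_curve:
  assumes "p \<in> poly_fun V" "\<And>i. i \<in> V \<Longrightarrow> \<exists>P::complex poly. \<forall>l. q l i = poly P l"
  shows "\<exists>P::complex poly. \<forall>l. p (q l) = poly P l"
  using assms(1)
proof (induction rule: poly_fun_induct)
  case (const c)
  then show ?case by (intro exI[of _ "[:c:]"]) auto
next
  case (var i p)
  obtain P Q where "\<forall>l. q l i = poly P l" "\<forall>l. p (q l) = poly Q l"
    using var assms(2) by blast
  then show ?case by (intro exI[of _ "P * Q"]) auto
next
  case (add p r)
  then obtain P Q where "\<forall>l. p (q l) = poly P l" "\<forall>l. r (q l) = poly Q l" by blast
  then show ?case by (intro exI[of _ "P + Q"]) auto
qed

lemma poly_fun_line:
  assumes "p \<in> poly_fun V"
  obtains P :: "complex poly" where "\<And>l. p (\<lambda>i. x i + l * (y i - x i)) = poly P l"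
proof -
  have "\<exists>P::complex poly. \<forall>l. p (\<lambda>i. x i + l * (y i - x i)) = poly P l"
  proof (rule poly_fun_curve[OF assms])
    fix i show "\<exists>P::complex poly. \<forall>l. x i + l * (y i - x i) = poly P l"
      by (intro exI[of _ "[:x i, y i - x i:]"]) auto
  qed
  then show ?thesis using that by blast
qed

text \<open>The vanishing ideal of \<open>Z\<close> is prime. Closedness is kept apart, because
  \<open>irr_mix\<close> concerns a set that is not given by equations.\<close>

definition irr :: "'i set \<Rightarrow> ('i \<Rightarrow> complex) set \<Rightarrow> bool" where
  "irr V Z \<longleftrightarrow> Z \<noteq> {} \<and> (\<forall>p\<in>poly_fun V. \<forall>q\<in>poly_fun V. (\<forall>z\<in>Z. p z * q z = 0) \<longrightarrow>
     (\<forall>z\<in>Z. p z = 0) \<or> (\<forall>z\<in>Z. q z = 0))"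

lemma irrD:
  assumes "irr V Z" "p \<in> poly_fun V" "q \<in> poly_fun V" "\<And>z. z \<in> Z \<Longrightarrow> p z * q z = 0"
  shows "(\<forall>z\<in>Z. p z = 0) \<or> (\<forall>z\<in>Z. q z = 0)"
  using assms by (auto simp: irr_def)

lemma irr_power:
  assumes "irr V Z" "a \<in> poly_fun V" "\<exists>z\<in>Z. a z \<noteq> 0" "p \<in> poly_fun V" "\<And>z. z \<in> Z \<Longrightarrow> a z ^ k * p z = 0"
  shows "\<forall>z\<in>Z. p z = 0"
  using assms(5)
proof (induction k)
  case (Suc k)
  have "(\<forall>z\<in>Z. a z = 0) \<or> (\<forall>z\<in>Z. a z ^ k * p z = 0)"
    by (rule irrD[OF assms(1,2) poly_fun_mult[OF poly_fun_power]]) (use Suc(2) assms in \<open>auto simp: mult.assoc\<close>)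
  then show ?case using assms(3) Suc(1) by auto
qed auto

text \<open>Join a point where \<open>p\<close> is nonzero to one where \<open>q\<close> is nonzero
  by a line inside \<open>Z\<close>: on it both become univariate polynomials, and these have no
  zero divisors.\<close>

lemma irr_affine:
  assumes "Z \<noteq> {}" "\<And>x y l. x \<in> Z \<Longrightarrow> y \<in> Z \<Longrightarrow> (\<lambda>i. x i + l * (y i - x i)) \<in> Z"
  shows "irr V Z"
  unfolding irr_def
proof (intro conjI ballI impI)
  fix p q assume pq: "p \<in> poly_fun V" "q \<in> poly_fun V" and z: "\<forall>z\<in>Z. p z * q z = 0"
  show "(\<forall>z\<in>Z. p z = 0) \<or> (\<forall>z\<in>Z. q z = 0)"
  proof (rule ccontr)
    assume "\<not> ?thesis"
    then obtain x y where xy: "x \<in> Z" "y \<in> Z" "p x \<noteq> 0" "q y \<noteq> 0" by auto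
    obtain P where P: "\<And>l. p (\<lambda>i. x i + l * (y i - x i)) = poly P l" using poly_fun_line[OF pq(1)] by blast
    obtain Q where Q: "\<And>l. q (\<lambda>i. x i + l * (y i - x i)) = poly Q l" using poly_fun_line[OF pq(2)] by blast
    have "poly (P * Q) l = 0" for l
      using z assms(2)[OF xy(1,2), of l] P Q by (metis poly_mult)
    then have "P * Q = 0" using poly_all_0_iff_0 by blast
    then have "P = 0 \<or> Q = 0" by simp
    moreover have "poly P 0 \<noteq> 0" using P[of 0] xy by simp
    moreover have "poly Q 1 \<noteq> 0" using Q[of 1] xy by simp
    ultimately show False by auto
  qed
qed (use assms in auto)

lemma irr_UNIV: "irr V UNIV"
  by (rule irr_affine) auto

lemma poly_fun_domain:
  assumes "p \<in> poly_fun V" "q \<in> poly_fun V" "\<And>x. p x * q x = 0"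
  shows "(\<forall>x. p x = 0) \<or> (\<forall>x. q x = 0)"
  using irrD[OF irr_UNIV assms(1,2)] assms(3) by auto

lemma poly_fun_prod_nonzero:
  assumes "finite K" "\<And>k. k \<in> K \<Longrightarrow> p k \<in> poly_fun V" "\<And>k. k \<in> K \<Longrightarrow> \<exists>x. p k x \<noteq> 0"
  shows "\<exists>x. (\<Prod>k\<in>K. p k x) \<noteq> 0"
  using assms
proof (induction K rule: finite_induct)
  case (insert k K)
  obtain x where x: "(\<Prod>k\<in>K. p k x) \<noteq> 0" using insert by auto
  have P: "(\<lambda>x. \<Prod>k\<in>K. p k x) \<in> poly_fun V" using insert by (intro poly_fun_prod) auto
  have "\<not> (\<forall>x. p k x * (\<Prod>k\<in>K. p k x) = 0)"
  proof
    assume "\<forall>x. p k x * (\<Prod>k\<in>K. p k x) = 0"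
    then have "(\<forall>x. p k x = 0) \<or> (\<forall>x. (\<Prod>k\<in>K. p k x) = 0)"
      using poly_fun_domain[OF insert(4)[of k] P] by simp
    then show False using x insert(5)[of k] by auto
  qed
  then show ?case using insert(1,2) by simp
qed auto

text \<open>For \<open>L\<close> the identity this is algebraic independence of the coordinates in \<open>K\<close> on \<open>Z\<close>.\<close>

definition dominant :: "'k set \<Rightarrow> ('p \<Rightarrow> 'k \<Rightarrow> complex) \<Rightarrow> 'p set \<Rightarrow> bool" where
  "dominant K L Z \<longleftrightarrow> (\<forall>p\<in>poly_fun K. (\<forall>z\<in>Z. p (L z) = 0) \<longrightarrow> (\<forall>x. p x = 0))"

abbreviation indep :: "'i set \<Rightarrow> ('i \<Rightarrow> complex) set \<Rightarrow> bool" where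
  "indep I Z \<equiv> dominant I (\<lambda>z. z) Z"

lemma dominantD: "dominant K L Z \<Longrightarrow> p \<in> poly_fun K \<Longrightarrow> (\<And>z. z \<in> Z \<Longrightarrow> p (L z) = 0) \<Longrightarrow> p x = 0"
  by (auto simp: dominant_def)

lemma dominant_mono: "dominant K L Z \<Longrightarrow> K' \<subseteq> K \<Longrightarrow> Z \<subseteq> Z' \<Longrightarrow> dominant K' L Z'"
  unfolding dominant_def by (meson poly_fun_mono subsetD)

text \<open>Otherwise the product of nontrivial relations on the pieces would be a nontrivial
  relation on the union.\<close>

lemma dominant_UN:
  assumes "finite S" "dominant K L (\<Union>s\<in>S. Z s)"
  shows "\<exists>s\<in>S. dominant K L (Z s)"
proof (rule ccontr)
  assume "\<not> ?thesis"
  then have "\<forall>s\<in>S. \<exists>p\<in>poly_fun K. (\<forall>z\<in>Z s. p (L z) = 0) \<and> (\<exists>x. p x \<noteq> 0)" by (auto simp: dominant_def)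
  then obtain p where p: "\<And>s. s \<in> S \<Longrightarrow> p s \<in> poly_fun K" "\<And>s z. s \<in> S \<Longrightarrow> z \<in> Z s \<Longrightarrow> p s (L z) = 0"
    "\<And>s. s \<in> S \<Longrightarrow> \<exists>x. p s x \<noteq> 0" by metis
  have "(\<lambda>x. \<Prod>s\<in>S. p s x) \<in> poly_fun K" using p by (intro poly_fun_prod) auto
  then have "(\<Prod>s\<in>S. p s x) = 0" for x
    by (rule dominantD[OF assms(2)]) (use p assms(1) in auto)
  then show False using poly_fun_prod_nonzero[OF assms(1), of p K] p by metis
qed

section \<open>Hilbert functions\<close>

text \<open>Gaussian elimination: a pivot \<open>k0\<close> for the equation \<open>t\<close>
  removes one unknown together with one equation.\<close>

lemma more_unknowns:
  fixes M :: "'a \<Rightarrow> 'b \<Rightarrow> complex"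
  assumes "finite T" "finite S" "card T < card S"
  shows "\<exists>a. (\<exists>k\<in>S. a k \<noteq> 0) \<and> (\<forall>l\<in>T. (\<Sum>k\<in>S. a k * M k l) = 0)"
  using assms
proof (induction T arbitrary: S M rule: finite_induct)
  case empty
  then have "S \<noteq> {}" by auto
  then show ?case by (intro exI[of _ "\<lambda>_. 1"]) auto
next
  case (insert t T)
  show ?case
  proof (cases "\<forall>k\<in>S. M k t = 0")
    case True
    then show ?thesis using insert.IH[OF insert.prems(1), of M] insert.prems insert.hyps by auto
  next
    case False
    then obtain k0 where k0: "k0 \<in> S" "M k0 t \<noteq> 0" by auto
    define S' where "S' = S - {k0}"
    have S: "S = insert k0 S'" "k0 \<notin> S'" "finite S'" using k0 insert.prems by (auto simp: S'_def)
    have "card T < card S'" using insert.prems insert.hyps S by auto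
    from insert.IH[OF S(3) this, of "\<lambda>k l. M k l - M k t / M k0 t * M k0 l"]
    obtain a where a: "\<exists>k\<in>S'. a k \<noteq> 0"
      "\<And>l. l \<in> T \<Longrightarrow> (\<Sum>k\<in>S'. a k * (M k l - M k t / M k0 t * M k0 l)) = 0" by blast
    \<comment> \<open>The coefficient at the pivot is chosen so that the equation \<open>t\<close>
      holds.\<close>
    define a' where "a' = a(k0 := - (\<Sum>k\<in>S'. a k * M k t) / M k0 t)"
    have sum: "(\<Sum>k\<in>S. a' k * M k l) =
        (\<Sum>k\<in>S'. a k * M k l) - (\<Sum>k\<in>S'. a k * M k t) / M k0 t * M k0 l" for l
    proof -
      have "(\<Sum>k\<in>S'. a' k * M k l) = (\<Sum>k\<in>S'. a k * M k l)"
        using S by (intro sum.cong) (auto simp: a'_def)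
      then show ?thesis using S by (simp add: a'_def)
    qed
    have "(\<Sum>k\<in>S. a' k * M k l) = 0" if "l \<in> insert t T" for l
    proof (cases "l = t")
      case True
      then show ?thesis using sum[of t] k0 by simp
    next
      case False
      then have "(\<Sum>k\<in>S'. a k * M k l) - (\<Sum>k\<in>S'. a k * M k t) / M k0 t * M k0 l = 0"
        using a(2)[of l] that
        by (simp add: right_diff_distrib sum_subtractf sum_distrib_right sum_divide_distrib mult.assoc)
      then show ?thesis using sum by simp
    qed
    moreover have "\<exists>k\<in>S. a' k \<noteq> 0" using a(1) S by (auto simp: a'_def)
    ultimately show ?thesis by blast
  qed
qed

definition lin_indep_on :: "'p set \<Rightarrow> 'a set \<Rightarrow> ('a \<Rightarrow> 'p \<Rightarrow> complex) \<Rightarrow> bool" where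
  "lin_indep_on Z K q \<longleftrightarrow> (\<forall>c. (\<forall>z\<in>Z. (\<Sum>k\<in>K. c k * q k z) = 0) \<longrightarrow> (\<forall>k\<in>K. c k = 0))"

definition in_span_on :: "'p set \<Rightarrow> 'a set \<Rightarrow> ('a \<Rightarrow> 'p \<Rightarrow> complex) \<Rightarrow> ('p \<Rightarrow> complex) \<Rightarrow> bool" where
  "in_span_on Z S b f \<longleftrightarrow> (\<exists>c. \<forall>z\<in>Z. f z = (\<Sum>u\<in>S. c u * b u z))"

text \<open>Steinitz: with fewer spanning functions than \<open>K\<close> has elements, the rows of
  coefficients satisfy a nontrivial linear relation.\<close>

lemma lin_indep_on_card_le:
  assumes "lin_indep_on Z K q" "finite K" "finite S" "\<And>k. k \<in> K \<Longrightarrow> in_span_on Z S b (q k)"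
  shows "card K \<le> card S"
proof (rule ccontr)
  assume "\<not> ?thesis"
  moreover obtain M where M: "\<And>k z. k \<in> K \<Longrightarrow> z \<in> Z \<Longrightarrow> q k z = (\<Sum>u\<in>S. M k u * b u z)"
    using assms(4) unfolding in_span_on_def by metis
  ultimately obtain a where a: "\<exists>k\<in>K. a k \<noteq> 0" "\<And>u. u \<in> S \<Longrightarrow> (\<Sum>k\<in>K. a k * M k u) = 0"
    using more_unknowns[OF assms(3,2), of M] by auto
  have "(\<Sum>k\<in>K. a k * q k z) = 0" if "z \<in> Z" for z
  proof -
    have "(\<Sum>k\<in>K. a k * q k z) = (\<Sum>k\<in>K. \<Sum>u\<in>S. a k * M k u * b u z)"
      using M that by (intro sum.cong) (auto simp: sum_distrib_left mult.assoc)
    also have "\<dots> = (\<Sum>u\<in>S. (\<Sum>k\<in>K. a k * M k u) * b u z)"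
      by (subst sum.swap) (simp add: sum_distrib_right)
    also have "\<dots> = 0" using a(2) by simp
    finally show ?thesis .
  qed
  then show False using assms(1) a(1) unfolding lin_indep_on_def by blast
qed

text \<open>\<open>hilb_ge V s Z m\<close>: the value at \<open>s\<close> of the affine Hilbert function of \<open>Z\<close> is at least \<open>m\<close>.\<close>

definition hilb_ge :: "'i set \<Rightarrow> nat \<Rightarrow> ('i \<Rightarrow> complex) set \<Rightarrow> nat \<Rightarrow> bool" where
  "hilb_ge V s Z m \<longleftrightarrow> (\<exists>q. (\<forall>k<m. q k \<in> poly_deg V s) \<and> lin_indep_on Z {..<m} q)"

text \<open>Multiples of \<open>f\<close> by functions that are independent on \<open>Z1\<close> vanish on \<open>Z0\<close>,
  hence they are independent of functions that are independent on \<open>Z0\<close>.\<close>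

lemma hilb_ge_step:
  assumes Z: "Z0 \<subseteq> Z1" "irr V Z1"
    and f: "f \<in> poly_deg V e" "\<And>z. z \<in> Z0 \<Longrightarrow> f z = 0" "\<exists>z\<in>Z1. f z \<noteq> 0"
    and h: "hilb_ge V t Z0 a" "hilb_ge V s Z1 b" "t \<le> s + e"
  shows "hilb_ge V (s + e) Z1 (a + b)"
proof -
  obtain q where q: "\<And>k. k < a \<Longrightarrow> q k \<in> poly_deg V t" "lin_indep_on Z0 {..<a} q"
    using h(1) by (auto simp: hilb_ge_def)
  obtain p where p: "\<And>k. k < b \<Longrightarrow> p k \<in> poly_deg V s" "lin_indep_on Z1 {..<b} p"
    using h(2) by (auto simp: hilb_ge_def)
  define g where "g k = (if k < a then q k else (\<lambda>x. p (k - a) x * f x))" for k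
  have deg: "g k \<in> poly_deg V (s + e)" if "k < a + b" for k
  proof (cases "k < a")
    case True
    then show ?thesis using q(1)[OF True] poly_deg_mono_deg h(3) by (auto simp: g_def)
  next
    case False
    then show ?thesis using that p(1)[of "k - a"] poly_deg_mult[OF _ f(1)] by (auto simp: g_def)
  qed
  have "lin_indep_on Z1 {..<a + b} g"
    unfolding lin_indep_on_def
  proof (intro allI impI)
    fix c assume "\<forall>z\<in>Z1. (\<Sum>k<a + b. c k * g k z) = 0"
    moreover have "(\<Sum>k<a + b. c k * g k z) =
        (\<Sum>k<a. c k * q k z) + (\<Sum>k<b. c (a + k) * p k z) * f z" for z
    proof -
      have "(\<Sum>k<a + b. c k * g k z) = (\<Sum>k<a. c k * g k z) + (\<Sum>k<b. c (a + k) * g (a + k) z)"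
        by (induction b) (simp_all add: add.assoc)
      then show ?thesis by (simp add: g_def sum_distrib_right mult.assoc)
    qed
    ultimately have z: "(\<Sum>k<a. c k * q k z) + (\<Sum>k<b. c (a + k) * p k z) * f z = 0"
      if "z \<in> Z1" for z using that by metis
    have "(\<Sum>k<a. c k * q k z) = 0" if "z \<in> Z0" for z
      using z[of z] f(2)[OF that] that Z(1) by auto
    then have c1: "\<forall>k<a. c k = 0"
      using q(2) unfolding lin_indep_on_def by blast
    have P: "(\<lambda>z. \<Sum>k<b. c (a + k) * p k z) \<in> poly_fun V"
      using p(1) poly_deg_PF by (intro poly_fun_sum poly_fun_mult poly_fun_const) auto
    have "(\<Sum>k<b. c (a + k) * p k z) * f z = 0" if "z \<in> Z1" for z
      using z[OF that] c1 by simp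
    then have "\<forall>z\<in>Z1. (\<Sum>k<b. c (a + k) * p k z) = 0"
      using irrD[OF Z(2) P poly_deg_PF[OF f(1)]] f(3) by blast
    then have "\<forall>k\<in>{..<b}. c (a + k) = 0"
      using p(2)[unfolded lin_indep_on_def, rule_format, of "\<lambda>k. c (a + k)"] by blast
    then have "c k = 0" if "k < a + b" for k
      using c1 that by (cases "k < a") (metis, metis add_less_cancel_left le_add_diff_inverse lessThan_iff not_less)
    then show "\<forall>k\<in>{..<a + b}. c k = 0" by auto
  qed
  then show ?thesis using deg by (auto simp: hilb_ge_def)
qed

text \<open>Dimension at least \<open>m\<close>, read off from the order of growth of the Hilbert
  function. The factor \<open>k\<close> absorbs the degrees of the polynomials used to produce the
  growth.\<close>

definition grows :: "'i set \<Rightarrow> ('i \<Rightarrow> complex) set \<Rightarrow> nat \<Rightarrow> bool" where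
  "grows V Z m \<longleftrightarrow> (\<exists>k. \<forall>s. hilb_ge V (k * s) Z (s ^ m))"

text \<open>Discrete integration: \<open>s\<close> applications of \<open>hilb_ge_step\<close> with
  the same \<open>f\<close> add \<open>s ^ m\<close> independent functions each, while the degree
  rises by \<open>e * s\<close> in total.\<close>

lemma grows_step:
  assumes Z: "Z0 \<subseteq> Z1" "irr V Z1" and f: "f \<in> poly_fun V" "\<And>z. z \<in> Z0 \<Longrightarrow> f z = 0" "\<exists>z\<in>Z1. f z \<noteq> 0"
    and "grows V Z0 m"
  shows "grows V Z1 (Suc m)"
proof -
  obtain e where e: "f \<in> poly_deg V e" using f(1) by (auto simp: poly_fun_def)
  obtain k where k: "\<And>s. hilb_ge V (k * s) Z0 (s ^ m)" using assms(6) by (auto simp: grows_def)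
  have "hilb_ge V (k * s + e * j) Z1 (j * s ^ m)" for s j
  proof (induction j)
    case 0
    then show ?case by (auto simp: hilb_ge_def lin_indep_on_def)
  next
    case (Suc j)
    show ?case using hilb_ge_step[OF Z e f(2,3) k[of s] Suc] by (simp add: algebra_simps)
  qed
  then have "hilb_ge V ((k + e) * s) Z1 (s ^ Suc m)" for s
    by (metis add_mult_distrib power_Suc)
  then show ?thesis unfolding grows_def by blast
qed

lemma grows_0: "Z \<noteq> {} \<Longrightarrow> grows V Z 0"
  unfolding grows_def hilb_ge_def
  by (intro exI[of _ 0] allI exI[of _ "\<lambda>_ _. 1"]) (auto simp: poly_deg_const lin_indep_on_def)

text \<open>Climbs a flag of coordinate subspaces with \<open>grows_step\<close>, in place of
  counting monomials.\<close>

lemma grows_UNIV: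
  assumes "finite I"
  shows "grows I UNIV (card I)"
proof -
  have "grows I {x. \<forall>i\<in>I - K. x i = 0} (card K)" if "finite K" "K \<subseteq> I" for K
    using that
  proof (induction K rule: finite_induct)
    case empty
    have "(\<lambda>_. 0) \<in> {x. \<forall>i\<in>I. x i = 0}" by auto
    then show ?case using grows_0[of "{x. \<forall>i\<in>I. x i = 0}" I] by auto
  next
    case (insert k K)
    have "grows I {x. \<forall>i\<in>I - insert k K. x i = 0} (Suc (card K))"
    proof (rule grows_step[OF _ _ poly_fun_coord[of k I] _ _ insert.IH])
      show "irr I {x. \<forall>i\<in>I - insert k K. x i = 0}"
        by (rule irr_affine) (auto intro!: exI[of _ "\<lambda>_. 0"])
      show "\<exists>z\<in>{x. \<forall>i\<in>I - insert k K. x i = (0::complex)}. z k \<noteq> 0"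
        proof -
        have "(\<lambda>i. if i = k then 1 else 0) \<in> {x. \<forall>i\<in>I - insert k K. x i = (0::complex)}" by auto
        then show ?thesis by (rule bexI[rotated]) simp
      qed
    qed (use insert in auto)
    then show ?case using insert by simp
  qed
  from this[OF assms] show ?thesis by simp
qed

lemma poly_deg_subst_linear:
  assumes "p \<in> poly_deg K s" "\<And>i. i \<in> K \<Longrightarrow> (\<lambda>x. L x i) \<in> poly_deg V (Suc 0)"
  shows "(\<lambda>x. p (L x)) \<in> poly_deg V s"
  using assms(1)
proof (induction rule: poly_deg_induct)
  case (var i s p)
  then show ?case using poly_deg_mult[OF assms(2)[OF var(1)] var(3)] by simp
qed (auto intro: poly_deg_intros)

text \<open>Composition with a dominant map is injective on polynomials, and a map of degree 1 does
  not raise degrees, so independent functions can be pulled back.\<close>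

lemma grows_dominant:
  assumes "finite K" "dominant K L Z" "\<And>i. i \<in> K \<Longrightarrow> (\<lambda>x. L x i) \<in> poly_deg V (Suc 0)"
  shows "grows V Z (card K)"
proof -
  obtain k where k: "\<And>s. hilb_ge K (k * s) UNIV (s ^ card K)"
    using grows_UNIV[OF assms(1)] by (auto simp: grows_def)
  have "hilb_ge V (k * s) Z (s ^ card K)" for s
  proof -
    obtain q where q: "\<And>j. j < s ^ card K \<Longrightarrow> q j \<in> poly_deg K (k * s)"
      "lin_indep_on UNIV {..<s ^ card K} q"
      using k[of s] by (auto simp: hilb_ge_def)
    have "lin_indep_on Z {..<s ^ card K} (\<lambda>j x. q j (L x))"
      unfolding lin_indep_on_def
    proof (intro allI impI)
      fix c assume c: "\<forall>z\<in>Z. (\<Sum>j<s ^ card K. c j * q j (L z)) = 0"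
      have "(\<lambda>x. \<Sum>j<s ^ card K. c j * q j x) \<in> poly_fun K"
        using q(1) poly_deg_PF by (intro poly_fun_sum poly_fun_mult poly_fun_const) auto
      then have "(\<Sum>j<s ^ card K. c j * q j x) = 0" for x
        by (rule dominantD[OF assms(2)]) (use c in auto)
      then show "\<forall>j\<in>{..<s ^ card K}. c j = 0"
        using q(2) by (auto simp: lin_indep_on_def)
    qed
    moreover have "(\<lambda>x. q j (L x)) \<in> poly_deg V (k * s)" if "j < s ^ card K" for j
      by (rule poly_deg_subst_linear[OF q(1)[OF that] assms(3)])
    ultimately show ?thesis
      unfolding hilb_ge_def by (intro exI[of _ "\<lambda>j x. q j (L x)"]) auto
  qed
  then show ?thesis unfolding grows_def by blast
qed

lemma grows_indep: "finite I \<Longrightarrow> indep I Z \<Longrightarrow> I \<subseteq> V \<Longrightarrow> grows V Z (card I)"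
  by (rule grows_dominant) (auto intro: poly_deg_coord)

lemma in_span_on_add:
  assumes "in_span_on Z S b f" "in_span_on Z S b g"
  shows "in_span_on Z S b (\<lambda>x. f x + g x)"
proof -
  obtain c d where "\<And>z. z \<in> Z \<Longrightarrow> f z = (\<Sum>u\<in>S. c u * b u z)" "\<And>z. z \<in> Z \<Longrightarrow> g z = (\<Sum>u\<in>S. d u * b u z)"
    using assms unfolding in_span_on_def by metis
  then show ?thesis unfolding in_span_on_def
    by (intro exI[of _ "\<lambda>u. c u + d u"]) (simp add: distrib_right sum.distrib)
qed

lemma in_span_on_cmult:
  assumes "in_span_on Z S b f"
  shows "in_span_on Z S b (\<lambda>x. c * f x)"
proof -
  obtain d where "\<And>z. z \<in> Z \<Longrightarrow> f z = (\<Sum>u\<in>S. d u * b u z)"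
    using assms unfolding in_span_on_def by metis
  then show ?thesis unfolding in_span_on_def
    by (intro exI[of _ "\<lambda>u. c * d u"]) (simp add: sum_distrib_left mult.assoc)
qed

lemma in_span_on_sum:
  "(\<And>k. k \<in> K \<Longrightarrow> in_span_on Z S b (f k)) \<Longrightarrow> in_span_on Z S b (\<lambda>x. \<Sum>k\<in>K. f k x)"
proof (induction K rule: infinite_finite_induct)
  case (insert k K)
  then show ?case using in_span_on_add[of Z S b "f k"] by auto
qed (auto simp: in_span_on_def intro!: exI[of _ "\<lambda>_. 0"])

lemma in_span_on_base:
  assumes "finite S" "u \<in> S"
  shows "in_span_on Z S b (b u)"
  unfolding in_span_on_def
proof (intro exI ballI)
  fix z
  have "(\<Sum>v\<in>S. (if v = u then 1 else 0) * b v z) = (\<Sum>v\<in>S. if v = u then b v z else 0)"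
    by (intro sum.cong) auto
  then show "b u z = (\<Sum>v\<in>S. (if v = u then 1 else 0) * b v z)"
    using assms by (simp add: sum.delta)
qed

lemma in_span_on_cong:
  "in_span_on Z S b f \<Longrightarrow> (\<And>z. z \<in> Z \<Longrightarrow> f z = g z) \<Longrightarrow> in_span_on Z S b g"
  unfolding in_span_on_def by metis

section \<open>Modules over monomials with bounded exponents\<close>

definition monomial :: "('k \<Rightarrow> 'p \<Rightarrow> complex) \<Rightarrow> 'k set \<Rightarrow> ('k \<Rightarrow> nat) \<Rightarrow> 'p \<Rightarrow> complex" where
  "monomial g K \<kappa> x = (\<Prod>i\<in>K. g i x ^ \<kappa> i)"

text \<open>A filtration of the module generated by the \<open>b u\<close> over the polynomials in
  the functions \<open>g i\<close>. Bounding each exponent separately, not the total degree, makes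
  the count in \<open>card_gspan_index\<close> a plain power.\<close>

definition gspan :: "'p set \<Rightarrow> ('k \<Rightarrow> 'p \<Rightarrow> complex) \<Rightarrow> 'k set \<Rightarrow> 'u set \<Rightarrow> ('u \<Rightarrow> 'p \<Rightarrow> complex) \<Rightarrow>
    nat \<Rightarrow> ('p \<Rightarrow> complex) \<Rightarrow> bool" where
  "gspan Z g K B b t = in_span_on Z ((K \<rightarrow>\<^sub>E {..t}) \<times> B) (\<lambda>(\<kappa>, u) x. monomial g K \<kappa> x * b u x)"

lemma gspan_add:
  "gspan Z g K B b t f \<Longrightarrow> gspan Z g K B b t h \<Longrightarrow> gspan Z g K B b t (\<lambda>x. f x + h x)"
  unfolding gspan_def by (rule in_span_on_add)

lemma gspan_cmult: "gspan Z g K B b t f \<Longrightarrow> gspan Z g K B b t (\<lambda>x. c * f x)"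
  unfolding gspan_def by (rule in_span_on_cmult)

lemma gspan_sum:
  "(\<And>k. k \<in> S \<Longrightarrow> gspan Z g K B b t (f k)) \<Longrightarrow> gspan Z g K B b t (\<lambda>x. \<Sum>k\<in>S. f k x)"
  unfolding gspan_def by (rule in_span_on_sum)

lemma gspan_cong:
  "gspan Z g K B b t f \<Longrightarrow> (\<And>z. z \<in> Z \<Longrightarrow> f z = h z) \<Longrightarrow> gspan Z g K B b t h"
  unfolding gspan_def by (rule in_span_on_cong)

lemma gspan_monomial_base:
  assumes "finite K" "finite B" "\<And>i. i \<in> K \<Longrightarrow> \<kappa> i \<le> t" "u \<in> B"
  shows "gspan Z g K B b t (\<lambda>x. monomial g K \<kappa> x * b u x)"
proof -
  have "finite ((K \<rightarrow>\<^sub>E {..t}) \<times> B)" "(restrict \<kappa> K, u) \<in> (K \<rightarrow>\<^sub>E {..t}) \<times> B"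
    using assms by (auto intro!: finite_PiE)
  from in_span_on_base[OF this, of Z "\<lambda>(\<kappa>, u) x. monomial g K \<kappa> x * b u x"]
  show ?thesis by (simp add: gspan_def monomial_def)
qed

text \<open>Multiplication by \<open>h\<close> commutes with the monomials, so its effect on the
  generators determines its effect on the module, and exponents add.\<close>

lemma gspan_mult:
  assumes "finite K" "finite B" "gspan Z g K B b t f"
    and "\<And>u. u \<in> B \<Longrightarrow> gspan Z g K B b s (\<lambda>x. h x * b u x)"
  shows "gspan Z g K B b (t + s) (\<lambda>x. h x * f x)"
proof -
  have *: "gspan Z g K B b (t + s) (\<lambda>x. monomial g K \<kappa> x * f x)"
    if k: "\<And>i. i \<in> K \<Longrightarrow> \<kappa> i \<le> t" and f: "gspan Z g K B b s f" for \<kappa> f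
  proof -
    obtain c where c: "\<And>z. z \<in> Z \<Longrightarrow> f z =
        (\<Sum>v\<in>(K \<rightarrow>\<^sub>E {..s}) \<times> B. c v * (monomial g K (fst v) z * b (snd v) z))"
      using f unfolding gspan_def in_span_on_def by (auto simp: case_prod_beta)
    have "gspan Z g K B b (t + s) (\<lambda>z. \<Sum>v\<in>(K \<rightarrow>\<^sub>E {..s}) \<times> B.
        c v * (monomial g K (\<lambda>i. \<kappa> i + fst v i) z * b (snd v) z))"
      by (intro gspan_sum gspan_cmult gspan_monomial_base)
        (use assms k in \<open>auto simp: PiE_iff intro: add_mono\<close>)
    then show ?thesis
      by (rule gspan_cong)
        (simp add: c monomial_def power_add prod.distrib sum_distrib_left ac_simps)
  qed
  obtain c where c: "\<And>z. z \<in> Z \<Longrightarrow> f z =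
      (\<Sum>v\<in>(K \<rightarrow>\<^sub>E {..t}) \<times> B. c v * (monomial g K (fst v) z * b (snd v) z))"
    using assms(3) unfolding gspan_def in_span_on_def by (auto simp: case_prod_beta)
  have "gspan Z g K B b (t + s) (\<lambda>z. \<Sum>v\<in>(K \<rightarrow>\<^sub>E {..t}) \<times> B.
      c v * (monomial g K (fst v) z * (h z * b (snd v) z)))"
    by (intro gspan_sum gspan_cmult *) (use assms in \<open>auto simp: PiE_iff\<close>)
  then show ?thesis
    by (rule gspan_cong) (simp add: c sum_distrib_left ac_simps)
qed

lemma gspan_mono:
  assumes "finite K" "finite B" "gspan Z g K B b s f" "s \<le> t"
  shows "gspan Z g K B b t f"
proof -
  have "gspan Z g K B b (s + (t - s)) (\<lambda>x. 1 * f x)"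
  proof (rule gspan_mult[OF assms(1-3)])
    fix u assume "u \<in> B"
    from gspan_monomial_base[OF assms(1,2) _ this, of "\<lambda>_. 0" "t - s" Z g b]
    show "gspan Z g K B b (t - s) (\<lambda>x. 1 * b u x)" by (simp add: monomial_def)
  qed
  then show ?thesis using assms(4) by simp
qed

lemma gspan_base:
  assumes "finite K" "finite B" "u \<in> B"
  shows "gspan Z g K B b t (b u)"
  using gspan_monomial_base[OF assms(1,2) _ assms(3), of "\<lambda>_. 0" t Z g b] by (simp add: monomial_def)

lemma gspan_coord:
  assumes "finite K" "finite B" "gspan Z g K B b s f" "i \<in> K"
  shows "gspan Z g K B b (Suc s) (\<lambda>x. g i x * f x)"
proof -
  have "gspan Z g K B b (s + 1) (\<lambda>x. g i x * f x)"
  proof (rule gspan_mult[OF assms(1-3)])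
    fix u assume "u \<in> B"
    have "monomial g K (\<lambda>j. if j = i then 1 else 0) x = g i x" for x
      using assms(1,4) prod.delta[OF assms(1), of i "\<lambda>i. g i x"]
      by (simp add: monomial_def if_distrib[of "\<lambda>n. _ ^ n"] cong: if_cong)
    then show "gspan Z g K B b 1 (\<lambda>x. g i x * b u x)"
      using gspan_monomial_base[OF assms(1,2) _ \<open>u \<in> B\<close>, of "\<lambda>j. if j = i then 1 else 0" 1 Z g b] by simp
  qed
  then show ?thesis by simp
qed

lemma gspan_poly_deg:
  assumes "finite K" "finite B" "p \<in> poly_deg K d" "gspan Z (\<lambda>i x. x i) K B b t f"
  shows "gspan Z (\<lambda>i x. x i) K B b (t + d) (\<lambda>x. p x * f x)"
  using assms(3)
proof (induction rule: poly_deg_induct)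
  case (const c d)
  show ?case by (rule gspan_cmult[OF gspan_mono[OF assms(1,2,4)]]) simp
next
  case (var i d p)
  then show ?case using gspan_coord[OF assms(1,2) var(3,1)] by (simp add: mult.assoc)
next
  case (add d p q)
  then show ?case using gspan_add[OF add(3,4)] by (simp add: distrib_right)
qed

lemma card_gspan_index:
  "finite K \<Longrightarrow> card ((K \<rightarrow>\<^sub>E {..t}) \<times> B) = (t + 1) ^ card K * card B"
  by (simp add: card_cartesian_product card_PiE)

lemma power_growth_le:
  fixes c m d N :: nat
  assumes "\<And>s. s ^ m \<le> (c * s + 1) ^ d * N"
  shows "m \<le> d"
proof (rule ccontr)
  assume "\<not> m \<le> d"
  \<comment> \<open>For \<open>s \<ge> 1\<close> the right-hand side is at most
    \<open>((c + 1) * s) ^ d * N\<close>; this \<open>s\<close> exceeds by one the constant that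
    remains after cancelling \<open>s ^ d\<close>.\<close>
  define s where "s = (c + 1) ^ d * N + 1"
  have s: "s \<ge> 1" by (simp add: s_def)
  have "s ^ d * s \<le> s ^ m"
    using \<open>\<not> m \<le> d\<close> s power_increasing[of "Suc d" m s] by (simp add: mult.commute)
  also have "\<dots> \<le> (c * s + 1) ^ d * N" by (rule assms)
  also have "\<dots> \<le> ((c + 1) * s) ^ d * N"
    using s by (intro mult_right_mono power_mono) auto
  also have "\<dots> = s ^ d * ((c + 1) ^ d * N)"
    by (simp only: power_mult_distrib mult_ac)
  finally have "s \<le> (c + 1) ^ d * N" using s by simp
  then show False by (simp add: s_def)
qed

section \<open>Polynomials in one distinguished coordinate\<close>

text \<open>Degree less than \<open>m\<close> in \<open>j\<close>, not at most \<open>m\<close>.\<close>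

primrec updeg :: "'i set \<Rightarrow> 'i \<Rightarrow> nat \<Rightarrow> (('i \<Rightarrow> complex) \<Rightarrow> complex) set" where
  "updeg W j 0 = {\<lambda>x. 0}"
| "updeg W j (Suc m) = {f. \<exists>b\<in>poly_fun W. \<exists>g\<in>updeg W j m. f = (\<lambda>x. b x * x j ^ m + g x)}"

declare updeg.simps(2) [simp del]

lemma updeg_SucI: "b \<in> poly_fun W \<Longrightarrow> g \<in> updeg W j m \<Longrightarrow> (\<lambda>x. b x * x j ^ m + g x) \<in> updeg W j (Suc m)"
  unfolding updeg.simps by blast

lemma updeg_SucE:
  assumes "f \<in> updeg W j (Suc m)"
  obtains b g where "f = (\<lambda>x. b x * x j ^ m + g x)" "b \<in> poly_fun W" "g \<in> updeg W j m"
  using assms unfolding updeg.simps by blast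

lemma updeg_zero: "(\<lambda>x. 0) \<in> updeg W j m"
proof (induction m)
  case (Suc m)
  then show ?case using updeg_SucI[OF poly_fun_const[of 0 W] Suc] by simp
qed auto

lemma updeg_mono: "f \<in> updeg W j m \<Longrightarrow> m \<le> n \<Longrightarrow> f \<in> updeg W j n"
proof (induction n)
  case (Suc n)
  show ?case
  proof (cases "m = Suc n")
    case False
    then show ?thesis using updeg_SucI[OF poly_fun_const[of 0 W] Suc.IH] Suc.prems by auto
  qed (use Suc in auto)
qed auto

lemma updeg_add: "f \<in> updeg W j m \<Longrightarrow> g \<in> updeg W j m \<Longrightarrow> (\<lambda>x. f x + g x) \<in> updeg W j m"
proof (induction m arbitrary: f g)
  case (Suc m)
  obtain b f' where f: "f = (\<lambda>x. b x * x j ^ m + f' x)" "b \<in> poly_fun W" "f' \<in> updeg W j m"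
    by (rule updeg_SucE[OF Suc.prems(1)])
  obtain c g' where g: "g = (\<lambda>x. c x * x j ^ m + g' x)" "c \<in> poly_fun W" "g' \<in> updeg W j m"
    by (rule updeg_SucE[OF Suc.prems(2)])
  have "(\<lambda>x. f x + g x) = (\<lambda>x. (b x + c x) * x j ^ m + (f' x + g' x))"
    by (simp add: f(1) g(1) algebra_simps)
  then show ?case using updeg_SucI[OF poly_fun_add[OF f(2) g(2)] Suc.IH[OF f(3) g(3)]] by simp
qed auto

lemma updeg_cmult: "f \<in> updeg W j m \<Longrightarrow> a \<in> poly_fun W \<Longrightarrow> (\<lambda>x. a x * f x) \<in> updeg W j m"
proof (induction m arbitrary: f)
  case (Suc m)
  obtain b f' where f: "f = (\<lambda>x. b x * x j ^ m + f' x)" "b \<in> poly_fun W" "f' \<in> updeg W j m"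
    by (rule updeg_SucE[OF Suc.prems(1)])
  have "(\<lambda>x. a x * f x) = (\<lambda>x. (a x * b x) * x j ^ m + a x * f' x)"
    by (simp add: f(1) algebra_simps)
  then show ?case
    using updeg_SucI[OF poly_fun_mult[OF Suc.prems(2) f(2)] Suc.IH[OF f(3) Suc.prems(2)]] by simp
qed auto

lemma updeg_var: "f \<in> updeg W j m \<Longrightarrow> (\<lambda>x. x j * f x) \<in> updeg W j (Suc m)"
proof (induction m arbitrary: f)
  case 0
  then show ?case using updeg_zero[of W j "Suc 0"] by simp
next
  case (Suc m)
  obtain b f' where f: "f = (\<lambda>x. b x * x j ^ m + f' x)" "b \<in> poly_fun W" "f' \<in> updeg W j m"
    by (rule updeg_SucE[OF Suc.prems(1)])
  have "(\<lambda>x. x j * f x) = (\<lambda>x. b x * x j ^ Suc m + x j * f' x)"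
    by (simp add: f(1) algebra_simps)
  then show ?case using updeg_SucI[OF f(2) Suc.IH[OF f(3)]] by simp
qed

lemma updeg_pow: "f \<in> updeg W j m \<Longrightarrow> (\<lambda>x. x j ^ d * f x) \<in> updeg W j (m + d)"
proof (induction d)
  case (Suc d)
  then have "(\<lambda>x. x j ^ d * f x) \<in> updeg W j (m + d)" by simp
  from updeg_var[OF this] show ?case by (simp add: mult.assoc)
qed auto

lemma updeg_poly_fun: "f \<in> updeg W j m \<Longrightarrow> f \<in> poly_fun (insert j W)"
proof (induction m arbitrary: f)
  case (Suc m)
  obtain b f' where f: "f = (\<lambda>x. b x * x j ^ m + f' x)" "b \<in> poly_fun W" "f' \<in> updeg W j m"
    by (rule updeg_SucE[OF Suc.prems(1)])
  have "b \<in> poly_fun (insert j W)" using poly_fun_mono[OF f(2)] by auto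
  then show ?case unfolding f(1) by (intro poly_fun_add poly_fun_mult poly_fun_power poly_fun_coord Suc.IH[OF f(3)]) auto
qed auto

lemma poly_fun_updeg:
  assumes "f \<in> poly_fun (insert j W)"
  shows "\<exists>m. f \<in> updeg W j m"
  using assms
proof (induction rule: poly_fun_induct)
  case (const c)
  have "(\<lambda>x. c * x j ^ 0 + 0) \<in> updeg W j (Suc 0)"
    by (intro updeg_SucI updeg_zero) auto
  then show ?case by (intro exI[of _ "Suc 0"]) simp
next
  case (var i p)
  then obtain m where m: "p \<in> updeg W j m" by blast
  show ?case
  proof (cases "i = j")
    case True
    show ?thesis by (rule exI[of _ "Suc m"]) (use updeg_var[OF m] True in simp)
  next
    case False
    then have "i \<in> W" using var by blast
    then show ?thesis using updeg_cmult[OF m poly_fun_coord[of i W]] by (intro exI)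
  qed
next
  case (add p q)
  then obtain m n where "p \<in> updeg W j m" "q \<in> updeg W j n" by blast
  then have "p \<in> updeg W j (max m n)" "q \<in> updeg W j (max m n)"
    using updeg_mono by (meson max.cobounded1, meson max.cobounded2)
  from updeg_add[OF this] show ?case by (rule exI[of _ "max m n"])
qed

lemma updeg_lead:
  assumes "p \<in> updeg W j m" "\<exists>x. p x \<noteq> 0"
  obtains a n r where "a \<in> poly_fun W" "\<exists>x. a x \<noteq> 0" "r \<in> updeg W j n" "\<forall>x. p x = a x * x j ^ n + r x"
proof -
  have "\<exists>a n r. a \<in> poly_fun W \<and> (\<exists>x. a x \<noteq> 0) \<and> r \<in> updeg W j n \<and> (\<forall>x. p x = a x * x j ^ n + r x)"
    using assms
  proof (induction m arbitrary: p)
    case (Suc m)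
    obtain b f' where f: "p = (\<lambda>x. b x * x j ^ m + f' x)" "b \<in> poly_fun W" "f' \<in> updeg W j m"
      by (rule updeg_SucE[OF Suc.prems(1)])
    show ?case
    proof (cases "\<exists>x. b x \<noteq> 0")
      case True
      then show ?thesis using f by (intro exI[of _ b] exI[of _ m] exI[of _ f']) auto
    next
      case False
      then have "p = f'" using f by auto
      then show ?thesis using Suc.IH[OF f(3)] Suc.prems(2) by simp
    qed
  qed auto
  then obtain a n r where "a \<in> poly_fun W \<and> (\<exists>x. a x \<noteq> 0) \<and> r \<in> updeg W j n \<and> (\<forall>x. p x = a x * x j ^ n + r x)"
    by (elim exE)
  then show ?thesis by (intro that[of a r n]) simp_all
qed

lemma not_dominantE:
  assumes "\<not> dominant K L Z"
  obtains p where "p \<in> poly_fun K" "\<forall>z\<in>Z. p (L z) = 0" "\<exists>x. p x \<noteq> 0"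
proof -
  have "\<exists>p\<in>poly_fun K. (\<forall>z\<in>Z. p (L z) = 0) \<and> (\<exists>x. p x \<noteq> 0)"
    using assms by (simp add: dominant_def)
  then obtain p where "p \<in> poly_fun K" "(\<forall>z\<in>Z. p (L z) = 0) \<and> (\<exists>x. p x \<noteq> 0)" by (elim bexE)
  then show ?thesis by (intro that[of p]) simp_all
qed

text \<open>The leading coefficient of a relation involves only the independent coordinates
  \<open>I\<close>, hence cannot vanish on all of \<open>Z\<close>. For the same reason the degree
  in the coordinate \<open>j\<close> is positive.\<close>

lemma not_indep_insert:
  assumes "indep I Z" "\<not> indep (insert j I) Z"
  obtains a n r where "a \<in> poly_fun I" "\<exists>z\<in>Z. a z \<noteq> 0" "n > 0" "r \<in> updeg I j n"
    "\<forall>z\<in>Z. a z * z j ^ n + r z = 0"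
proof -
  obtain p where p: "p \<in> poly_fun (insert j I)" "\<forall>z\<in>Z. p z = 0" "\<exists>x. p x \<noteq> 0"
    by (rule not_dominantE[OF assms(2)])
  obtain m where m: "p \<in> updeg I j m" using poly_fun_updeg[OF p(1)] by blast
  obtain a n r where a: "a \<in> poly_fun I" "\<exists>x. a x \<noteq> 0" "r \<in> updeg I j n" "\<forall>x. p x = a x * x j ^ n + r x"
    by (rule updeg_lead[OF m p(3)])
  have az: "\<exists>z\<in>Z. a z \<noteq> 0"
  proof (rule ccontr)
    assume nz: "\<not> ?thesis"
    have "a x = 0" for x by (rule dominantD[OF assms(1) a(1)]) (use nz in auto)
    then show False using a(2) by simp
  qed
  have n: "n > 0"
  proof (rule ccontr)
    assume "\<not> n > 0"
    then show False using a(3,4) p(2) az by auto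
  qed
  show ?thesis
    by (rule that[OF a(1) az n a(3)]) (use a(4) p(2) in simp)
qed

section \<open>Hilbert functions of irreducible sets\<close>

text \<open>The set \<open>E\<close> serves as its own index set. Degrees of the coefficients are
  bounded only later, by \<open>poly_fun_common_deg\<close>.\<close>

definition modspan :: "('i \<Rightarrow> complex) set \<Rightarrow> 'i set \<Rightarrow> (('i \<Rightarrow> complex) \<Rightarrow> complex) set \<Rightarrow>
    (('i \<Rightarrow> complex) \<Rightarrow> complex) \<Rightarrow> bool" where
  "modspan Z I E f \<longleftrightarrow> (\<exists>q. (\<forall>e\<in>E. q e \<in> poly_fun I) \<and> (\<forall>z\<in>Z. f z = (\<Sum>e\<in>E. q e z * e z)))"

lemma modspanE:
  assumes "modspan Z I E f"
  obtains q where "\<forall>e\<in>E. q e \<in> poly_fun I" "\<forall>z\<in>Z. f z = (\<Sum>e\<in>E. q e z * e z)"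
proof -
  obtain q where "(\<forall>e\<in>E. q e \<in> poly_fun I) \<and> (\<forall>z\<in>Z. f z = (\<Sum>e\<in>E. q e z * e z))"
    using assms unfolding modspan_def by (elim exE)
  then show ?thesis by (intro that[of q]) simp_all
qed

lemma modspan_add:
  assumes "modspan Z I E f" "modspan Z I E g"
  shows "modspan Z I E (\<lambda>x. f x + g x)"
proof -
  obtain p where p: "\<forall>e\<in>E. p e \<in> poly_fun I" "\<forall>z\<in>Z. f z = (\<Sum>e\<in>E. p e z * e z)"
    by (rule modspanE[OF assms(1)])
  obtain q where q: "\<forall>e\<in>E. q e \<in> poly_fun I" "\<forall>z\<in>Z. g z = (\<Sum>e\<in>E. q e z * e z)"
    by (rule modspanE[OF assms(2)])
  show ?thesis unfolding modspan_def
    by (rule exI[of _ "\<lambda>e x. p e x + q e x"]) (use p q in \<open>simp add: poly_fun_add distrib_right sum.distrib\<close>)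
qed

lemma modspan_mult:
  assumes "modspan Z I E f" "a \<in> poly_fun I"
  shows "modspan Z I E (\<lambda>x. a x * f x)"
proof -
  obtain p where p: "\<forall>e\<in>E. p e \<in> poly_fun I" "\<forall>z\<in>Z. f z = (\<Sum>e\<in>E. p e z * e z)"
    by (rule modspanE[OF assms(1)])
  show ?thesis unfolding modspan_def
    by (rule exI[of _ "\<lambda>e x. a x * p e x"])
      (use p in \<open>simp add: poly_fun_mult assms(2) sum_distrib_left mult.assoc\<close>)
qed

lemma modspan_zero: "modspan Z I E (\<lambda>x. 0)"
  unfolding modspan_def by (intro exI[of _ "\<lambda>e x. 0"]) auto

lemma modspan_sum:
  "(\<And>k. k \<in> K \<Longrightarrow> modspan Z I E (f k)) \<Longrightarrow> modspan Z I E (\<lambda>x. \<Sum>k\<in>K. f k x)"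
  by (induction K rule: infinite_finite_induct) (auto intro: modspan_add modspan_zero)

lemma modspan_cong: "modspan Z I E f \<Longrightarrow> (\<And>z. z \<in> Z \<Longrightarrow> f z = g z) \<Longrightarrow> modspan Z I E g"
  unfolding modspan_def by simp

lemma modspan_base:
  assumes "finite E" "u \<in> E"
  shows "modspan Z I E u"
  unfolding modspan_def
proof (intro exI conjI ballI)
  fix z
  have "(\<Sum>e\<in>E. (if e = u then 1 else 0) * e z) = (\<Sum>e\<in>E. if e = u then e z else 0)"
    by (intro sum.cong) auto
  then show "u z = (\<Sum>e\<in>E. (\<lambda>e x. if e = u then 1 else 0) e z * e z)"
    using assms by (simp add: sum.delta)
qed simp

lemma modspan_updeg:
  assumes "r \<in> updeg I j n" "\<And>k. k < n \<Longrightarrow> modspan Z I E (\<lambda>x. x j ^ k * e x)"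
  shows "modspan Z I E (\<lambda>x. r x * e x)"
  using assms
proof (induction n arbitrary: r)
  case 0
  then show ?case by (simp add: modspan_zero)
next
  case (Suc n)
  obtain b f where f: "r = (\<lambda>x. b x * x j ^ n + f x)" "b \<in> poly_fun I" "f \<in> updeg I j n"
    by (rule updeg_SucE[OF Suc.prems(1)])
  have "modspan Z I E (\<lambda>x. f x * e x)"
    by (rule Suc.IH[OF f(3)]) (simp add: Suc.prems(2))
  from modspan_add[OF modspan_mult[OF Suc.prems(2)[of n] f(2)] this]
  show ?case by (simp add: f(1) algebra_simps)
qed

lemma modspan_trans:
  assumes "modspan Z I E f" "\<And>e. e \<in> E \<Longrightarrow> modspan Z I E' (\<lambda>x. h x * e x)"
  shows "modspan Z I E' (\<lambda>x. h x * f x)"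
proof -
  obtain p where p: "\<forall>e\<in>E. p e \<in> poly_fun I" "\<forall>z\<in>Z. f z = (\<Sum>e\<in>E. p e z * e z)"
    by (rule modspanE[OF assms(1)])
  have "modspan Z I E' (\<lambda>x. \<Sum>e\<in>E. p e x * (h x * e x))"
    by (intro modspan_sum modspan_mult[OF assms(2)]) (use p in auto)
  then show ?thesis
    by (rule modspan_cong) (simp add: p sum_distrib_left ac_simps)
qed

text \<open>The factor \<open>a\<close> is the product of the leading coefficients of algebraic relations for the coordinates in \<open>D\<close>;
  it allows to eliminate all powers of these coordinates beyond the degrees of the relations.\<close>

lemma maximal_indep_finite_module:
  assumes "indep I Z" "irr V Z" "I \<subseteq> V" "finite D" "\<And>j. j \<in> D \<Longrightarrow> \<not> indep (insert j I) Z"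
  shows "\<exists>a\<in>poly_fun I. (\<exists>z\<in>Z. a z \<noteq> 0) \<and> (\<exists>E. finite E \<and> (\<lambda>x. 1) \<in> E \<and>
    (\<forall>i\<in>I \<union> D. \<forall>e\<in>E. modspan Z I E (\<lambda>x. a x * x i * e x)))"
  using assms(4,5)
proof (induction D rule: finite_induct)
  case empty
  obtain z where "z \<in> Z" using assms(2) by (auto simp: irr_def)
  moreover have "modspan Z I {\<lambda>x. 1} (\<lambda>x. x i * 1)" if "i \<in> I" for i
    by (rule modspan_mult[OF modspan_base poly_fun_coord[OF that]]) auto
  ultimately show ?case
    by (intro bexI[where x="\<lambda>x. 1" and A="poly_fun I"] conjI exI[of _ "{\<lambda>x. 1}"]) auto
next
  case (insert j D)
  have "\<exists>a\<in>poly_fun I. (\<exists>z\<in>Z. a z \<noteq> 0) \<and> (\<exists>E. finite E \<and> (\<lambda>x. 1) \<in> E \<and>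
      (\<forall>i\<in>I \<union> D. \<forall>e\<in>E. modspan Z I E (\<lambda>x. a x * x i * e x)))"
    by (rule insert.IH, rule insert.prems) simp
  then obtain a where a: "a \<in> poly_fun I" "(\<exists>z\<in>Z. a z \<noteq> 0) \<and> (\<exists>E. finite E \<and> (\<lambda>x. 1) \<in> E \<and>
      (\<forall>i\<in>I \<union> D. \<forall>e\<in>E. modspan Z I E (\<lambda>x. a x * x i * e x)))"
    by (elim bexE)
  from a(2) obtain E where az: "\<exists>z\<in>Z. a z \<noteq> 0" and E: "finite E" "(\<lambda>x. 1) \<in> E"
    and aE: "\<forall>i\<in>I \<union> D. \<forall>e\<in>E. modspan Z I E (\<lambda>x. a x * x i * e x)"
    by (elim conjE exE)
  obtain b n r where b: "b \<in> poly_fun I" "\<exists>z\<in>Z. b z \<noteq> 0" "n > 0" "r \<in> updeg I j n"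
    "\<forall>z\<in>Z. b z * z j ^ n + r z = 0"
    by (rule not_indep_insert[OF assms(1) insert.prems[of j]]) simp
  \<comment> \<open>The relation of degree \<open>n\<close> for \<open>j\<close> leaves the powers
    below \<open>n\<close> as new generators over the old ones.\<close>
  define E' where "E' = (\<lambda>(e, k) x. x j ^ k * e x) ` (E \<times> {..<n})"
  have E': "finite E'" "(\<lambda>x. 1) \<in> E'"
  proof -
    show "(\<lambda>x. 1) \<in> E'" unfolding E'_def
      by (rule image_eqI[of _ _ "(\<lambda>x. 1, 0)"]) (use E b in auto)
  qed (use E in \<open>auto simp: E'_def\<close>)
  have base: "modspan Z I E' (\<lambda>x. x j ^ k * e x)" if "e \<in> E" "k < n" for e k
    by (rule modspan_base[OF E'(1)]) (use that in \<open>auto simp: E'_def\<close>)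
  have ab: "(\<lambda>x. a x * b x) \<in> poly_fun I" by (rule poly_fun_mult[OF a(1) b(1)])
  have "modspan Z I E' (\<lambda>x. (a x * b x) * x i * u x)" if i: "i \<in> I \<union> insert j D" and "u \<in> E'" for i u
  proof -
    obtain e k where u: "u = (\<lambda>x. x j ^ k * e x)" "e \<in> E" "k < n" using \<open>u \<in> E'\<close> by (auto simp: E'_def)
    show ?thesis
    proof (cases "i = j")
      case False
      then have "i \<in> I \<union> D" using i by auto
      have "modspan Z I E' (\<lambda>x. x j ^ k * (a x * x i * e x))"
        by (rule modspan_trans[OF aE[rule_format, OF \<open>i \<in> I \<union> D\<close> u(2)] base[OF _ u(3)]])
      from modspan_mult[OF this b(1)] show ?thesis by (simp add: u(1) ac_simps)
    next
      case True
      show ?thesis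
      proof (cases "Suc k < n")
        case True
        from modspan_mult[OF base[OF u(2) True] ab] show ?thesis
          by (simp add: u(1) \<open>i = j\<close> ac_simps)
      next
        case False
        \<comment> \<open>The product reaches \<open>x j ^ n\<close>; the relation rewrites
          \<open>b x * x j ^ n\<close> as \<open>- r x\<close>, which has lower degree in
          \<open>j\<close>.\<close>
        then have n: "n = Suc k" using u(3) by simp
        have "modspan Z I E' (\<lambda>x. r x * e x)"
          by (rule modspan_updeg[OF b(4) base[OF u(2)]])
        from modspan_mult[OF this poly_fun_uminus[OF a(1)]]
        show ?thesis
        proof (rule modspan_cong)
          fix z assume "z \<in> Z"
          then have "r z = - (b z * z j ^ n)" using bspec[OF b(5)] by (simp add: eq_neg_iff_add_eq_0 add.commute)
          then show "- a z * (r z * e z) = a z * b z * z i * u z"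
            by (simp add: u(1) \<open>i = j\<close> n ac_simps)
        qed
      qed
    qed
  qed
  moreover have "\<exists>z\<in>Z. a z * b z \<noteq> 0"
  proof (rule ccontr)
    assume "\<not> ?thesis"
    then have "(\<forall>z\<in>Z. a z = 0) \<or> (\<forall>z\<in>Z. b z = 0)"
      using irrD[OF assms(2) poly_fun_mono[OF a(1) assms(3)] poly_fun_mono[OF b(1) assms(3)]] by simp
    then show False using az b(2) by blast
  qed
  ultimately show ?case using ab E'
    by (intro bexI[where x="\<lambda>x. a x * b x" and A="poly_fun I"] conjI exI[of _ E']) auto
qed

lemma poly_fun_common_deg:
  assumes "finite Q" "Q \<subseteq> poly_fun I"
  shows "\<exists>c. Q \<subseteq> poly_deg I c"
  using assms
proof (induction Q rule: finite_induct)
  case (insert q Q)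
  then obtain c d where "Q \<subseteq> poly_deg I c" "q \<in> poly_deg I d" by (auto simp: poly_fun_def)
  then have "insert q Q \<subseteq> poly_deg I (max c d)"
    using poly_deg_mono_deg[of _ I c "max c d"] poly_deg_mono_deg[of q I d "max c d"] by auto
  then show ?case by blast
qed auto

text \<open>All coordinates are algebraic over \<open>I\<close>. So polynomials of degree
  \<open>s\<close>, multiplied by \<open>a ^ s\<close>, lie in a finite module over the polynomials
  in \<open>I\<close>, with exponents bounded linearly in \<open>s\<close>; the Hilbert function has
  order at most \<open>card I\<close>.\<close>

lemma grows_le_maximal_indep:
  assumes fin: "finite V" and Z: "irr V Z" and I: "I \<subseteq> V" "indep I Z"
    and max: "\<And>j. j \<in> V - I \<Longrightarrow> \<not> indep (insert j I) Z" and "grows V Z m"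
  shows "m \<le> card I"
proof -
  have finI: "finite I" using fin I finite_subset by blast
  have "\<exists>a\<in>poly_fun I. (\<exists>z\<in>Z. a z \<noteq> 0) \<and> (\<exists>E. finite E \<and> (\<lambda>x. 1) \<in> E \<and>
      (\<forall>i\<in>I \<union> (V - I). \<forall>e\<in>E. modspan Z I E (\<lambda>x. a x * x i * e x)))"
    by (rule maximal_indep_finite_module[OF I(2) Z I(1) finite_Diff[OF fin]], rule max)
  then obtain a where a: "a \<in> poly_fun I" "(\<exists>z\<in>Z. a z \<noteq> 0) \<and> (\<exists>E. finite E \<and> (\<lambda>x. 1) \<in> E \<and>
      (\<forall>i\<in>I \<union> (V - I). \<forall>e\<in>E. modspan Z I E (\<lambda>x. a x * x i * e x)))"
    by (elim bexE)
  from a(2) obtain E where az: "\<exists>z\<in>Z. a z \<noteq> 0" and E: "finite E" "(\<lambda>x. 1) \<in> E"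
    and aE: "\<forall>i\<in>I \<union> (V - I). \<forall>e\<in>E. modspan Z I E (\<lambda>x. a x * x i * e x)"
    by (elim conjE exE)
  define rel where "rel i e q \<longleftrightarrow> (\<forall>e'\<in>E. q e' \<in> poly_fun I) \<and>
    (\<forall>z\<in>Z. a z * z i * e z = (\<Sum>e'\<in>E. q e' z * e' z))" for i e and q :: "_ \<Rightarrow> _ \<Rightarrow> complex"
  define q where "q i e = (SOME q. rel i e q)" for i e
  have rel: "rel i e (q i e)" if "i \<in> V" "e \<in> E" for i e
  proof -
    have "modspan Z I E (\<lambda>x. a x * x i * e x)" using aE that by simp
    then have "\<exists>q. rel i e q" unfolding modspan_def rel_def .
    then show ?thesis unfolding q_def by (rule someI_ex)
  qed
  have q: "q i e e' \<in> poly_fun I" if "i \<in> V" "e \<in> E" "e' \<in> E" for i e e'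
    using rel[OF that(1,2)] that(3) unfolding rel_def by simp
  have qsum: "a z * z i * e z = (\<Sum>e'\<in>E. q i e e' z * e' z)" if "i \<in> V" "e \<in> E" "z \<in> Z" for i e z
    using rel[OF that(1,2)] that(3) unfolding rel_def by simp
  have "\<exists>c. insert a ((\<lambda>(i, e, e'). q i e e') ` (V \<times> E \<times> E)) \<subseteq> poly_deg I c"
    by (rule poly_fun_common_deg) (use fin E a q in auto)
  then obtain c where c0: "insert a ((\<lambda>(i, e, e'). q i e e') ` (V \<times> E \<times> E)) \<subseteq> poly_deg I c"
    by (elim exE)
  have c: "q i e e' \<in> poly_deg I c" if "i \<in> V" "e \<in> E" "e' \<in> E" for i e e'
    using c0 that by (auto simp: image_subset_iff)
  have ca: "a \<in> poly_deg I c" using c0 by simp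
  let ?g = "gspan Z (\<lambda>i x. x i) I E (\<lambda>e. e)"
  note fE = finI E(1)
  have step: "?g c (\<lambda>x. a x * x i * e x)" if "i \<in> V" "e \<in> E" for i e
  proof -
    have "?g (0 + c) (\<lambda>z. \<Sum>e'\<in>E. q i e e' z * e' z)"
      by (intro gspan_sum gspan_poly_deg[OF fE c[OF that]] gspan_base[OF fE])
    then show ?thesis by (intro gspan_cong[OF _ sym[OF qsum[OF that]]]) simp_all
  qed
  have astep: "?g (t + c) (\<lambda>x. a x * f x)" if "?g t f" for t f
    by (rule gspan_poly_deg[OF fE ca that])
  \<comment> \<open>Each coordinate factor of \<open>p\<close> uses up one factor \<open>a\<close>
    and raises the exponents by at most \<open>c\<close>; spare factors \<open>a\<close> are
    absorbed by \<open>astep\<close>.\<close>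
  have span: "?g (c * s) (\<lambda>x. a x ^ s * p x)" if "p \<in> poly_deg V s" for s p
    using that
  proof (induction rule: poly_deg_induct)
    case (const d s)
    have "?g (c * s) (\<lambda>x. a x ^ s * 1)"
    proof (induction s)
      case 0
      then show ?case using gspan_base[OF fE E(2)] by simp
    next
      case (Suc s)
      from astep[OF this] show ?case by (simp add: algebra_simps)
    qed
    from gspan_cmult[OF this, of d] show ?case by (simp add: mult.commute)
  next
    case (var i s p)
    have "?g (c * s + c) (\<lambda>x. (a x * x i) * (a x ^ s * p x))"
      by (rule gspan_mult[OF fE var(3) step[OF var(1)]])
    then show ?case by (simp add: algebra_simps)
  next
    case (add s p q)
    then show ?case using gspan_add[OF add(3,4)] by (simp add: distrib_left)
  qed
  have bound: "m' \<le> (c * s + 1) ^ card I * card E" if "hilb_ge V s Z m'" for s m'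
  proof -
    obtain p where p: "\<And>k. k < m' \<Longrightarrow> p k \<in> poly_deg V s" "lin_indep_on Z {..<m'} p"
      using \<open>hilb_ge V s Z m'\<close> by (auto simp: hilb_ge_def)
    \<comment> \<open>Multiplication by \<open>a ^ s\<close> is injective on polynomial functions on
      \<open>Z\<close>, by irreducibility.\<close>
    have "lin_indep_on Z {..<m'} (\<lambda>k x. a x ^ s * p k x)"
      unfolding lin_indep_on_def
    proof (intro allI impI)
      fix d assume d: "\<forall>z\<in>Z. (\<Sum>k<m'. d k * (a z ^ s * p k z)) = 0"
      have "(\<lambda>z. \<Sum>k<m'. d k * p k z) \<in> poly_fun V"
        using p(1) poly_deg_PF by (intro poly_fun_sum poly_fun_mult poly_fun_const) auto
      then have "\<forall>z\<in>Z. (\<Sum>k<m'. d k * p k z) = 0"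
      proof (rule irr_power[OF Z poly_fun_mono[OF a(1) I(1)] az, of _ s])
        fix z assume "z \<in> Z"
        then show "a z ^ s * (\<Sum>k<m'. d k * p k z) = 0"
          using d by (simp add: sum_distrib_left ac_simps)
      qed
      then show "\<forall>k\<in>{..<m'}. d k = 0" using p(2) by (auto simp: lin_indep_on_def)
    qed
    then have "card {..<m'} \<le> card ((I \<rightarrow>\<^sub>E {..c * s}) \<times> E)"
      by (rule lin_indep_on_card_le) (use span p(1) fE in \<open>auto simp: gspan_def intro!: finite_PiE\<close>)
    then show ?thesis by (simp add: card_gspan_index[OF finI])
  qed
  obtain k where k: "\<And>s. hilb_ge V (k * s) Z (s ^ m)" using assms(6) by (auto simp: grows_def)
  have "s ^ m \<le> (c * k * s + 1) ^ card I * card E" for s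
    using bound[OF k[of s]] by (simp add: mult.assoc)
  then show ?thesis by (rule power_growth_le)
qed

lemma indep_extend:
  assumes "finite V" "K \<subseteq> V" "indep K Z"
  obtains I where "K \<subseteq> I" "I \<subseteq> V" "indep I Z" "\<forall>j\<in>V - I. \<not> indep (insert j I) Z"
proof -
  define F where "F = {I. K \<subseteq> I \<and> I \<subseteq> V \<and> indep I Z}"
  have "finite F" "F \<noteq> {}" using assms by (auto simp: F_def)
  then obtain I where I: "I \<in> F" "\<forall>I'\<in>F. I \<subseteq> I' \<longrightarrow> I = I'"
    using finite_has_maximal[of F] by auto
  have "\<not> indep (insert j I) Z" if "j \<in> V - I" for j
    using I(2)[rule_format, of "insert j I"] I(1) that by (auto simp: F_def)
  then show ?thesis using I(1) by (intro that[of I]) (simp_all add: F_def)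
qed

text \<open>On an irreducible set every maximal independent set reaches the order of growth, so any
  \<open>K\<close> extends to a large one. This property of transcendence bases fails for reducible
  sets.\<close>

lemma irr_indep_extend:
  assumes "finite V" "irr V Z" "K \<subseteq> V" "indep K Z" "grows V Z m"
  obtains I where "K \<subseteq> I" "I \<subseteq> V" "indep I Z" "m \<le> card I"
    "\<forall>j\<in>V - I. \<not> indep (insert j I) Z"
proof -
  obtain I where I: "K \<subseteq> I" "I \<subseteq> V" "indep I Z" "\<forall>j\<in>V - I. \<not> indep (insert j I) Z"
    by (rule indep_extend[OF assms(1,3,4)])
  show ?thesis
    by (rule that[OF I(1-3) grows_le_maximal_indep[OF assms(1,2) I(2,3) bspec[OF I(4)] assms(5)] I(4)])
qed

lemma indep_empty: "Z \<noteq> {} \<Longrightarrow> indep {} Z"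
  unfolding dominant_def
proof (intro ballI impI allI)
  fix p x assume "Z \<noteq> {}" "p \<in> poly_fun {}" "\<forall>z\<in>Z. p z = 0"
  then obtain z where "z \<in> Z" "p z = 0" by auto
  then show "p x = 0" using poly_fun_cong[OF \<open>p \<in> poly_fun {}\<close>, of x z] by simp
qed

section \<open>Specialization of prime ideals\<close>

lemma updeg_uminus: "f \<in> updeg W j m \<Longrightarrow> (\<lambda>x. - f x) \<in> updeg W j m"
  using updeg_cmult[OF _ poly_fun_const[of "-1"], of f W j m] by simp

lemma updeg_diff:
  assumes "f \<in> updeg W j m" "g \<in> updeg W j m"
  shows "(\<lambda>x. f x - g x) \<in> updeg W j m"
  using updeg_add[OF assms(1) updeg_uminus[OF assms(2)]] by simp

lemma updeg_pseudo_div_step: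
  assumes "a \<in> poly_fun W" "r \<in> updeg W j n" "b \<in> poly_fun W" "f \<in> updeg W j (n + d)"
  shows "(\<lambda>x. a x * (b x * x j ^ (n + d) + f x) - b x * x j ^ d * (a x * x j ^ n + r x)) \<in> updeg W j (n + d)"
proof -
  have "(\<lambda>x. a x * f x - b x * (x j ^ d * r x)) \<in> updeg W j (n + d)"
    by (intro updeg_diff updeg_cmult updeg_pow assms)
  then show ?thesis by (simp add: algebra_simps power_add)
qed

text \<open>The leading coefficient \<open>a\<close> cannot be inverted, so the dividend is
  multiplied by a power of it.\<close>

lemma updeg_pseudo_div:
  assumes "a \<in> poly_fun W" "r \<in> updeg W j n" "f \<in> updeg W j (n + d)"
  shows "\<exists>k. \<exists>s\<in>updeg W j d. \<exists>t\<in>updeg W j n. \<forall>x. a x ^ k * f x = (a x * x j ^ n + r x) * s x + t x"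
  using assms(3)
proof (induction d arbitrary: f)
  case 0
  then show ?case
    by (intro exI[of _ 0] bexI[where x="\<lambda>x. 0" and A="updeg W j 0"] bexI[where x=f and A="updeg W j n"]) auto
next
  case (Suc d)
  obtain b f' where f: "f = (\<lambda>x. b x * x j ^ (n + d) + f' x)" "b \<in> poly_fun W" "f' \<in> updeg W j (n + d)"
    by (rule updeg_SucE[OF Suc.prems[simplified]])
  define g where "g = (\<lambda>x. a x * f x - b x * x j ^ d * (a x * x j ^ n + r x))"
  have "g \<in> updeg W j (n + d)"
    unfolding g_def f(1) by (rule updeg_pseudo_div_step[OF assms(1,2) f(2,3)])
  from Suc.IH[OF this] obtain k s t where st: "s \<in> updeg W j d" "t \<in> updeg W j n"
    "\<forall>x. a x ^ k * g x = (a x * x j ^ n + r x) * s x + t x" by (elim exE bexE)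
  have "(\<lambda>x. (a x ^ k * b x) * x j ^ d + s x) \<in> updeg W j (Suc d)"
    by (intro updeg_SucI st poly_fun_mult poly_fun_power f assms)
  moreover have "a x ^ Suc k * f x = (a x * x j ^ n + r x) * ((a x ^ k * b x) * x j ^ d + s x) + t x" for x
  proof -
    have "a x ^ Suc k * f x = a x ^ k * g x + a x ^ k * (b x * x j ^ d * (a x * x j ^ n + r x))"
      by (simp add: g_def algebra_simps)
    then show ?thesis using st(3) by (simp add: algebra_simps)
  qed
  ultimately show ?case using st(2)
    by (intro exI[of _ "Suc k"] bexI[where x=t and A="updeg W j n"]
        bexI[where x="\<lambda>x. (a x ^ k * b x) * x j ^ d + s x" and A="updeg W j (Suc d)"]) auto
qed

text \<open>Exposes the leading coefficient \<open>a ^ k * b\<close> of the quotient; in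
  \<open>specialize_step\<close> it must be known to lie outside the prime ideal.\<close>

lemma updeg_pseudo_div_lead:
  assumes "a \<in> poly_fun W" "r \<in> updeg W j n" "b \<in> poly_fun W" "f \<in> updeg W j (n + d)"
  shows "\<exists>k. \<exists>s\<in>updeg W j d. \<exists>t\<in>updeg W j n. \<forall>x. a x ^ Suc k * (b x * x j ^ (n + d) + f x) =
    (a x * x j ^ n + r x) * ((a x ^ k * b x) * x j ^ d + s x) + t x"
proof -
  define g where "g = (\<lambda>x. a x * (b x * x j ^ (n + d) + f x) - b x * x j ^ d * (a x * x j ^ n + r x))"
  have "g \<in> updeg W j (n + d)"
    unfolding g_def by (rule updeg_pseudo_div_step[OF assms])
  from updeg_pseudo_div[OF assms(1,2) this] obtain k s t where st: "s \<in> updeg W j d" "t \<in> updeg W j n"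
    "\<forall>x. a x ^ k * g x = (a x * x j ^ n + r x) * s x + t x" by (elim exE bexE)
  have "a x ^ Suc k * (b x * x j ^ (n + d) + f x) =
    (a x * x j ^ n + r x) * ((a x ^ k * b x) * x j ^ d + s x) + t x" for x
  proof -
    have "a x ^ Suc k * (b x * x j ^ (n + d) + f x) =
        a x ^ k * g x + a x ^ k * (b x * x j ^ d * (a x * x j ^ n + r x))"
      by (simp add: g_def algebra_simps)
    then show ?thesis using st(3) by (simp add: algebra_simps)
  qed
  then show ?thesis using st(1,2) by (intro exI[of _ k] bexI[where x=s] bexI[where x=t]) auto
qed

lemma updeg_poly:
  assumes "r \<in> updeg W j n" "j \<notin> W"
  shows "\<exists>R. (\<forall>k\<ge>n. coeff R k = 0) \<and> (\<forall>\<xi>. r (x(j := \<xi>)) = poly R \<xi>)"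
  using assms(1)
proof (induction n arbitrary: r)
  case 0
  then show ?case by (intro exI[of _ 0]) simp
next
  case (Suc n)
  obtain b f where f: "r = (\<lambda>x. b x * x j ^ n + f x)" "b \<in> poly_fun W" "f \<in> updeg W j n"
    by (rule updeg_SucE[OF Suc.prems])
  obtain R where R: "\<forall>k\<ge>n. coeff R k = 0" "\<forall>\<xi>. f (x(j := \<xi>)) = poly R \<xi>"
    using Suc.IH[OF f(3)] by (elim exE conjE)
  have "b (x(j := \<xi>)) = b x" for \<xi> by (rule poly_fun_cong[OF f(2)]) (use assms(2) in auto)
  then have "r (x(j := \<xi>)) = poly (monom (b x) n + R) \<xi>" for \<xi>
    unfolding f(1) using R(2) by (simp only: poly_add poly_monom fun_upd_same)
  then show ?case using R(1)
    by (intro exI[of _ "monom (b x) n + R"]) (auto simp del: fun_upd_apply)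
qed

section \<open>Elimination modulo a prime ideal\<close>

locale prime_ideal =
  fixes V :: "'i set" and P :: "(('i \<Rightarrow> complex) \<Rightarrow> complex) set"
  assumes P_poly_fun: "p \<in> P \<Longrightarrow> p \<in> poly_fun V"
    and P_zero: "(\<lambda>x. 0) \<in> P"
    and P_add: "p \<in> P \<Longrightarrow> q \<in> P \<Longrightarrow> (\<lambda>x. p x + q x) \<in> P"
    and P_mult: "p \<in> P \<Longrightarrow> a \<in> poly_fun V \<Longrightarrow> (\<lambda>x. a x * p x) \<in> P"
    and P_one: "(\<lambda>x. 1) \<notin> P"
    and P_prime: "p \<in> poly_fun V \<Longrightarrow> q \<in> poly_fun V \<Longrightarrow> (\<lambda>x. p x * q x) \<in> P \<Longrightarrow> p \<in> P \<or> q \<in> P"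
begin

lemma P_uminus: "p \<in> P \<Longrightarrow> (\<lambda>x. - p x) \<in> P"
  using P_mult[OF _ poly_fun_const[of "-1"], of p] by simp

lemma P_diff: "p \<in> P \<Longrightarrow> q \<in> P \<Longrightarrow> (\<lambda>x. p x - q x) \<in> P"
  using P_add[OF _ P_uminus, of p q] by simp

lemma P_power: "p \<in> poly_fun V \<Longrightarrow> (\<lambda>x. p x ^ k) \<in> P \<Longrightarrow> p \<in> P"
proof (induction k)
  case (Suc k)
  then have "(\<lambda>x. p x * p x ^ k) \<in> P" by simp
  then show ?case using P_prime[OF Suc(2) poly_fun_power[OF Suc(2)]] Suc by auto
qed (use P_one in simp)

text \<open>The \<open>W\<close>-coordinates of \<open>x\<close> form a zero of the elimination
  ideal of \<open>P\<close> in these coordinates.\<close>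

definition kills :: "('i \<Rightarrow> complex) \<Rightarrow> 'i set \<Rightarrow> bool" where
  "kills x W \<longleftrightarrow> (\<forall>p\<in>P. p \<in> poly_fun W \<longrightarrow> p x = 0)"

primrec updegP :: "'i set \<Rightarrow> 'i \<Rightarrow> nat \<Rightarrow> (('i \<Rightarrow> complex) \<Rightarrow> complex) set" where
  "updegP W j 0 = {\<lambda>x. 0}"
| "updegP W j (Suc m) = {f. \<exists>b\<in>poly_fun W. b \<in> P \<and> (\<exists>g\<in>updegP W j m. f = (\<lambda>x. b x * x j ^ m + g x))}"

lemma updegP_P:
  assumes "insert j W \<subseteq> V"
  shows "f \<in> updegP W j m \<Longrightarrow> f \<in> P"
proof (induction m arbitrary: f)
  case (Suc m)
  then obtain b g where f: "f = (\<lambda>x. b x * x j ^ m + g x)" "b \<in> P" "g \<in> updegP W j m" by auto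
  have "(\<lambda>x. x j ^ m * b x) \<in> P" using assms by (intro P_mult f poly_fun_power poly_fun_coord) auto
  from P_add[OF this Suc.IH[OF f(3)]] show ?case by (simp add: f(1) mult.commute)
qed (use P_zero in auto)

lemma updegP_kills:
  assumes "kills x W" "j \<notin> W"
  shows "f \<in> updegP W j m \<Longrightarrow> f (x(j := \<xi>)) = 0"
proof (induction m arbitrary: f)
  case (Suc m)
  then obtain b g where f: "f = (\<lambda>x. b x * x j ^ m + g x)" "b \<in> P" "b \<in> poly_fun W" "g \<in> updegP W j m" by auto
  have "b (x(j := \<xi>)) = b x" by (rule poly_fun_cong[OF f(3)]) (use assms(2) in auto)
  then have "b (x(j := \<xi>)) = 0" using assms(1) f(2,3) unfolding kills_def by simp
  then show ?case unfolding f(1) Suc.IH[OF f(4)] by simp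
qed auto

text \<open>Finds the leading term modulo \<open>P\<close>; the higher terms, with coefficients in
  \<open>P\<close>, go into \<open>s\<close>.\<close>

lemma updeg_cases:
  assumes "insert j W \<subseteq> V" "f \<in> updeg W j m" "f \<notin> updegP W j m"
  shows "\<exists>n<m. \<exists>b\<in>poly_fun W. \<exists>r\<in>updeg W j n. \<exists>s\<in>P. b \<notin> P \<and> s \<in> poly_fun (insert j W) \<and>
    (\<forall>x. f x = b x * x j ^ n + r x + s x)"
  using assms(2,3)
proof (induction m arbitrary: f)
  case (Suc m)
  obtain b g where f: "f = (\<lambda>x. b x * x j ^ m + g x)" "b \<in> poly_fun W" "g \<in> updeg W j m"
    by (rule updeg_SucE[OF Suc.prems(1)])
  show ?case
  proof (cases "b \<in> P")
    case False
    then show ?thesis using f P_zero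
      by (intro exI[of _ m] conjI bexI[where x=b and A="poly_fun W"] bexI[where x=g and A="updeg W j m"]
          bexI[where x="\<lambda>x. 0" and A=P]) auto
  next
    case True
    have "g \<notin> updegP W j m" using Suc.prems(2) f True by auto
    from Suc.IH[OF f(3) this] obtain n c r s where n: "n < m" "c \<in> poly_fun W" "r \<in> updeg W j n" "s \<in> P"
      "c \<notin> P" "s \<in> poly_fun (insert j W)" "\<forall>x. g x = c x * x j ^ n + r x + s x" by (elim exE bexE conjE)
    have "(\<lambda>x. x j ^ m * b x) \<in> P" using assms(1) by (intro P_mult True poly_fun_power poly_fun_coord) auto
    from P_add[OF this n(4)] have "(\<lambda>x. x j ^ m * b x + s x) \<in> P" .
    moreover have "(\<lambda>x. x j ^ m * b x + s x) \<in> poly_fun (insert j W)"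
      by (intro poly_fun_add poly_fun_mult poly_fun_power poly_fun_coord n(6) poly_fun_mono[OF f(2)]) auto
    ultimately show ?thesis using n f(1)
      by (intro exI[of _ n] conjI bexI[where x=c and A="poly_fun W"] bexI[where x=r and A="updeg W j n"]
          bexI[where x="\<lambda>x. x j ^ m * b x + s x" and A=P]) auto
  qed
qed auto

text \<open>If \<open>P\<close> contains no relation for the coordinate \<open>j\<close> over \<open>W\<close>, then all but finitely many values \<open>\<xi>\<close> will do.
  Otherwise let \<open>\<xi>\<close> be a root of a relation of least degree \<open>n\<close>; pseudo-division by this relation shows that
  all of \<open>P\<close> vanishes, and a Bezout relation modulo \<open>P\<close> keeps \<open>g\<close> from vanishing.\<close>

lemma specialize_step:
  assumes W: "insert j W \<subseteq> V" "j \<notin> W" and g: "g \<in> poly_fun (insert j W)" "g \<notin> P"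
  shows "\<exists>h\<in>poly_fun W. h \<notin> P \<and> (\<forall>x. kills x W \<longrightarrow> h x \<noteq> 0 \<longrightarrow>
    (\<exists>\<xi>. kills (x(j := \<xi>)) (insert j W) \<and> g (x(j := \<xi>)) \<noteq> 0))"
proof -
  let ?W = "insert j W"
  have sub: "p \<in> poly_fun ?W \<Longrightarrow> p \<in> poly_fun V" "p \<in> poly_fun W \<Longrightarrow> p \<in> poly_fun V" "p \<in> poly_fun W \<Longrightarrow> p \<in> poly_fun ?W" for p
    using poly_fun_mono W(1) by (blast intro: poly_fun_mono)+
  have lead_poly_fun: "(\<lambda>x. b x * x j ^ n + r x) \<in> poly_fun ?W" if "b \<in> poly_fun W" "r \<in> updeg W j n" for b n r
    by (intro poly_fun_add poly_fun_mult poly_fun_power poly_fun_coord sub(3)[OF that(1)] updeg_poly_fun[OF that(2)]) simp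
  have bx: "b (x(j := \<xi>)) = b x" if "b \<in> poly_fun W" for b x \<xi>
    by (rule poly_fun_cong[OF that]) (use W(2) in auto)
  define N where "N n \<longleftrightarrow> (\<exists>b\<in>poly_fun W. b \<notin> P \<and> (\<exists>r\<in>updeg W j n. (\<lambda>x. b x * x j ^ n + r x) \<in> P))" for n
  \<comment> \<open>Stripping coefficients in \<open>P\<close> from an element of \<open>P\<close>
    leaves either nothing or a relation, so below the least degree of a relation all coefficients
    lie in \<open>P\<close>.\<close>
  have top: "f \<in> updegP W j m \<or> (\<exists>n<m. N n)" if "f \<in> P" "f \<in> updeg W j m" for f m
  proof (rule disjCI, rule ccontr)
    assume no_N: "\<not> (\<exists>n<m. N n)"
    assume "f \<notin> updegP W j m"
    from updeg_cases[OF W(1) that(2) this] obtain n b r s where n: "n < m" "b \<in> poly_fun W" "r \<in> updeg W j n"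
      "s \<in> P" "b \<notin> P" "\<forall>x. f x = b x * x j ^ n + r x + s x" by (elim exE bexE conjE)
    have "(\<lambda>x. f x - s x) = (\<lambda>x. b x * x j ^ n + r x)" using n(6) by auto
    then have "(\<lambda>x. b x * x j ^ n + r x) \<in> P" using P_diff[OF that(1) n(4)] by simp
    then have "N n" unfolding N_def using n by blast
    then show False using n(1) no_N by blast
  qed
  obtain mg where mg: "g \<in> updeg W j mg" using poly_fun_updeg[OF g(1)] by (elim exE)
  show ?thesis
  proof (cases "\<exists>n. N n")
    case False
    have "g \<notin> updegP W j mg" using updegP_P[OF W(1)] g(2) by blast
    from updeg_cases[OF W(1) mg this] obtain n b r s where n: "b \<in> poly_fun W" "r \<in> updeg W j n" "s \<in> P"
      "b \<notin> P" "s \<in> poly_fun ?W" "\<forall>x. g x = b x * x j ^ n + r x + s x" by (elim exE bexE conjE)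
    have "\<exists>\<xi>. kills (x(j := \<xi>)) ?W \<and> g (x(j := \<xi>)) \<noteq> 0" if x: "kills x W" "b x \<noteq> 0" for x
    proof -
      \<comment> \<open>Without relations every element of \<open>P\<close> has all its coefficients
        in \<open>P\<close>, so any \<open>\<xi>\<close> is admissible. The function
        \<open>b\<close>, used as \<open>h\<close>, is the leading coefficient of \<open>g\<close>
        modulo \<open>P\<close>.\<close>
      have kills: "kills (x(j := \<xi>)) ?W" for \<xi>
        unfolding kills_def
      proof (intro ballI impI)
        fix p assume p: "p \<in> P" "p \<in> poly_fun ?W"
        obtain m where "p \<in> updeg W j m" using poly_fun_updeg[OF p(2)] by (elim exE)
        then have "p \<in> updegP W j m" using top[OF p(1)] False by blast
        then show "p (x(j := \<xi>)) = 0" by (rule updegP_kills[OF x(1) W(2)])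
      qed
      obtain R where R: "\<forall>k\<ge>n. coeff R k = 0" "\<forall>\<xi>. r (x(j := \<xi>)) = poly R \<xi>"
        using updeg_poly[OF n(2) W(2), of x] by (elim exE conjE)
      have "coeff (monom (b x) n + R) n \<noteq> 0" using R(1) x(2) by simp
      then have "monom (b x) n + R \<noteq> 0" by (metis coeff_0)
      then obtain \<xi> where \<xi>: "poly (monom (b x) n + R) \<xi> \<noteq> 0" using poly_all_0_iff_0 by blast
      have "s (x(j := \<xi>)) = 0" using kills[of \<xi>] n(3,5) by (simp add: kills_def)
      then have "g (x(j := \<xi>)) \<noteq> 0" using \<xi> n(6) R(2) bx[OF n(1)] by (simp add: poly_monom)
      then show ?thesis using kills by blast
    qed
    then show ?thesis using n(1,4) by (intro bexI[where x=b and A="poly_fun W"] conjI) auto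
  next
    case True
    define n where "n = (LEAST n. N n)"
    have "N n" using True unfolding n_def by (rule LeastI_ex)
    then obtain b r where b: "b \<in> poly_fun W" "b \<notin> P" "r \<in> updeg W j n" "(\<lambda>x. b x * x j ^ n + r x) \<in> P"
      unfolding N_def by blast
    have nmin: "\<not> N m" if "m < n" for m using that not_less_Least unfolding n_def by blast
    define p where "p = (\<lambda>x. b x * x j ^ n + r x)"
    have p: "p \<in> P" "p \<in> poly_fun ?W" using b lead_poly_fun unfolding p_def by auto
    have n0: "n > 0" using b by (cases n) auto
    have low: "f \<in> updegP W j n" if "f \<in> P" "f \<in> updeg W j n" for f
      using top[OF that] nmin by blast
    \<comment> \<open>The ideal generated by \<open>g\<close> modulo \<open>P\<close>. Its element
      of least degree acts as a greatest common divisor of \<open>g\<close> and the relation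
      \<open>p\<close>.\<close>
    define G where "G = {f. \<exists>u\<in>poly_fun ?W. \<exists>v\<in>P. v \<in> poly_fun ?W \<and> (\<forall>x. f x = u x * g x + v x)}"
    have GI: "f \<in> G" if "u \<in> poly_fun ?W" "v \<in> P" "v \<in> poly_fun ?W" "\<And>x. f x = u x * g x + v x" for f u v
      unfolding G_def using that by blast
    define N' where "N' m \<longleftrightarrow> (\<exists>c\<in>poly_fun W. c \<notin> P \<and> (\<exists>r\<in>updeg W j m. (\<lambda>x. c x * x j ^ m + r x) \<in> G))" for m
    have "p \<in> G" by (rule GI[OF poly_fun_const[of 0] p]) simp
    then have "N' n" unfolding N'_def using b unfolding p_def by blast
    define m where "m = (LEAST m. N' m)"
    have "N' m" unfolding m_def using \<open>N' n\<close> by (rule LeastI)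
    then obtain c q where c: "c \<in> poly_fun W" "c \<notin> P" "q \<in> updeg W j m" "(\<lambda>x. c x * x j ^ m + q x) \<in> G"
      unfolding N'_def by blast
    have mmin: "\<not> N' l" if "l < m" for l using that not_less_Least unfolding m_def by blast
    have "m \<le> n" unfolding m_def using \<open>N' n\<close> by (rule Least_le)
    then obtain d where d: "n = m + d" using le_Suc_ex by blast
    obtain u v where uv: "u \<in> poly_fun ?W" "v \<in> P" "v \<in> poly_fun ?W" "\<forall>x. c x * x j ^ m + q x = u x * g x + v x"
      using c(4) unfolding G_def by blast
    have lowG: "t \<in> P" if t: "t \<in> G" "t \<in> updeg W j m" for t
    proof (rule ccontr)
      assume "t \<notin> P"
      then have "t \<notin> updegP W j m" using updegP_P[OF W(1)] by blast
      from updeg_cases[OF W(1) t(2) this] obtain l e r' s where l: "l < m" "e \<in> poly_fun W" "r' \<in> updeg W j l"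
        "s \<in> P" "e \<notin> P" "s \<in> poly_fun ?W" "\<forall>x. t x = e x * x j ^ l + r' x + s x" by (elim exE bexE conjE)
      obtain u' v' where u': "u' \<in> poly_fun ?W" "v' \<in> P" "v' \<in> poly_fun ?W" "\<forall>x. t x = u' x * g x + v' x"
        using t(1) unfolding G_def by blast
      have "(\<lambda>x. e x * x j ^ l + r' x) \<in> G"
      proof (rule GI[OF u'(1) P_diff[OF u'(2) l(4)] poly_fun_diff[OF u'(3) l(6)]])
        fix x
        have "e x * x j ^ l + r' x = t x - s x" using l(7) by simp
        also have "\<dots> = u' x * g x + (v' x - s x)" using u'(4) by simp
        finally show "e x * x j ^ l + r' x = u' x * g x + (v' x - s x)" .
      qed
      then have "N' l" unfolding N'_def using l by blast
      then show False using mmin l(1) by blast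
    qed
    define Q where "Q = (\<lambda>x. c x * x j ^ m + q x)"
    have QW: "Q \<in> poly_fun ?W" unfolding Q_def by (rule lead_poly_fun[OF c(1,3)])
    \<comment> \<open>Suppose \<open>m\<close> is positive and divide the relation \<open>p\<close>
      by \<open>Q\<close>. The remainder lies in \<open>P\<close>, so \<open>Q * S\<close> does. If
      \<open>S\<close> lies in \<open>P\<close>, it is a relation of degree below \<open>n\<close>;
      if \<open>Q\<close> does, then dividing \<open>g\<close> by \<open>Q\<close> shows that
      \<open>g\<close> lies in \<open>P\<close>.\<close>
    have "m = 0"
    proof (rule ccontr)
      assume "m \<noteq> 0"
      have "r \<in> updeg W j (m + d)" using b(3) d by simp
      from updeg_pseudo_div_lead[OF c(1,3) b(1) this] obtain k s t where st: "s \<in> updeg W j d"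
        "t \<in> updeg W j m" "\<forall>x. c x ^ Suc k * (b x * x j ^ (m + d) + r x) =
          (c x * x j ^ m + q x) * ((c x ^ k * b x) * x j ^ d + s x) + t x"
        by (elim exE bexE)
      define S where "S = (\<lambda>x. (c x ^ k * b x) * x j ^ d + s x)"
      have ckb: "(\<lambda>x. c x ^ k * b x) \<in> poly_fun W" by (intro poly_fun_mult poly_fun_power c b)
      have SW: "S \<in> poly_fun ?W" unfolding S_def by (rule lead_poly_fun[OF ckb st(1)])
      have eq: "c x ^ Suc k * p x = Q x * S x + t x" for x
        using st(3) unfolding p_def Q_def S_def d by simp
      have cp: "(\<lambda>x. c x ^ Suc k * p x) \<in> P" by (intro P_mult p poly_fun_power sub(2) c)
      have cpW: "(\<lambda>x. c x ^ Suc k * p x) \<in> poly_fun ?W" by (intro poly_fun_mult p poly_fun_power sub(3) c)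
      have Sv: "(\<lambda>x. S x * v x) \<in> P" "(\<lambda>x. S x * v x) \<in> poly_fun ?W"
        by (intro P_mult uv sub(1) SW, intro poly_fun_mult SW uv)
      have "t \<in> G"
      proof (rule GI[OF poly_fun_uminus[OF poly_fun_mult[OF SW uv(1)]] P_diff[OF cp Sv(1)] poly_fun_diff[OF cpW Sv(2)]])
        fix x
        have "Q x = u x * g x + v x" using uv(4) unfolding Q_def by simp
        then show "t x = - (S x * u x) * g x + (c x ^ Suc k * p x - S x * v x)"
          unfolding eq by (simp add: algebra_simps)
      qed
      then have tP: "t \<in> P" using lowG st(2) by blast
      have "(\<lambda>x. Q x * S x) = (\<lambda>x. c x ^ Suc k * p x - t x)" unfolding eq by simp
      then have "(\<lambda>x. Q x * S x) \<in> P" using P_diff[OF cp tP] by simp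
      then have "Q \<in> P \<or> S \<in> P" by (rule P_prime[OF sub(1)[OF QW] sub(1)[OF SW]])
      then show False
      proof
        assume "S \<in> P"
        moreover have "(\<lambda>x. c x ^ k * b x) \<notin> P"
        proof
          assume "(\<lambda>x. c x ^ k * b x) \<in> P"
          then have "(\<lambda>x. c x ^ k) \<in> P \<or> b \<in> P"
            by (rule P_prime[OF sub(2)[OF poly_fun_power[OF c(1)]] sub(2)[OF b(1)]])
          then show False using P_power[OF sub(2)[OF c(1)]] c(2) b(2) by blast
        qed
        ultimately have "N d" unfolding N_def S_def using ckb st(1) by blast
        then show False using nmin[of d] d \<open>m \<noteq> 0\<close> by simp
      next
        assume QP: "Q \<in> P"
        have "g \<in> updeg W j (m + mg)" by (rule updeg_mono[OF mg]) simp
        from updeg_pseudo_div[OF c(1,3) this] obtain k s t where st: "s \<in> updeg W j mg"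
          "t \<in> updeg W j m" "\<forall>x. c x ^ k * g x = (c x * x j ^ m + q x) * s x + t x"
          by (elim exE bexE)
        have sW: "s \<in> poly_fun ?W" by (rule updeg_poly_fun[OF st(1)])
        have sQ: "(\<lambda>x. s x * Q x) \<in> P" by (rule P_mult[OF QP sub(1)[OF sW]])
        have "t \<in> G"
        proof (rule GI[OF poly_fun_power[OF sub(3)[OF c(1)]] P_uminus[OF sQ] poly_fun_uminus[OF poly_fun_mult[OF sW QW]]])
          fix x
          show "t x = c x ^ k * g x + - (s x * Q x)" using st(3) unfolding Q_def by (simp add: algebra_simps)
        qed
        then have tP: "t \<in> P" using lowG st(2) by blast
        have "(\<lambda>x. c x ^ k * g x) = (\<lambda>x. s x * Q x + t x)"
          using st(3) unfolding Q_def by (simp add: algebra_simps)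
        then have "(\<lambda>x. c x ^ k * g x) \<in> P" using P_add[OF sQ tP] by simp
        then have "(\<lambda>x. c x ^ k) \<in> P \<or> g \<in> P"
          by (rule P_prime[OF sub(2)[OF poly_fun_power[OF c(1)]] sub(1)[OF g(1)]])
        then show False using P_power[OF sub(2)[OF c(1)]] c(2) g(2) by blast
      qed
    qed
    \<comment> \<open>In degree 0 the element of \<open>G\<close> becomes a Bezout identity whose
      left-hand side is free of the coordinate \<open>j\<close>.\<close>
    then have cug: "c x = u x * g x + v x" for x using uv(4) c(3) by simp
    have h: "(\<lambda>x. b x * c x) \<in> poly_fun W" "(\<lambda>x. b x * c x) \<notin> P"
      using poly_fun_mult[OF b(1) c(1)] P_prime[OF sub(2)[OF b(1)] sub(2)[OF c(1)]] b(2) c(2) by blast+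
    have "\<exists>\<xi>. kills (x(j := \<xi>)) ?W \<and> g (x(j := \<xi>)) \<noteq> 0" if x: "kills x W" "b x * c x \<noteq> 0" for x
    proof -
      obtain R where R: "\<forall>k\<ge>n. coeff R k = 0" "\<forall>\<xi>. r (x(j := \<xi>)) = poly R \<xi>"
        using updeg_poly[OF b(3) W(2), of x] by (elim exE conjE)
      \<comment> \<open>Since \<open>b x\<close> is nonzero, the specialized relation keeps its
        degree \<open>n > 0\<close> and has a root.\<close>
      have "coeff (monom (b x) n + R) n \<noteq> 0" using R(1) x(2) by simp
      then have "n \<le> degree (monom (b x) n + R)" by (rule le_degree)
      then have "\<not> constant (poly (monom (b x) n + R))" using n0 by (simp add: constant_degree)
      then obtain \<xi> where \<xi>: "poly (monom (b x) n + R) \<xi> = 0"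
        by (auto dest: fundamental_theorem_of_algebra)
      let ?y = "x(j := \<xi>)"
      have py: "p ?y = 0" using \<xi> R(2) bx[OF b(1)] unfolding p_def by (simp add: poly_monom)
      have kills: "kills ?y ?W"
        unfolding kills_def
      proof (intro ballI impI)
        fix f assume f: "f \<in> P" "f \<in> poly_fun ?W"
        obtain l where "f \<in> updeg W j l" using poly_fun_updeg[OF f(2)] by (elim exE)
        then have "f \<in> updeg W j (n + l)" by (rule updeg_mono) simp
        from updeg_pseudo_div[OF b(1,3) this] obtain k s t where st: "s \<in> updeg W j l"
          "t \<in> updeg W j n" "\<forall>x. b x ^ k * f x = (b x * x j ^ n + r x) * s x + t x"
          by (elim exE bexE)
        have "(\<lambda>x. b x ^ k * f x - s x * p x) \<in> P"
          by (intro P_diff P_mult f p poly_fun_power sub(2)[OF b(1)] sub(1)[OF updeg_poly_fun[OF st(1)]])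
        moreover have "(\<lambda>x. b x ^ k * f x - s x * p x) = t"
          using st(3) unfolding p_def by (auto simp: algebra_simps)
        ultimately have "t \<in> P" by simp
        then have "t ?y = 0" using updegP_kills[OF x(1) W(2) low] st(2) by blast
        then have "b ?y ^ k * f ?y = 0" using st(3) py unfolding p_def by simp
        then show "f ?y = 0" using bx[OF b(1)] x(2) by simp
      qed
      have "v ?y = 0" using kills uv(2,3) by (simp add: kills_def)
      then have "g ?y \<noteq> 0" using cug[of ?y] bx[OF c(1)] x(2) by auto
      then show ?thesis using kills by blast
    qed
    then show ?thesis using h by (intro bexI[where x="\<lambda>x. b x * c x" and A="poly_fun W"] conjI) auto
  qed
qed

text \<open>Iterates \<open>specialize_step\<close>. With \<open>W\<close> empty it gives the
  Nullstellensatz; with \<open>W\<close> independent modulo \<open>P\<close> it gives the lifting in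
  \<open>irr_generic_point\<close>.\<close>

lemma specialize:
  assumes "finite D" "W \<inter> D = {}" "W \<union> D \<subseteq> V" "g \<in> poly_fun (W \<union> D)" "g \<notin> P"
  shows "\<exists>h\<in>poly_fun W. h \<notin> P \<and> (\<forall>x. kills x W \<longrightarrow> h x \<noteq> 0 \<longrightarrow>
    (\<exists>y. (\<forall>i\<in>W. y i = x i) \<and> kills y (W \<union> D) \<and> g y \<noteq> 0))"
  using assms
proof (induction D arbitrary: g rule: finite_induct)
  case empty
  then show ?case by (intro bexI[where x=g and A="poly_fun W"]) auto
next
  case (insert j D)
  have "\<exists>h\<in>poly_fun (W \<union> D). h \<notin> P \<and> (\<forall>x. kills x (W \<union> D) \<longrightarrow> h x \<noteq> 0 \<longrightarrow>
    (\<exists>\<xi>. kills (x(j := \<xi>)) (insert j (W \<union> D)) \<and> g (x(j := \<xi>)) \<noteq> 0))"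
    by (rule specialize_step) (use insert in auto)
  then obtain h where h: "h \<in> poly_fun (W \<union> D)" "h \<notin> P" and h': "\<forall>x. kills x (W \<union> D) \<longrightarrow> h x \<noteq> 0 \<longrightarrow>
    (\<exists>\<xi>. kills (x(j := \<xi>)) (insert j (W \<union> D)) \<and> g (x(j := \<xi>)) \<noteq> 0)" by (elim bexE conjE)
  have "\<exists>k\<in>poly_fun W. k \<notin> P \<and> (\<forall>x. kills x W \<longrightarrow> k x \<noteq> 0 \<longrightarrow>
    (\<exists>y. (\<forall>i\<in>W. y i = x i) \<and> kills y (W \<union> D) \<and> h y \<noteq> 0))"
    by (rule insert.IH) (use insert.prems h in auto)
  then obtain k where k: "k \<in> poly_fun W" "k \<notin> P" and k': "\<forall>x. kills x W \<longrightarrow> k x \<noteq> 0 \<longrightarrow>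
    (\<exists>y. (\<forall>i\<in>W. y i = x i) \<and> kills y (W \<union> D) \<and> h y \<noteq> 0)" by (elim bexE conjE)
  have "\<exists>y. (\<forall>i\<in>W. y i = x i) \<and> kills y (W \<union> insert j D) \<and> g y \<noteq> 0" if x: "kills x W" "k x \<noteq> 0" for x
  proof -
    obtain y where y: "\<forall>i\<in>W. y i = x i" "kills y (W \<union> D)" "h y \<noteq> 0" using k' x by blast
    obtain \<xi> where \<xi>: "kills (y(j := \<xi>)) (insert j (W \<union> D))" "g (y(j := \<xi>)) \<noteq> 0" using h' y by blast
    have "\<forall>i\<in>W. (y(j := \<xi>)) i = x i" using y(1) insert.prems by auto
    then show ?thesis using \<xi> by (intro exI[of _ "y(j := \<xi>)"]) simp
  qed
  then show ?case using k by (intro bexI[where x=k and A="poly_fun W"]) auto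
qed

definition zeros :: "('i \<Rightarrow> complex) set" where
  "zeros = {y. \<forall>p\<in>P. p y = 0}"

lemma kills_zeros: "kills y V \<longleftrightarrow> y \<in> zeros"
  using P_poly_fun by (auto simp: kills_def zeros_def)

text \<open>Specialization starting from no coordinates at all: \<open>h\<close> is then a nonzero
  constant, so a zero of \<open>P\<close> with \<open>g\<close> nonzero exists.\<close>

lemma nullstellensatz:
  assumes "finite V" "g \<in> poly_fun V" "\<And>y. y \<in> zeros \<Longrightarrow> g y = 0"
  shows "g \<in> P"
proof (rule ccontr)
  assume "g \<notin> P"
  then have "\<exists>h\<in>poly_fun {}. h \<notin> P \<and> (\<forall>x. kills x {} \<longrightarrow> h x \<noteq> 0 \<longrightarrow>
    (\<exists>y. (\<forall>i\<in>{}. y i = x i) \<and> kills y ({} \<union> V) \<and> g y \<noteq> 0))"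
    by (intro specialize) (use assms in auto)
  then obtain h where h: "h \<in> poly_fun {}" "h \<notin> P" and h': "\<forall>x. kills x {} \<longrightarrow> h x \<noteq> 0 \<longrightarrow>
    (\<exists>y. (\<forall>i\<in>{}. y i = x i) \<and> kills y ({} \<union> V) \<and> g y \<noteq> 0)" by (elim bexE conjE)
  have const: "p = (\<lambda>x. p x0)" if "p \<in> poly_fun {}" for p and x0 :: "'i \<Rightarrow> complex" using poly_fun_cong[OF that] by auto
  define x0 :: "'i \<Rightarrow> complex" where "x0 = (\<lambda>_. 0)"
  have "kills x0 {}"
    unfolding kills_def
  proof (intro ballI impI, rule ccontr)
    fix p assume p: "p \<in> P" "p \<in> poly_fun {}" "p x0 \<noteq> 0"
    have "(\<lambda>x. inverse (p x0) * p x) \<in> P" by (rule P_mult[OF p(1) poly_fun_const])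
    moreover have "(\<lambda>x. inverse (p x0) * p x) = (\<lambda>x. 1)" using const[OF p(2), of x0] p(3)
      by (metis left_inverse)
    ultimately show False using P_one by simp
  qed
  moreover have "h x0 \<noteq> 0" using const[OF h(1), of x0] h(2) P_zero by metis
  ultimately obtain y where "kills y V" "g y \<noteq> 0" using h' by auto
  then show False using assms(3) kills_zeros by blast
qed

lemma irr_zeros: "finite V \<Longrightarrow> irr V zeros"
  unfolding irr_def
proof (intro conjI ballI impI)
  assume "finite V"
  then show "zeros \<noteq> {}" using nullstellensatz[of "\<lambda>x. 1"] P_one by auto
  fix p q assume "p \<in> poly_fun V" "q \<in> poly_fun V" "\<forall>z\<in>zeros. p z * q z = 0"
  then have "p \<in> P \<or> q \<in> P"
    using P_prime nullstellensatz[OF \<open>finite V\<close> poly_fun_mult] by blast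
  then show "(\<forall>z\<in>zeros. p z = 0) \<or> (\<forall>z\<in>zeros. q z = 0)" by (auto simp: zeros_def)
qed

end

section \<open>Irreducible subsets and chains\<close>

definition aclosed :: "'i set \<Rightarrow> ('i \<Rightarrow> complex) set \<Rightarrow> bool" where
  "aclosed V Z \<longleftrightarrow> (\<exists>Q\<subseteq>poly_fun V. Z = {x. \<forall>q\<in>Q. q x = 0})"

lemma aclosedI: "Q \<subseteq> poly_fun V \<Longrightarrow> aclosed V {x. \<forall>q\<in>Q. q x = 0}"
  by (auto simp: aclosed_def)

lemma aclosed_separate:
  assumes "aclosed V Z" "x \<notin> Z"
  obtains q where "q \<in> poly_fun V" "\<forall>z\<in>Z. q z = 0" "q x \<noteq> 0"
proof -
  obtain Q where Q: "Q \<subseteq> poly_fun V" "Z = {x. \<forall>q\<in>Q. q x = 0}"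
    using assms(1) unfolding aclosed_def by (elim exE conjE)
  then obtain q where "q \<in> Q" "q x \<noteq> 0" using assms(2) by auto
  then show ?thesis using Q by (intro that[of q]) auto
qed

lemma aclosed_Int:
  assumes "aclosed V X" "aclosed V Y"
  shows "aclosed V (X \<inter> Y)"
proof -
  obtain Q R where "Q \<subseteq> poly_fun V" "X = {x. \<forall>q\<in>Q. q x = 0}" "R \<subseteq> poly_fun V" "Y = {x. \<forall>q\<in>R. q x = 0}"
    using assms unfolding aclosed_def by (elim exE conjE)
  then show ?thesis unfolding aclosed_def by (intro exI[of _ "Q \<union> R"]) auto
qed

text \<open>Points carry values at all indices; a closed set is a cylinder over those outside
  \<open>V\<close>.\<close>

lemma aclosed_cong:
  assumes "aclosed V X" "x \<in> X" "\<And>i. i \<in> V \<Longrightarrow> x i = y i"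
  shows "y \<in> X"
proof (rule ccontr)
  assume "y \<notin> X"
  obtain q where "q \<in> poly_fun V" "\<forall>z\<in>X. q z = 0" "q y \<noteq> 0"
    by (rule aclosed_separate[OF assms(1) \<open>y \<notin> X\<close>])
  then show False using poly_fun_cong[of q V x y] assms by auto
qed

definition ideal_in :: "'i set \<Rightarrow> (('i \<Rightarrow> complex) \<Rightarrow> complex) set \<Rightarrow> bool" where
  "ideal_in V J \<longleftrightarrow> J \<subseteq> poly_fun V \<and> (\<lambda>x. 0) \<in> J \<and> (\<forall>p\<in>J. \<forall>q\<in>J. (\<lambda>x. p x + q x) \<in> J) \<and>
    (\<forall>p\<in>J. \<forall>a\<in>poly_fun V. (\<lambda>x. a x * p x) \<in> J)"

lemma ideal_in_vanishing: "ideal_in V {p \<in> poly_fun V. \<forall>x\<in>X. p x = 0}"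
  unfolding ideal_in_def by (auto intro: poly_fun_add poly_fun_mult)

lemma ideal_in_adjoin:
  assumes "ideal_in V J" "p \<in> poly_fun V"
  shows "ideal_in V {f. \<exists>m\<in>J. \<exists>a\<in>poly_fun V. f = (\<lambda>x. m x + a x * p x)}" (is "ideal_in V ?K")
    and "J \<subseteq> {f. \<exists>m\<in>J. \<exists>a\<in>poly_fun V. f = (\<lambda>x. m x + a x * p x)}"
    and "p \<in> {f. \<exists>m\<in>J. \<exists>a\<in>poly_fun V. f = (\<lambda>x. m x + a x * p x)}"
proof -
  have J: "J \<subseteq> poly_fun V" "(\<lambda>x. 0) \<in> J" "\<And>p q. p \<in> J \<Longrightarrow> q \<in> J \<Longrightarrow> (\<lambda>x. p x + q x) \<in> J"
    "\<And>p a. p \<in> J \<Longrightarrow> a \<in> poly_fun V \<Longrightarrow> (\<lambda>x. a x * p x) \<in> J"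
    using assms(1) by (simp_all add: ideal_in_def)
  have KI: "f \<in> ?K" if "m \<in> J" "a \<in> poly_fun V" "f = (\<lambda>x. m x + a x * p x)" for f m a
    using that by (intro CollectI bexI[where x=m and A=J] bexI[where x=a and A="poly_fun V"])
  show sub: "J \<subseteq> ?K"
  proof
    fix m assume "m \<in> J"
    then show "m \<in> ?K" by (rule KI[OF _ poly_fun_const[of 0]]) simp
  qed
  show "p \<in> ?K" by (rule KI[OF J(2) poly_fun_const[of 1]]) simp
  show "ideal_in V ?K"
    unfolding ideal_in_def
  proof (intro conjI ballI)
    show "?K \<subseteq> poly_fun V"
    proof
      fix f assume "f \<in> ?K"
      then obtain m a where f: "m \<in> J" "a \<in> poly_fun V" "f = (\<lambda>x. m x + a x * p x)" by (elim CollectE bexE)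
      show "f \<in> poly_fun V" unfolding f(3) by (intro poly_fun_add poly_fun_mult f assms subsetD[OF J(1)])
    qed
    show "(\<lambda>x. 0) \<in> ?K" using J(2) sub by (rule rev_subsetD)
  next
    fix f g assume "f \<in> ?K" "g \<in> ?K"
    then obtain m a n b where f: "m \<in> J" "a \<in> poly_fun V" "f = (\<lambda>x. m x + a x * p x)"
      and g: "n \<in> J" "b \<in> poly_fun V" "g = (\<lambda>x. n x + b x * p x)" by (elim CollectE bexE)
    show "(\<lambda>x. f x + g x) \<in> ?K"
      by (rule KI[OF J(3)[OF f(1) g(1)] poly_fun_add[OF f(2) g(2)]]) (simp add: f(3) g(3) algebra_simps)
  next
    fix f c assume "f \<in> ?K" and c: "c \<in> poly_fun V"
    then obtain m a where f: "m \<in> J" "a \<in> poly_fun V" "f = (\<lambda>x. m x + a x * p x)" by (elim CollectE bexE)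
    show "(\<lambda>x. c x * f x) \<in> ?K"
      by (rule KI[OF J(4)[OF f(1) c] poly_fun_mult[OF c f(2)]]) (simp add: f(3) algebra_simps)
  qed
qed

text \<open>An ideal that is maximal among those disjoint from a multiplicative set is prime; Zorn's
  lemma provides it.\<close>

lemma prime_ideal_avoiding:
  assumes J: "ideal_in V J" and S: "S \<subseteq> poly_fun V" "(\<lambda>x. 1) \<in> S"
    "\<And>s t. s \<in> S \<Longrightarrow> t \<in> S \<Longrightarrow> (\<lambda>x. s x * t x) \<in> S" "J \<inter> S = {}"
  obtains P where "prime_ideal V P" "J \<subseteq> P" "P \<inter> S = {}"
proof -
  define \<A> where "\<A> = {M. ideal_in V M \<and> J \<subseteq> M \<and> M \<inter> S = {}}"
  have "\<exists>M\<in>\<A>. \<forall>X\<in>\<A>. M \<subseteq> X \<longrightarrow> X = M"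
  proof (rule subset_Zorn_nonempty)
    show "\<A> \<noteq> {}" using J S(4) by (auto simp: \<A>_def)
  next
    fix \<C> assume C: "\<C> \<noteq> {}" "subset.chain \<A> \<C>"
    then have ideal: "\<And>M. M \<in> \<C> \<Longrightarrow> ideal_in V M" and rest: "\<And>M. M \<in> \<C> \<Longrightarrow> J \<subseteq> M \<and> M \<inter> S = {}"
      by (auto simp: \<A>_def subset_chain_def)
    have "ideal_in V (\<Union>\<C>)"
      unfolding ideal_in_def
    proof (intro conjI ballI)
      show "\<Union>\<C> \<subseteq> poly_fun V"
      proof (rule Union_least)
        fix M assume "M \<in> \<C>"
        then show "M \<subseteq> poly_fun V" using ideal[of M] by (simp add: ideal_in_def)
      qed
      show "(\<lambda>x. 0) \<in> \<Union>\<C>" using ideal C(1) by (auto simp: ideal_in_def)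
    next
      fix p q assume "p \<in> \<Union>\<C>" "q \<in> \<Union>\<C>"
      then obtain M N where MN: "M \<in> \<C>" "N \<in> \<C>" "p \<in> M" "q \<in> N" by (elim UnionE)
      then have "M \<subseteq> N \<or> N \<subseteq> M" using C(2) by (auto simp: subset_chain_def)
      then show "(\<lambda>x. p x + q x) \<in> \<Union>\<C>"
      proof
        assume "M \<subseteq> N"
        then have "(\<lambda>x. p x + q x) \<in> N" using ideal[OF MN(2)] MN(3,4) by (simp add: ideal_in_def subset_iff)
        then show ?thesis using MN(2) by (rule UnionI[rotated])
      next
        assume "N \<subseteq> M"
        then have "(\<lambda>x. p x + q x) \<in> M" using ideal[OF MN(1)] MN(3,4) by (simp add: ideal_in_def subset_iff)
        then show ?thesis using MN(1) by (rule UnionI[rotated])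
      qed
    next
      fix p a assume "p \<in> \<Union>\<C>" and a: "a \<in> poly_fun V"
      then obtain M where M: "M \<in> \<C>" "p \<in> M" by (elim UnionE)
      then have "(\<lambda>x. a x * p x) \<in> M" using ideal[OF M(1)] a by (simp add: ideal_in_def)
      then show "(\<lambda>x. a x * p x) \<in> \<Union>\<C>" using M(1) by (rule UnionI[rotated])
    qed
    then show "\<Union>\<C> \<in> \<A>" using rest C(1) by (auto simp: \<A>_def)
  qed
  then obtain M where "M \<in> \<A>" and max: "\<forall>X\<in>\<A>. M \<subseteq> X \<longrightarrow> X = M" by (elim bexE)
  then have M: "ideal_in V M" "J \<subseteq> M" "M \<inter> S = {}" by (auto simp: \<A>_def)
  then have I: "M \<subseteq> poly_fun V" "(\<lambda>x. 0) \<in> M" "\<And>p q. p \<in> M \<Longrightarrow> q \<in> M \<Longrightarrow> (\<lambda>x. p x + q x) \<in> M"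
    "\<And>p a. p \<in> M \<Longrightarrow> a \<in> poly_fun V \<Longrightarrow> (\<lambda>x. a x * p x) \<in> M"
    by (simp_all add: ideal_in_def)
  have meets: "\<exists>s\<in>S. \<exists>m\<in>M. \<exists>a\<in>poly_fun V. s = (\<lambda>x. m x + a x * p x)" if "p \<in> poly_fun V" "p \<notin> M" for p
  proof (rule ccontr)
    let ?K = "{f. \<exists>m\<in>M. \<exists>a\<in>poly_fun V. f = (\<lambda>x. m x + a x * p x)}"
    assume "\<not> ?thesis"
    then have "?K \<inter> S = {}" by auto
    then have "?K \<in> \<A>" unfolding \<A>_def
      using ideal_in_adjoin(1,2)[OF M(1) that(1)] M(2) by (intro CollectI conjI) (auto simp only:)
    then have "?K = M" using max ideal_in_adjoin(2)[OF M(1) that(1)] by (simp only:)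
    then show False using ideal_in_adjoin(3)[OF M(1) that(1)] that(2) by (simp only:)
  qed
  have "prime_ideal V M"
  proof
    show "(\<lambda>x. 1) \<notin> M" using M(3) S(2) by auto
  next
    fix p q assume pq: "p \<in> poly_fun V" "q \<in> poly_fun V" "(\<lambda>x. p x * q x) \<in> M"
    show "p \<in> M \<or> q \<in> M"
    proof (rule ccontr)
      assume "\<not> ?thesis"
      then have "p \<notin> M" "q \<notin> M" by auto
      obtain s m a where s: "s \<in> S" "m \<in> M" "a \<in> poly_fun V" "s = (\<lambda>x. m x + a x * p x)"
        using meets[OF pq(1) \<open>p \<notin> M\<close>] by (elim bexE)
      obtain t n b where t: "t \<in> S" "n \<in> M" "b \<in> poly_fun V" "t = (\<lambda>x. n x + b x * q x)"
        using meets[OF pq(2) \<open>q \<notin> M\<close>] by (elim bexE)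
      have tV: "t \<in> poly_fun V" using t(1) S(1) by auto
      \<comment> \<open>Expansion of the product of \<open>m + a * p\<close> and
        \<open>n + b * q\<close>: each summand contains \<open>m\<close>, \<open>n\<close> or
        \<open>p * q\<close>.\<close>
      have "(\<lambda>x. t x * m x + (a x * p x * n x + (a x * b x) * (p x * q x))) \<in> M"
        by (rule I(3)[OF I(4)[OF s(2) tV] I(3)[OF I(4)[OF t(2) poly_fun_mult[OF s(3) pq(1)]]
          I(4)[OF pq(3) poly_fun_mult[OF s(3) t(3)]]]])
      moreover have "(\<lambda>x. t x * m x + (a x * p x * n x + (a x * b x) * (p x * q x))) = (\<lambda>x. s x * t x)"
        by (simp add: s(4) t(4) algebra_simps)
      ultimately have "(\<lambda>x. s x * t x) \<in> M" by simp
      then show False using S(3)[OF s(1) t(1)] M(3) by (simp only: disjoint_iff)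
    qed
  qed (use I in \<open>simp_all add: subset_iff\<close>)
  then show ?thesis using M(2,3) by (rule that)
qed

text \<open>Takes the place of the decomposition into irreducible components: a prime ideal that
  avoids \<open>S\<close> cuts out an irreducible subset, and by the Nullstellensatz no member of
  \<open>S\<close> vanishes identically on it.\<close>

lemma aclosed_irr_subset:
  assumes V: "finite V" and X: "aclosed V X" and S: "S \<subseteq> poly_fun V" "(\<lambda>x. 1) \<in> S"
    "\<And>s t. s \<in> S \<Longrightarrow> t \<in> S \<Longrightarrow> (\<lambda>x. s x * t x) \<in> S" "\<And>s. s \<in> S \<Longrightarrow> \<exists>x\<in>X. s x \<noteq> 0"
  obtains Z where "Z \<subseteq> X" "aclosed V Z" "irr V Z" "\<forall>s\<in>S. \<exists>z\<in>Z. s z \<noteq> 0"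
proof -
  have "{p \<in> poly_fun V. \<forall>x\<in>X. p x = 0} \<inter> S = {}" using S(4) by auto
  from prime_ideal_avoiding[OF ideal_in_vanishing S(1-3) this]
  obtain P where P: "prime_ideal V P" "{p \<in> poly_fun V. \<forall>x\<in>X. p x = 0} \<subseteq> P" "P \<inter> S = {}" by blast
  interpret prime_ideal V P by (rule P(1))
  have "zeros \<subseteq> X"
  proof
    fix y assume y: "y \<in> zeros"
    show "y \<in> X"
    proof (rule ccontr)
      assume "y \<notin> X"
      then obtain q where "q \<in> poly_fun V" "\<forall>z\<in>X. q z = 0" "q y \<noteq> 0" by (rule aclosed_separate[OF X])
      then show False using y P(2) by (auto simp: zeros_def)
    qed
  qed
  moreover have "aclosed V zeros" unfolding zeros_def by (rule aclosedI) (use P_poly_fun in auto)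
  moreover have "\<exists>z\<in>zeros. s z \<noteq> 0" if "s \<in> S" for s
  proof (rule ccontr)
    assume "\<not> ?thesis"
    then have "s \<in> P" using nullstellensatz[OF V, of s] S(1) that by auto
    then show False using P(3) that by auto
  qed
  ultimately show ?thesis using irr_zeros[OF V] by (intro that[of zeros]) auto
qed

text \<open>A prime ideal that contains \<open>J\<close> but no power of \<open>g\<close> would
  contain \<open>g\<close> by the Nullstellensatz for prime ideals.\<close>

lemma strong_nullstellensatz:
  assumes V: "finite V" and J: "ideal_in V J" and g: "g \<in> poly_fun V"
    and z: "\<And>x. (\<forall>p\<in>J. p x = 0) \<Longrightarrow> g x = 0"
  shows "\<exists>k. (\<lambda>x. g x ^ k) \<in> J"
proof (rule ccontr)
  assume no: "\<not> ?thesis"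
  define S where "S = range (\<lambda>k x. g x ^ k)"
  have S: "S \<subseteq> poly_fun V" "(\<lambda>x. 1) \<in> S" "J \<inter> S = {}"
    using poly_fun_power[OF g] no by (auto simp: S_def intro: range_eqI[of _ _ 0])
  have mult: "(\<lambda>x. s x * t x) \<in> S" if "s \<in> S" "t \<in> S" for s t
  proof -
    obtain k l where "s = (\<lambda>x. g x ^ k)" "t = (\<lambda>x. g x ^ l)" using \<open>s \<in> S\<close> \<open>t \<in> S\<close> by (auto simp: S_def)
    then show ?thesis unfolding S_def by (intro range_eqI[of _ _ "k + l"]) (simp add: power_add)
  qed
  obtain P where P: "prime_ideal V P" "J \<subseteq> P" "P \<inter> S = {}"
    by (rule prime_ideal_avoiding[OF J S(1,2) mult S(3)])
  interpret prime_ideal V P by (rule P(1))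
  have "g \<in> P"
    by (rule nullstellensatz[OF V g]) (use z P(2) in \<open>auto simp: zeros_def\<close>)
  moreover have "g \<in> S" unfolding S_def by (rule range_eqI[of _ _ 1]) simp
  ultimately show False using P(3) by auto
qed

text \<open>The pullbacks of nonzero polynomials form a multiplicative set, and dominance means that
  none of them vanishes identically; so \<open>aclosed_irr_subset\<close> preserves
  dominance.\<close>

lemma dominant_irr_subset:
  assumes V: "finite V" and X: "aclosed V X" and L: "dominant K L X" "\<And>i. i \<in> K \<Longrightarrow> (\<lambda>x. L x i) \<in> poly_fun V"
  obtains Z where "Z \<subseteq> X" "aclosed V Z" "irr V Z" "dominant K L Z"
proof -
  define S where "S = {\<lambda>x. p (L x) | p. p \<in> poly_fun K \<and> (\<exists>x. p x \<noteq> 0)}"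
  have SI: "(\<lambda>x. p (L x)) \<in> S" if "p \<in> poly_fun K" "\<exists>x. p x \<noteq> 0" for p using that by (auto simp: S_def)
  have SE: "\<exists>p\<in>poly_fun K. (\<exists>x. p x \<noteq> 0) \<and> s = (\<lambda>x. p (L x))" if "s \<in> S" for s
    using that by (auto simp: S_def)
  have "S \<subseteq> poly_fun V" using poly_fun_subst[OF _ L(2)] by (auto simp: S_def)
  moreover have "(\<lambda>x. 1) \<in> S" by (rule SI[OF poly_fun_const[of 1]]) simp
  moreover have "(\<lambda>x. s x * t x) \<in> S" if st: "s \<in> S" "t \<in> S" for s t
  proof -
    obtain p where p: "p \<in> poly_fun K" "\<exists>x. p x \<noteq> 0" "s = (\<lambda>x. p (L x))"
      using SE[OF st(1)] by (elim bexE conjE)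
    obtain q where q: "q \<in> poly_fun K" "\<exists>x. q x \<noteq> 0" "t = (\<lambda>x. q (L x))"
      using SE[OF st(2)] by (elim bexE conjE)
    have "\<exists>x. p x * q x \<noteq> 0"
    proof (rule ccontr)
      assume "\<not> ?thesis"
      then have "p x * q x = 0" for x by simp
      from poly_fun_domain[OF p(1) q(1) this] show False using p(2) q(2) by auto
    qed
    from SI[OF poly_fun_mult[OF p(1) q(1)] this] show ?thesis by (simp add: p(3) q(3))
  qed
  moreover have "\<exists>x\<in>X. s x \<noteq> 0" if s: "s \<in> S" for s
  proof -
    obtain p where p: "p \<in> poly_fun K" "\<exists>x. p x \<noteq> 0" "s = (\<lambda>x. p (L x))"
      using SE[OF s] by (elim bexE conjE)
    then show ?thesis using L(1) by (auto simp: dominant_def)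
  qed
  ultimately obtain Z where Z: "Z \<subseteq> X" "aclosed V Z" "irr V Z" "\<forall>s\<in>S. \<exists>z\<in>Z. s z \<noteq> 0"
    by (rule aclosed_irr_subset[OF V X])
  have "dominant K L Z"
    unfolding dominant_def
  proof (intro ballI impI, rule ccontr)
    fix p assume p: "p \<in> poly_fun K" "\<forall>z\<in>Z. p (L z) = 0" "\<not> (\<forall>x. p x = 0)"
    then have "(\<lambda>x. p (L x)) \<in> S" by (intro SI) auto
    then show False using Z(4) p(2) by auto
  qed
  then show ?thesis using Z by (intro that[of Z])
qed

lemma indep_irr_subset:
  assumes "finite V" "aclosed V X" "I \<subseteq> V" "indep I X"
  obtains Z where "Z \<subseteq> X" "aclosed V Z" "irr V Z" "indep I Z"
  by (rule dominant_irr_subset[OF assms(1,2,4)]) (use assms(3) in auto)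

text \<open>The image of \<open>Z\<close> in the coordinates \<open>I\<close> contains a nonempty
  open set: independence makes the elimination ideal zero, so every point satisfies
  \<open>kills\<close>, and \<open>specialize\<close> lifts those with \<open>h\<close>
  nonzero.\<close>

lemma irr_generic_point:
  assumes V: "finite V" and Z: "aclosed V Z" "irr V Z" and I: "I \<subseteq> V" "indep I Z"
  obtains h where "h \<in> poly_fun I" "\<exists>x. h x \<noteq> 0" "\<forall>x. h x \<noteq> 0 \<longrightarrow> (\<exists>z\<in>Z. \<forall>i\<in>I. z i = x i)"
proof -
  define P where "P = {p \<in> poly_fun V. \<forall>z\<in>Z. p z = 0}"
  interpret prime_ideal V P
  proof
    show "(\<lambda>x. 1) \<notin> P" using Z(2) by (auto simp: P_def irr_def)
  next
    fix p q assume "p \<in> poly_fun V" "q \<in> poly_fun V" "(\<lambda>x. p x * q x) \<in> P"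
    then show "p \<in> P \<or> q \<in> P" using irrD[OF Z(2), of p q] by (simp add: P_def)
  qed (auto simp: P_def intro: poly_fun_add poly_fun_mult)
  have zeros: "zeros = Z"
  proof
    show "zeros \<subseteq> Z"
    proof (rule subsetI, rule ccontr)
      fix y assume y: "y \<in> zeros" "y \<notin> Z"
      obtain q where "q \<in> poly_fun V" "\<forall>z\<in>Z. q z = 0" "q y \<noteq> 0" by (rule aclosed_separate[OF Z(1) y(2)])
      then have "q \<in> P" by (simp add: P_def)
      then show False using y(1) \<open>q y \<noteq> 0\<close> by (simp add: zeros_def)
    qed
    show "Z \<subseteq> zeros" unfolding zeros_def by (auto simp: P_def)
  qed
  have "\<exists>h\<in>poly_fun I. h \<notin> P \<and> (\<forall>x. kills x I \<longrightarrow> h x \<noteq> 0 \<longrightarrow>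
    (\<exists>y. (\<forall>i\<in>I. y i = x i) \<and> kills y (I \<union> (V - I)) \<and> 1 \<noteq> (0::complex)))"
    by (rule specialize) (use V I P_one in auto)
  then obtain h where h: "h \<in> poly_fun I" "h \<notin> P" and h': "\<forall>x. kills x I \<longrightarrow> h x \<noteq> 0 \<longrightarrow>
    (\<exists>y. (\<forall>i\<in>I. y i = x i) \<and> kills y (I \<union> (V - I)) \<and> 1 \<noteq> (0::complex))" by (elim bexE conjE)
  have "I \<union> (V - I) = V" using I(1) by auto
  have kills: "kills x I" for x
    unfolding kills_def
  proof (intro ballI impI)
    fix p assume "p \<in> P" "p \<in> poly_fun I"
    then show "p x = 0" by (intro dominantD[OF I(2), of p x]) (auto simp: P_def)
  qed
  have "\<exists>x. h x \<noteq> 0" using h poly_fun_mono[OF h(1) I(1)] by (auto simp: P_def)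
  moreover have "\<forall>x. h x \<noteq> 0 \<longrightarrow> (\<exists>z\<in>Z. \<forall>i\<in>I. z i = x i)"
  proof (intro allI impI)
    fix x assume "h x \<noteq> 0"
    then obtain y where "\<forall>i\<in>I. y i = x i" "kills y (I \<union> (V - I))" using h' kills by blast
    then show "\<exists>z\<in>Z. \<forall>i\<in>I. z i = x i"
      using \<open>I \<union> (V - I) = V\<close> kills_zeros zeros by auto
  qed
  ultimately show ?thesis using h(1) by (intro that[of h])
qed

section \<open>Krull dimension by chains of irreducible closed sets\<close>

definition irr_chain :: "'i set \<Rightarrow> ('i \<Rightarrow> complex) set \<Rightarrow> nat \<Rightarrow> bool" where
  "irr_chain V X m \<longleftrightarrow> (\<exists>C. (\<forall>l\<le>m. aclosed V (C l) \<and> irr V (C l) \<and> C l \<subseteq> X) \<and> (\<forall>l<m. C l \<subset> C (Suc l)))"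

text \<open>Every strict inclusion raises the order of growth by one, and growth of the largest
  member yields as many independent coordinates.\<close>

lemma irr_chain_indep:
  assumes V: "finite V" and "irr_chain V X m"
  obtains I where "I \<subseteq> V" "indep I X" "m \<le> card I"
proof -
  obtain C where C: "\<And>l. l \<le> m \<Longrightarrow> aclosed V (C l) \<and> irr V (C l) \<and> C l \<subseteq> X"
    "\<And>l. l < m \<Longrightarrow> C l \<subset> C (Suc l)" using assms(2) unfolding irr_chain_def by auto
  have grows: "grows V (C l) l" if "l \<le> m" for l
    using that
  proof (induction l)
    case 0
    have "C 0 \<noteq> {}" using C(1)[of 0] by (auto simp: irr_def)
    then show ?case by (rule grows_0)
  next
    case (Suc l)
    then have sub: "C l \<subset> C (Suc l)" using C(2) by simp
    then obtain x where x: "x \<in> C (Suc l)" "x \<notin> C l" by blast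
    have "aclosed V (C l)" using C(1) Suc by simp
    then obtain q where q: "q \<in> poly_fun V" "\<forall>z\<in>C l. q z = 0" "q x \<noteq> 0" by (rule aclosed_separate[OF _ x(2)])
    show ?case
      by (rule grows_step[of "C l" _ _ q]) (use sub q x C(1)[of "Suc l"] Suc in auto)
  qed
  have irr: "irr V (C m)" using C(1) by simp
  have "C m \<noteq> {}" using irr by (simp add: irr_def)
  obtain I where "I \<subseteq> V" "indep I (C m)" "m \<le> card I"
    by (rule irr_indep_extend[OF V irr empty_subsetI indep_empty[OF \<open>C m \<noteq> {}\<close>] grows[OF order_refl]])
  then show ?thesis using dominant_mono[of I _ "C m" I X] C(1)[of m] by (intro that[of I]) auto
qed

text \<open>Hyperplane sections: cutting an irreducible subset by \<open>x i = c\<close> for a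
  suitable \<open>c\<close> keeps the other coordinates of \<open>I\<close> independent, and the
  section is proper because \<open>i\<close> itself is independent.\<close>

lemma indep_irr_chain:
  assumes V: "finite V"
  shows "aclosed V X \<Longrightarrow> I \<subseteq> V \<Longrightarrow> indep I X \<Longrightarrow> irr_chain V X (card I)"
proof (induction "card I" arbitrary: X I)
  case 0
  have "finite I" using 0(3) V by (rule finite_subset)
  then have "I = {}" using 0(1) by simp
  have "X \<noteq> {}" using dominantD[OF 0(4) poly_fun_const[of 1]] by auto
  then obtain x where x: "x \<in> X" by auto
  define Z where "Z = {y. \<forall>q\<in>(\<lambda>i y. y i - x i) ` V. q y = 0}"
  have "aclosed V Z" unfolding Z_def by (rule aclosedI) (auto intro!: poly_fun_diff)
  moreover have "irr V Z" by (rule irr_affine) (auto simp: Z_def)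
  moreover have "Z \<subseteq> X" using aclosed_cong[OF 0(2) x] by (auto simp: Z_def)
  ultimately show ?case using \<open>I = {}\<close> unfolding irr_chain_def by (intro exI[of _ "\<lambda>_. Z"]) auto
next
  case (Suc m)
  obtain Z where Z: "Z \<subseteq> X" "aclosed V Z" "irr V Z" "indep I Z"
    by (rule indep_irr_subset[OF V Suc(3-5)])
  obtain h where h: "h \<in> poly_fun I" "\<exists>x. h x \<noteq> 0" "\<forall>x. h x \<noteq> 0 \<longrightarrow> (\<exists>z\<in>Z. \<forall>i\<in>I. z i = x i)"
    by (rule irr_generic_point[OF V Z(2,3) Suc(4) Z(4)])
  obtain x0 where x0: "h x0 \<noteq> 0" using h(2) by blast
  obtain i where i: "i \<in> I" using Suc(2) by fastforce
  \<comment> \<open>A value taken from a point where \<open>h\<close> is nonzero: then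
    \<open>h\<close> stays a nonzero polynomial after the coordinate \<open>i\<close> is fixed to
    \<open>c\<close>, and generic values of the other coordinates in \<open>I\<close> still
    lift.\<close>
  define c where "c = x0 i"
  define X' where "X' = Z \<inter> {y. \<forall>q\<in>{\<lambda>y. y i - c}. q y = 0}"
  have "(\<lambda>y. y i - c) \<in> poly_fun V" using i Suc(4) by (intro poly_fun_diff) auto
  then have X': "aclosed V X'" unfolding X'_def by (intro aclosed_Int[OF Z(2)] aclosedI) auto
  have "indep (I - {i}) X'"
    unfolding dominant_def
  proof (intro ballI impI)
    fix p assume p: "p \<in> poly_fun (I - {i})" "\<forall>z\<in>X'. p z = 0"
    have hc: "(\<lambda>x. h (x(i := c))) \<in> poly_fun (I - {i})"
    proof (rule poly_fun_subst[OF h(1)])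
      fix k assume "k \<in> I"
      then show "(\<lambda>x. (x(i := c)) k) \<in> poly_fun (I - {i})" by (cases "k = i") auto
    qed
    have "p x * h (x(i := c)) = 0" for x
    proof (cases "h (x(i := c)) = 0")
      case False
      then obtain z where z: "z \<in> Z" "\<forall>k\<in>I. z k = (x(i := c)) k" using h(3) by blast
      then have "z \<in> X'" using i by (simp add: X'_def)
      moreover have "p x = p z" by (rule poly_fun_cong[OF p(1)]) (use z in auto)
      ultimately show ?thesis using p(2) by simp
    qed simp
    then have "(\<forall>x. p x = 0) \<or> (\<forall>x. h (x(i := c)) = 0)" by (rule poly_fun_domain[OF p(1) hc])
    moreover have "h (x0(i := c)) \<noteq> 0" using x0 by (simp add: c_def)
    ultimately show "\<forall>x. p x = 0" by blast
  qed
  moreover have "card (I - {i}) = m" using Suc(2) i by simp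
  ultimately have "irr_chain V X' m" using Suc(1)[of "I - {i}" X'] X' Suc(4) by auto
  then obtain C where C: "\<forall>l\<le>m. aclosed V (C l) \<and> irr V (C l) \<and> C l \<subseteq> X'" "\<forall>l<m. C l \<subset> C (Suc l)"
    unfolding irr_chain_def by (elim exE conjE)
  have "X' \<subset> Z"
  proof
    show "X' \<subseteq> Z" by (auto simp: X'_def)
    have "\<exists>z\<in>Z. z i - c \<noteq> 0"
    proof (rule ccontr)
      assume no: "\<not> ?thesis"
      have "(\<lambda>y. y i - c) \<in> poly_fun I" using i by (intro poly_fun_diff) auto
      from dominantD[OF Z(4) this] no have "\<And>x. x i - c = 0" by auto
      from this[of "\<lambda>_. c + 1"] show False by simp
    qed
    then show "X' \<noteq> Z" by (auto simp: X'_def)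
  qed
  then have "C m \<subset> Z" using C(1) by auto
  define C' where "C' l = (if l \<le> m then C l else Z)" for l
  have "aclosed V (C' l) \<and> irr V (C' l) \<and> C' l \<subseteq> X" for l
    using C(1) Z \<open>X' \<subset> Z\<close> by (auto simp: C'_def)
  moreover have "C' l \<subset> C' (Suc l)" if "l < Suc m" for l
    using that C(2) \<open>C m \<subset> Z\<close> by (cases "l = m") (auto simp: C'_def)
  ultimately show ?case unfolding irr_chain_def Suc(2)[symmetric] by (intro exI[of _ C']) auto
qed

section \<open>Cones\<close>

definition dilate :: "complex \<Rightarrow> ('i \<Rightarrow> complex) \<Rightarrow> 'i \<Rightarrow> complex" where
  "dilate c x = (\<lambda>i. c * x i)"

definition homog :: "nat \<Rightarrow> (('i \<Rightarrow> complex) \<Rightarrow> complex) \<Rightarrow> bool" where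
  "homog d p \<longleftrightarrow> (\<forall>c x. p (dilate c x) = c ^ d * p x)"

text \<open>The scalar 0 is included, so a cone contains the origin.\<close>

definition conic :: "('i \<Rightarrow> complex) set \<Rightarrow> bool" where
  "conic Y \<longleftrightarrow> Y \<noteq> {} \<and> (\<forall>y\<in>Y. \<forall>c. dilate c y \<in> Y)"

lemma homogD: "homog d p \<Longrightarrow> p (dilate c x) = c ^ d * p x"
  by (simp add: homog_def)

lemma poly_deg_homog_parts:
  assumes "p \<in> poly_deg V s"
  shows "\<exists>ph. (\<forall>d. ph d \<in> poly_deg V d \<and> homog d (ph d)) \<and> (\<forall>x. p x = (\<Sum>d\<le>s. ph d x))"
  using assms
proof (induction rule: poly_deg_induct)
  case (const c s)
  define ph where "ph d = (\<lambda>x :: 'a \<Rightarrow> complex. if d = 0 then c else 0)" for d :: nat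
  have "\<forall>d. ph d \<in> poly_deg V d \<and> homog d (ph d)" by (simp add: ph_def poly_deg_const homog_def)
  moreover have "\<forall>x. c = (\<Sum>d\<le>s. ph d x)" by (simp add: ph_def sum.delta)
  ultimately show ?case by blast
next
  case (var i s p)
  obtain ph where ph: "\<forall>d. ph d \<in> poly_deg V d \<and> homog d (ph d)" "\<forall>x. p x = (\<Sum>d\<le>s. ph d x)"
    using var(3) by (elim exE conjE)
  define qh where "qh d = (case d of 0 \<Rightarrow> \<lambda>x. 0 | Suc d \<Rightarrow> \<lambda>x. x i * ph d x)" for d
  have "qh d \<in> poly_deg V d \<and> homog d (qh d)" for d
  proof (cases d)
    case (Suc e)
    have "homog e (ph e)" using ph(1) by simp
    then have "homog (Suc e) (\<lambda>x. x i * ph e x)" by (simp add: homog_def dilate_def)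
    then show ?thesis using poly_deg_var[OF var(1), of "ph e" e] ph(1) by (simp add: Suc qh_def)
  qed (simp add: qh_def poly_deg_const homog_def)
  moreover have "x i * p x = (\<Sum>d\<le>Suc s. qh d x)" for x
    unfolding sum.atMost_Suc_shift by (simp add: qh_def ph(2) sum_distrib_left)
  ultimately show ?case by (intro exI[of _ qh]) simp
next
  case (add s p q)
  obtain ph where ph: "\<forall>d. ph d \<in> poly_deg V d \<and> homog d (ph d)" "\<forall>x. p x = (\<Sum>d\<le>s. ph d x)"
    using add(3) by (elim exE conjE)
  obtain qh where qh: "\<forall>d. qh d \<in> poly_deg V d \<and> homog d (qh d)" "\<forall>x. q x = (\<Sum>d\<le>s. qh d x)"
    using add(4) by (elim exE conjE)
  show ?case
    by (rule exI[of _ "\<lambda>d x. ph d x + qh d x"])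
      (use ph qh in \<open>simp add: homog_def poly_deg_add distrib_left sum.distrib\<close>)
qed

lemma poly_deg_in_span_mon:
  assumes V: "finite V" and "p \<in> poly_deg V s"
  shows "in_span_on UNIV {\<kappa> \<in> V \<rightarrow>\<^sub>E {..s}. sum \<kappa> V \<le> s} (monomial (\<lambda>i x. x i) V) p"
  using assms(2)
proof (induction rule: poly_deg_induct)
  case (const c s)
  have fin: "finite {\<kappa> \<in> V \<rightarrow>\<^sub>E {..s}. sum \<kappa> V \<le> s}" using V by (simp add: finite_PiE)
  have "in_span_on UNIV {\<kappa> \<in> V \<rightarrow>\<^sub>E {..s}. sum \<kappa> V \<le> s} (monomial (\<lambda>i x. x i) V)
      (monomial (\<lambda>i x. x i) V (\<lambda>i\<in>V. 0))"
    by (rule in_span_on_base[OF fin]) auto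
  moreover have "monomial (\<lambda>i x. x i) V (\<lambda>i\<in>V. 0) = (\<lambda>x. 1)"
    by (simp add: fun_eq_iff monomial_def)
  ultimately have "in_span_on UNIV {\<kappa> \<in> V \<rightarrow>\<^sub>E {..s}. sum \<kappa> V \<le> s} (monomial (\<lambda>i x. x i) V) (\<lambda>x. 1)"
    by simp
  from in_span_on_cmult[OF this, of c] show ?case by (simp only: mult_1_right)
next
  case (var i s p)
  let ?m = "monomial (\<lambda>i x. x i) V"
  let ?S = "\<lambda>s. {\<kappa> \<in> V \<rightarrow>\<^sub>E {..s}. sum \<kappa> V \<le> s}"
  have fin: "finite (?S (Suc s))" using V by (simp add: finite_PiE)
  obtain c where c: "\<And>x. p x = (\<Sum>\<kappa>\<in>?S s. c \<kappa> * ?m \<kappa> x)"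
    using var(3) unfolding in_span_on_def by auto
  have "in_span_on UNIV (?S (Suc s)) ?m (\<lambda>x. x i * ?m \<kappa> x)" if k: "\<kappa> \<in> ?S s" for \<kappa>
  proof -
    define \<kappa>' where "\<kappa>' = \<kappa>(i := Suc (\<kappa> i))"
    have "sum \<kappa>' V = Suc (sum \<kappa> V)"
      using V var(1) unfolding \<kappa>'_def by (subst (1 2) sum.remove[of V i]) auto
    then have "\<kappa>' \<in> ?S (Suc s)"
      using k var(1) by (auto simp: \<kappa>'_def PiE_iff extensional_def le_Suc_eq)
    moreover have "?m \<kappa>' = (\<lambda>x. x i * ?m \<kappa> x)"
    proof
      fix x :: "_ \<Rightarrow> complex"
      have "(\<Prod>l\<in>V - {i}. x l ^ \<kappa>' l) = (\<Prod>l\<in>V - {i}. x l ^ \<kappa> l)"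
        by (intro prod.cong) (auto simp: \<kappa>'_def)
      then show "?m \<kappa>' x = x i * ?m \<kappa> x"
        unfolding monomial_def prod.remove[OF V var(1)] by (simp add: \<kappa>'_def)
    qed
    ultimately show ?thesis
      using in_span_on_base[OF fin, of \<kappa>' UNIV ?m] by simp
  qed
  then have "in_span_on UNIV (?S (Suc s)) ?m (\<lambda>x. \<Sum>\<kappa>\<in>?S s. c \<kappa> * (x i * ?m \<kappa> x))"
    by (intro in_span_on_sum in_span_on_cmult)
  then show ?case
    by (rule in_span_on_cong) (simp add: c sum_distrib_left mult.left_commute)
next
  case (add s p q)
  then show ?case by (intro in_span_on_add)
qed

lemma poly_sum_eq_coeff:
  fixes a b :: "nat \<Rightarrow> complex"
  assumes "\<And>c. (\<Sum>d\<le>n. a d * c ^ d) = 0" "d \<le> n"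
  shows "a d = 0"
proof -
  have "poly (\<Sum>d\<le>n. monom (a d) d) c = 0" for c
    using assms(1)[of c] by (simp add: poly_sum poly_monom)
  then have "(\<Sum>d\<le>n. monom (a d) d) = 0" using poly_all_0_iff_0 by blast
  then have "coeff (\<Sum>d\<le>n. monom (a d) d) d = 0" by simp
  then show ?thesis using assms(2) by (simp add: coeff_sum)
qed

text \<open>Along the line through \<open>x\<close> the values of the parts are the coefficients of
  a polynomial in \<open>c\<close>.\<close>

lemma homog_parts_vanish:
  assumes "\<And>d. homog d (ph d)" "\<And>c. (\<Sum>d\<le>s. ph d (dilate c x)) = 0" "d \<le> s"
  shows "ph d x = 0"
  by (rule poly_sum_eq_coeff[where n=s and a="\<lambda>d. ph d x"])
    (use assms homogD[OF assms(1)] in \<open>simp_all add: mult.commute\<close>)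

text \<open>Each coordinate vanishes wherever the forms \<open>g k\<close> do on \<open>Y\<close>,
  so by the Nullstellensatz a power of it is a combination of them there. By homogeneity only the
  parts of matching degree are kept, which gives the cofactors smaller degree than the
  power.\<close>

lemma power_reduction_on_cone:
  assumes V: "finite V" and K: "finite K" and Y: "aclosed V Y" "conic Y"
    and g: "\<And>k. k \<in> K \<Longrightarrow> g k \<in> poly_fun V" "\<And>k. k \<in> K \<Longrightarrow> homog (e k) (g k)" "\<And>k. k \<in> K \<Longrightarrow> e k \<ge> 1"
    and cut: "\<forall>y\<in>Y. (\<forall>k\<in>K. g k y = 0) \<longrightarrow> (\<forall>i\<in>V. y i = 0)"
    and j: "j \<in> V"
  shows "\<exists>N0. \<forall>N\<ge>N0. \<exists>q. (\<forall>k\<in>K. q k \<in> poly_deg V (N - 1)) \<and> (\<forall>y\<in>Y. y j ^ N = (\<Sum>k\<in>K. g k y * q k y))"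
proof -
  define J where "J = {p \<in> poly_fun V. \<exists>q. (\<forall>k\<in>K. q k \<in> poly_fun V) \<and> (\<forall>y\<in>Y. p y = (\<Sum>k\<in>K. g k y * q k y))}"
  have JI: "p \<in> J" if "p \<in> poly_fun V" "\<forall>k\<in>K. q k \<in> poly_fun V" "\<forall>y\<in>Y. p y = (\<Sum>k\<in>K. g k y * q k y)" for p q
    using that unfolding J_def by (intro CollectI conjI exI[of _ q])
  have JE: "p \<in> poly_fun V \<and> (\<exists>q. (\<forall>k\<in>K. q k \<in> poly_fun V) \<and> (\<forall>y\<in>Y. p y = (\<Sum>k\<in>K. g k y * q k y)))" if "p \<in> J" for p
    using that unfolding J_def by (rule CollectD)
  have ideal: "ideal_in V J"
    unfolding ideal_in_def
  proof (intro conjI ballI)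
    show "J \<subseteq> poly_fun V" unfolding J_def by auto
    show "(\<lambda>x. 0) \<in> J" by (rule JI[of _ "\<lambda>k x. 0"]) simp_all
  next
    fix p q assume "p \<in> J" "q \<in> J"
    then obtain a b where p: "p \<in> poly_fun V" "\<forall>k\<in>K. a k \<in> poly_fun V" "\<forall>y\<in>Y. p y = (\<Sum>k\<in>K. g k y * a k y)"
      and q: "q \<in> poly_fun V" "\<forall>k\<in>K. b k \<in> poly_fun V" "\<forall>y\<in>Y. q y = (\<Sum>k\<in>K. g k y * b k y)"
      using JE by (elim JE[elim_format] conjE exE)
    show "(\<lambda>x. p x + q x) \<in> J"
      by (rule JI[of _ "\<lambda>k x. a k x + b k x"])
        (use p q in \<open>simp_all add: poly_fun_add distrib_left sum.distrib\<close>)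
  next
    fix p c assume "p \<in> J" and c: "c \<in> poly_fun V"
    then obtain a where p: "p \<in> poly_fun V" "\<forall>k\<in>K. a k \<in> poly_fun V" "\<forall>y\<in>Y. p y = (\<Sum>k\<in>K. g k y * a k y)"
      by (elim JE[elim_format] conjE exE)
    show "(\<lambda>x. c x * p x) \<in> J"
      by (rule JI[of _ "\<lambda>k x. c x * a k x"])
        (use p c in \<open>simp_all add: poly_fun_mult sum_distrib_left mult.left_commute\<close>)
  qed
  have "\<exists>N. (\<lambda>x. x j ^ N) \<in> J"
  proof (rule strong_nullstellensatz[OF V ideal poly_fun_coord[OF j]])
    fix x assume x: "\<forall>p\<in>J. p x = 0"
    have "x \<in> Y"
    proof (rule ccontr)
      assume "x \<notin> Y"
      then obtain p where p: "p \<in> poly_fun V" "\<forall>z\<in>Y. p z = 0" "p x \<noteq> 0" by (rule aclosed_separate[OF Y(1)])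
      have "p \<in> J" by (rule JI[of _ "\<lambda>k x. 0"]) (use p in simp_all)
      then show False using x p(3) by blast
    qed
    moreover have "g k x = 0" if k: "k \<in> K" for k
    proof -
      have "g k \<in> J"
      proof (rule JI[OF g(1)[OF k], of "\<lambda>l x. if l = k then 1 else 0"])
        show "\<forall>y\<in>Y. g k y = (\<Sum>l\<in>K. g l y * (if l = k then 1 else 0))"
        proof
          fix y
          have "(\<Sum>l\<in>K. g l y * (if l = k then 1 else 0)) = (\<Sum>l\<in>K. if l = k then g l y else 0)"
            by (intro sum.cong) auto
          then show "g k y = (\<Sum>l\<in>K. g l y * (if l = k then 1 else 0))" using K k by (simp add: sum.delta)
        qed
      qed auto
      then show ?thesis using x by blast
    qed
    ultimately show "x j = 0" using cut j by blast
  qed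
  then obtain N0 where N0: "(\<lambda>x. x j ^ N0) \<in> J" by (elim exE)
  have "\<exists>q. (\<forall>k\<in>K. q k \<in> poly_deg V (N - 1)) \<and> (\<forall>y\<in>Y. y j ^ N = (\<Sum>k\<in>K. g k y * q k y))"
    if N: "N \<ge> Suc N0" for N
  proof -
    have "(\<lambda>x. x j ^ (N - N0) * x j ^ N0) \<in> J"
      using ideal N0 poly_fun_power[OF poly_fun_coord[OF j], of "N - N0"] by (simp add: ideal_in_def)
    then have "(\<lambda>x. x j ^ N) \<in> J" using N by (simp flip: power_add)
    then obtain q where q: "\<forall>k\<in>K. q k \<in> poly_fun V" "\<forall>y\<in>Y. y j ^ N = (\<Sum>k\<in>K. g k y * q k y)"
      by (elim JE[elim_format] conjE exE)
    have "\<exists>D. q ` K \<subseteq> poly_deg V D" by (rule poly_fun_common_deg) (use K q in auto)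
    then obtain D where D: "q ` K \<subseteq> poly_deg V D" by (elim exE)
    define rel where "rel k ph \<longleftrightarrow> (\<forall>d. ph d \<in> poly_deg V d \<and> homog d (ph d)) \<and>
      (\<forall>x. q k x = (\<Sum>d\<le>D. ph d x))" for k ph
    define ph where "ph k = (SOME ph. rel k ph)" for k
    have rel: "rel k (ph k)" if "k \<in> K" for k
    proof -
      have "q k \<in> poly_deg V D" using D that by auto
      then have "\<exists>ph. rel k ph" unfolding rel_def by (rule poly_deg_homog_parts)
      then show ?thesis unfolding ph_def by (rule someI_ex)
    qed
    \<comment> \<open>The part of \<open>q k\<close> that together with \<open>g k\<close> has
      degree \<open>N\<close>, or 0 if no part of that degree is available. As
      \<open>e k \<ge> 1\<close>, its degree is at most \<open>N - 1\<close>.\<close>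
    define q' where "q' k = (if e k \<le> N \<and> N - e k \<le> D then ph k (N - e k) else (\<lambda>x. 0))" for k
    have "q' k \<in> poly_deg V (N - 1)" if k: "k \<in> K" for k
    proof (cases "e k \<le> N \<and> N - e k \<le> D")
      case True
      have "ph k (N - e k) \<in> poly_deg V (N - e k)" using rel[OF k] by (simp add: rel_def)
      then have "ph k (N - e k) \<in> poly_deg V (N - 1)" by (rule poly_deg_mono_deg) (use g(3)[OF k] in simp)
      then show ?thesis using True by (simp add: q'_def)
    next
      case False
      show ?thesis unfolding q'_def if_not_P[OF False] by (rule poly_deg_const)
    qed
    moreover have "y j ^ N = (\<Sum>k\<in>K. g k y * q' k y)" if y: "y \<in> Y" for y
    proof -
      \<comment> \<open>Both sides along the line through \<open>y\<close>, as polynomials in the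
        scalar; their coefficients at \<open>N\<close> are compared.\<close>
      define A where "A = monom (y j ^ N) N"
      define B where "B = (\<Sum>k\<in>K. \<Sum>d\<le>D. monom (g k y * ph k d y) (d + e k))"
      have "poly A c = poly B c" for c
      proof -
        have "dilate c y \<in> Y" using Y(2) y by (simp add: conic_def)
        then have "(dilate c y) j ^ N = (\<Sum>k\<in>K. g k (dilate c y) * q k (dilate c y))" using q(2) by simp
        also have "\<dots> = (\<Sum>k\<in>K. \<Sum>d\<le>D. g k y * ph k d y * c ^ (d + e k))"
        proof (intro sum.cong refl)
          fix k assume k: "k \<in> K"
          have hom: "homog d (ph k d)" for d using rel[OF k] by (simp add: rel_def)
          have "q k (dilate c y) = (\<Sum>d\<le>D. c ^ d * ph k d y)"
            using rel[OF k] by (simp add: rel_def homogD[OF hom])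
          then show "g k (dilate c y) * q k (dilate c y) = (\<Sum>d\<le>D. g k y * ph k d y * c ^ (d + e k))"
            using homogD[OF g(2)[OF k]] by (simp add: sum_distrib_left power_add ac_simps)
        qed
        finally show ?thesis
          by (simp add: A_def B_def poly_sum poly_monom dilate_def power_mult_distrib mult.commute)
      qed
      then have "A = B" using poly_eq_poly_eq_iff by blast
      then have "y j ^ N = coeff B N" by (simp add: A_def flip: \<open>A = B\<close>)
      also have "\<dots> = (\<Sum>k\<in>K. g k y * q' k y)"
        unfolding B_def coeff_sum
      proof (intro sum.cong refl)
        fix k
        have "(\<Sum>d\<le>D. coeff (monom (g k y * ph k d y) (d + e k)) N) =
            (\<Sum>d\<le>D. if d = N - e k then (if e k \<le> N then g k y * ph k d y else 0) else 0)"
          by (intro sum.cong) (auto simp: coeff_monom)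
        then show "(\<Sum>d\<le>D. coeff (monom (g k y * ph k d y) (d + e k)) N) = g k y * q' k y"
          by (simp add: q'_def sum.delta)
      qed
      finally show ?thesis .
    qed
    ultimately show ?thesis by (intro exI[of _ q']) simp
  qed
  then show ?thesis by (intro exI[of _ "Suc N0"]) simp
qed

text \<open>If \<open>card K\<close> forms cut a cone down to the origin, then the coordinate ring of the cone is finite
  over the polynomials in these forms, which bounds the growth of its Hilbert function.\<close>

lemma indep_card_le_forms:
  assumes V: "finite V" and K: "finite K" and Y: "aclosed V Y" "conic Y"
    and g: "\<And>k. k \<in> K \<Longrightarrow> g k \<in> poly_fun V" "\<And>k. k \<in> K \<Longrightarrow> homog (e k) (g k)" "\<And>k. k \<in> K \<Longrightarrow> e k \<ge> 1"
    and cut: "\<forall>y\<in>Y. (\<forall>k\<in>K. g k y = 0) \<longrightarrow> (\<forall>i\<in>V. y i = 0)"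
    and I: "I \<subseteq> V" "indep I Y"
  shows "card I \<le> card K"
proof -
  define red where "red j N q \<longleftrightarrow> (\<forall>k\<in>K. q k \<in> poly_deg V (N - 1)) \<and> (\<forall>y\<in>Y. y j ^ N = (\<Sum>k\<in>K. g k y * q k y))"
    for j N q
  have "\<forall>j\<in>V. \<exists>N0. \<forall>N\<ge>N0. \<exists>q. red j N q"
    unfolding red_def by (intro ballI power_reduction_on_cone[where g=g and e=e, OF V K Y g cut])
  from bchoice[OF this] obtain N0 where N0: "\<forall>j\<in>V. \<forall>N\<ge>N0 j. \<exists>q. red j N q" by (elim exE)
  \<comment> \<open>One exponent that works for all coordinates; \<open>Suc\<close> keeps it
    positive, so that a reduction lowers the degree of the cofactors.\<close>
  define N where "N = Suc (\<Sum>j\<in>V. N0 j)"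
  have "N \<ge> N0 j" if "j \<in> V" for j
    using member_le_sum[OF that, of N0] V by (simp add: N_def)
  then have red: "\<exists>q. red j N q" if "j \<in> V" for j using N0 that by blast
  have N1: "N \<ge> 1" by (simp add: N_def)
  define B where "B = V \<rightarrow>\<^sub>E {..<N}"
  let ?m = "monomial (\<lambda>i x. x i) V"
  have B: "finite B" unfolding B_def using V by (intro finite_PiE) auto
  \<comment> \<open>A monomial with an exponent at least \<open>N\<close> is rewritten by the
    reduction of \<open>x j ^ N\<close>. Every summand has a factor \<open>g k\<close>, which raises
    the filtration by 1, and a cofactor of smaller degree, so the filtration index stays within the
    degree.\<close>
  have monomial: "gspan Y g K B ?m (sum \<kappa> V) (?m \<kappa>)" for \<kappa>
  proof (induction "sum \<kappa> V" arbitrary: \<kappa> rule: less_induct)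
    case less
    show ?case
    proof (cases "\<forall>i\<in>V. \<kappa> i < N")
      case True
      then have "restrict \<kappa> V \<in> B" by (auto simp: B_def)
      moreover have "?m (restrict \<kappa> V) = ?m \<kappa>"
        by (simp add: fun_eq_iff monomial_def cong: prod.cong)
      ultimately show ?thesis using gspan_base[OF K B, of "restrict \<kappa> V" Y g ?m] by simp
    next
      case False
      then obtain j where j: "j \<in> V" "\<kappa> j \<ge> N" by force
      obtain q where q: "red j N q" using red[OF j(1)] by (elim exE)
      define \<kappa>' where "\<kappa>' = \<kappa>(j := \<kappa> j - N)"
      have sum': "sum \<kappa> V = sum \<kappa>' V + N"
      proof -
        have "sum \<kappa>' (V - {j}) = sum \<kappa> (V - {j})" by (intro sum.cong) (auto simp: \<kappa>'_def)
        then show ?thesis using j by (simp add: sum.remove[OF V j(1)] \<kappa>'_def)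
      qed
      have m: "?m \<kappa> x = x j ^ N * ?m \<kappa>' x" for x
      proof -
        have "(\<Prod>l\<in>V - {j}. x l ^ \<kappa>' l) = (\<Prod>l\<in>V - {j}. x l ^ \<kappa> l)"
          by (intro prod.cong) (auto simp: \<kappa>'_def)
        then show ?thesis using j(2)
          unfolding monomial_def prod.remove[OF V j(1)] by (simp add: \<kappa>'_def flip: power_add mult.assoc)
      qed
      have mdeg: "?m \<kappa>' \<in> poly_deg V (sum \<kappa>' V)"
      proof -
        have "(\<lambda>x. \<Prod>i\<in>W. x i ^ \<kappa>' i) \<in> poly_deg V (sum \<kappa>' W)" if "finite W" "W \<subseteq> V" for W
          using that
        proof (induction W rule: finite_induct)
          case (insert i W)
          have "(\<lambda>x. x i ^ n) \<in> poly_deg V n" for n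
          proof (induction n)
            case (Suc n)
            then show ?case using poly_deg_var[of i V _ n] insert by simp
          qed (simp add: poly_deg_const)
          from poly_deg_mult[OF this insert.IH] show ?case using insert by simp
        qed (simp add: poly_deg_const)
        from this[OF V order_refl] show ?thesis unfolding monomial_def .
      qed
      have low: "gspan Y g K B ?m (sum \<kappa> V - 1) p" if p: "p \<in> poly_deg V (sum \<kappa> V - 1)" for p
      proof -
        let ?S = "{\<kappa>' \<in> V \<rightarrow>\<^sub>E {..sum \<kappa> V - 1}. sum \<kappa>' V \<le> sum \<kappa> V - 1}"
        obtain c where c: "\<And>x. p x = (\<Sum>\<kappa>\<in>?S. c \<kappa> * ?m \<kappa> x)"
          using poly_deg_in_span_mon[OF V p] unfolding in_span_on_def by auto
        have "gspan Y g K B ?m (sum \<kappa> V - 1) (\<lambda>x. \<Sum>\<kappa>\<in>?S. c \<kappa> * ?m \<kappa> x)"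
        proof (intro gspan_sum gspan_cmult)
          fix \<kappa>1 assume "\<kappa>1 \<in> ?S"
          then have "sum \<kappa>1 V \<le> sum \<kappa> V - 1" by simp
          moreover from this have "sum \<kappa>1 V < sum \<kappa> V" using sum' N1 by simp
          ultimately show "gspan Y g K B ?m (sum \<kappa> V - 1) (?m \<kappa>1)"
            using gspan_mono[OF K B less] by blast
        qed
        then show ?thesis by (rule gspan_cong) (simp add: c)
      qed
      have "gspan Y g K B ?m (Suc (sum \<kappa> V - 1)) (\<lambda>x. \<Sum>k\<in>K. g k x * (q k x * ?m \<kappa>' x))"
      proof (intro gspan_sum gspan_coord[OF K B low])
        fix k assume "k \<in> K"
        then have "q k \<in> poly_deg V (N - 1)" using q by (simp add: red_def)
        from poly_deg_mult[OF this mdeg]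
        show "(\<lambda>x. q k x * ?m \<kappa>' x) \<in> poly_deg V (sum \<kappa> V - 1)" using sum' N1 by (simp add: add.commute)
      qed
      moreover have "Suc (sum \<kappa> V - 1) = sum \<kappa> V" using sum' N1 by simp
      ultimately have "gspan Y g K B ?m (sum \<kappa> V) (\<lambda>x. \<Sum>k\<in>K. g k x * (q k x * ?m \<kappa>' x))" by simp
      then show ?thesis
      proof (rule gspan_cong)
        fix y assume "y \<in> Y"
        then have "y j ^ N = (\<Sum>k\<in>K. g k y * q k y)" using q by (simp add: red_def)
        then show "(\<Sum>k\<in>K. g k y * (q k y * ?m \<kappa>' y)) = ?m \<kappa> y"
          by (simp add: m sum_distrib_right mult.assoc)
      qed
    qed
  qed
  have span: "gspan Y g K B ?m s p" if p: "p \<in> poly_deg V s" for p s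
  proof -
    let ?S = "{\<kappa> \<in> V \<rightarrow>\<^sub>E {..s}. sum \<kappa> V \<le> s}"
    obtain c where c: "\<And>x. p x = (\<Sum>\<kappa>\<in>?S. c \<kappa> * ?m \<kappa> x)"
      using poly_deg_in_span_mon[OF V p] unfolding in_span_on_def by auto
    have "gspan Y g K B ?m s (\<lambda>x. \<Sum>\<kappa>\<in>?S. c \<kappa> * ?m \<kappa> x)"
    proof (intro gspan_sum gspan_cmult)
      fix \<kappa> assume "\<kappa> \<in> ?S"
      then show "gspan Y g K B ?m s (?m \<kappa>)" using gspan_mono[OF K B monomial[of \<kappa>]] by simp
    qed
    then show ?thesis by (rule gspan_cong) (simp add: c)
  qed
  have finI: "finite I" using I(1) V by (rule finite_subset)
  obtain k where k: "\<And>s. hilb_ge V (k * s) Y (s ^ card I)"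
    using grows_indep[OF finI I(2,1)] by (auto simp: grows_def)
  have "s ^ card I \<le> (k * s + 1) ^ card K * card B" for s
  proof -
    obtain p where p: "\<And>j. j < s ^ card I \<Longrightarrow> p j \<in> poly_deg V (k * s)" "lin_indep_on Y {..<s ^ card I} p"
      using k[of s] by (auto simp: hilb_ge_def)
    from p(2) have "card {..<s ^ card I} \<le> card ((K \<rightarrow>\<^sub>E {..k * s}) \<times> B)"
      by (rule lin_indep_on_card_le) (use span p(1) K B in \<open>auto simp: gspan_def intro!: finite_PiE\<close>)
    then show ?thesis by (simp add: card_gspan_index[OF K])
  qed
  then show ?thesis by (rule power_growth_le)
qed

section \<open>Families of cones\<close>

definition linform :: "'i set \<Rightarrow> (('i \<Rightarrow> complex) \<Rightarrow> complex) \<Rightarrow> bool" where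
  "linform V l \<longleftrightarrow> l \<in> poly_deg V (Suc 0) \<and> homog 1 l"

lemma linform_coord: "i \<in> V \<Longrightarrow> linform V (\<lambda>x. x i)"
  by (simp add: linform_def poly_deg_coord homog_def dilate_def)

lemma linform_diff: "linform V l \<Longrightarrow> linform V m \<Longrightarrow> linform V (\<lambda>x. l x - c * m x)"
  unfolding linform_def homog_def
  using poly_deg_add[OF _ poly_deg_cmult[of m V "Suc 0" "- c"], of l] by (simp add: algebra_simps)

lemma linform_poly_fun: "linform V l \<Longrightarrow> l \<in> poly_fun V"
  by (auto simp: linform_def intro: poly_deg_PF)

text \<open>Linear forms over whose polynomial ring the coordinate ring of the cone is finite,
  expressed by the geometric condition that passes to nearby fibres.\<close>

definition cuts_out :: "'i set \<Rightarrow> 'k set \<Rightarrow> (('i \<Rightarrow> complex) \<Rightarrow> 'k \<Rightarrow> complex) \<Rightarrow> ('i \<Rightarrow> complex) set \<Rightarrow> bool" where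
  "cuts_out V K L Y \<longleftrightarrow> (\<forall>k\<in>K. linform V (\<lambda>x. L x k)) \<and>
    (\<forall>y\<in>Y. (\<forall>k\<in>K. L y k = 0) \<longrightarrow> (\<forall>i\<in>V. y i = 0))"

text \<open>If the image of the cone under the linear forms satisfies a nontrivial polynomial relation,
  then it satisfies a homogeneous one, \<open>ph d\<close>. Choose \<open>x\<close> with \<open>ph d x \<noteq> 0\<close>: the combinations of
  the forms that vanish in the direction \<open>x\<close> still cut out the origin.\<close>

lemma cuts_out_reduce:
  assumes Y: "conic Y" and K: "cuts_out V K L Y" and "\<not> dominant K L Y"
  shows "\<exists>k\<in>K. \<exists>L'. cuts_out V (K - {k}) L' Y"
proof -
  obtain p where p: "p \<in> poly_fun K" "\<forall>z\<in>Y. p (L z) = 0" "\<exists>x. p x \<noteq> 0" by (rule not_dominantE[OF assms(3)])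
  obtain s where "p \<in> poly_deg K s" using p(1) by (auto simp: poly_fun_def)
  then obtain ph where ph: "\<forall>d. ph d \<in> poly_deg K d \<and> homog d (ph d)" "\<forall>x. p x = (\<Sum>d\<le>s. ph d x)"
    using poly_deg_homog_parts by blast
  obtain x where "p x \<noteq> 0" using p(3) by blast
  then have "\<exists>d\<in>{..s}. ph d x \<noteq> 0" using ph(2) sum.neutral by force
  then obtain d where d: "d \<le> s" "ph d x \<noteq> 0" by auto
  have hom: "homog d (ph d)" for d using ph(1) by simp
  have phPF: "ph d \<in> poly_fun K" for d using ph(1) poly_deg_PF by blast
  have lin: "linform V (\<lambda>x. L x k)" if "k \<in> K" for k using K that by (simp add: cuts_out_def)
  have dil: "L (dilate c y) k = dilate c (L y) k" if "k \<in> K" for c y k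
    using lin[OF that] by (simp add: linform_def homog_def dilate_def[of c "L y"])
  have vanish: "ph d (L y) = 0" if y: "y \<in> Y" for y
  proof (rule homog_parts_vanish[OF hom _ d(1)])
    fix c
    have "(\<Sum>d\<le>s. ph d (dilate c (L y))) = p (dilate c (L y))" using ph(2) by simp
    also have "\<dots> = p (L (dilate c y))" by (rule poly_fun_cong[OF p(1)]) (simp add: dil)
    also have "\<dots> = 0" using p(2) Y y by (simp add: conic_def)
    finally show "(\<Sum>d\<le>s. ph d (dilate c (L y))) = 0" .
  qed
  obtain y0 where y0: "y0 \<in> Y" using Y by (auto simp: conic_def)
  have d0: "d \<noteq> 0"
  proof
    assume "d = 0"
    have "ph d x = ph d (dilate 0 x)" using homogD[OF hom[of d], of 0 x] \<open>d = 0\<close> by simp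
    also have "dilate 0 x = dilate 0 (L y0)" by (simp add: dilate_def)
    also have "ph d \<dots> = 0" using homogD[OF hom[of d], of 0 "L y0"] vanish[OF y0] by simp
    finally show False using d(2) by simp
  qed
  have "\<exists>k\<in>K. x k \<noteq> 0"
  proof (rule ccontr)
    assume no: "\<not> ?thesis"
    have "ph d x = ph d (dilate 0 x)" by (rule poly_fun_cong[OF phPF]) (use no in \<open>simp add: dilate_def\<close>)
    then show False using homogD[OF hom[of d], of 0 x] d0 d(2) by (simp add: power_0_left)
  qed
  then obtain k where k: "k \<in> K" "x k \<noteq> 0" by blast
  define L' where "L' y j = L y j - (x j / x k) * L y k" for y j
  have "cuts_out V (K - {k}) L' Y"
    unfolding cuts_out_def
  proof (intro conjI ballI impI)
    fix j assume "j \<in> K - {k}"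
    then show "linform V (\<lambda>x. L' x j)" unfolding L'_def by (intro linform_diff lin k) simp
  next
    fix y i assume y: "y \<in> Y" and z: "\<forall>j\<in>K - {k}. L' y j = 0" and i: "i \<in> V"
    define c where "c = L y k / x k"
    have Lc: "L y j = dilate c x j" if "j \<in> K" for j
      using z that k(2) by (cases "j = k") (simp_all add: c_def dilate_def L'_def)
    have "0 = ph d (L y)" using vanish[OF y] by simp
    also have "\<dots> = ph d (dilate c x)" by (rule poly_fun_cong[OF phPF]) (rule Lc)
    also have "\<dots> = c ^ d * ph d x" by (rule homogD[OF hom])
    finally have "c = 0" using d(2) by simp
    then have "\<forall>j\<in>K. L y j = 0" using Lc by (simp add: dilate_def)
    then show "y i = 0" using K y i by (simp add: cuts_out_def)
  qed
  then show ?thesis using k(1) by blast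
qed

text \<open>Noether normalization for cones: starting from all coordinates,
  \<open>cuts_out_reduce\<close> lowers the number of forms as long as they satisfy a relation on
  the cone.\<close>

lemma cuts_out_dominant:
  assumes "finite V" "conic Y"
  obtains K L where "K \<subseteq> V" "cuts_out V K L Y" "dominant K L Y"
proof -
  have "\<exists>K'\<subseteq>V. \<exists>L'. cuts_out V K' L' Y \<and> dominant K' L' Y" if "K \<subseteq> V" "cuts_out V K L Y" for K L
    using that
  proof (induction "card K" arbitrary: K L rule: less_induct)
    case less
    show ?case
    proof (cases "dominant K L Y")
      case True
      then show ?thesis using less.prems by blast
    next
      case False
      obtain k L' where k: "k \<in> K" "cuts_out V (K - {k}) L' Y"
        using cuts_out_reduce[OF assms(2) less.prems(2) False] by blast
      have "finite K" using less.prems(1) assms(1) by (rule finite_subset)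
      then have "card (K - {k}) < card K" using k(1) by (rule card_Diff1_less)
      from less.hyps[OF this _ k(2)] less.prems(1) show ?thesis by blast
    qed
  qed
  moreover have "cuts_out V V (\<lambda>x. x) Y" by (simp add: cuts_out_def linform_coord)
  ultimately have "\<exists>K'\<subseteq>V. \<exists>L'. cuts_out V K' L' Y \<and> dominant K' L' Y" by blast
  then show ?thesis using that by blast
qed

text \<open>Dominance of the forms gives growth of order \<open>card K\<close>, and on an
  irreducible subset growth is realized by coordinates. Together with
  \<open>indep_card_le_forms\<close> the number of parameters equals the dimension.\<close>

lemma cone_parameters:
  assumes V: "finite V" and Y: "aclosed V Y" "conic Y"
  obtains K L I where "K \<subseteq> V" "cuts_out V K L Y" "I \<subseteq> V" "indep I Y" "card K \<le> card I"
proof -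
  obtain K L where K: "K \<subseteq> V" "cuts_out V K L Y" "dominant K L Y" by (rule cuts_out_dominant[OF V Y(2)])
  have finK: "finite K" using K(1) V by (rule finite_subset)
  have lin: "linform V (\<lambda>x. L x k)" if "k \<in> K" for k using K(2) that by (simp add: cuts_out_def)
  obtain Z where Z: "Z \<subseteq> Y" "aclosed V Z" "irr V Z" "dominant K L Z"
    by (rule dominant_irr_subset[OF V Y(1) K(3) linform_poly_fun[OF lin]])
  have "grows V Z (card K)"
    by (rule grows_dominant[OF finK Z(4)]) (use lin in \<open>simp add: linform_def\<close>)
  moreover have "Z \<noteq> {}" using Z(3) by (simp add: irr_def)
  ultimately obtain I where I: "I \<subseteq> V" "indep I Z" "card K \<le> card I"
    using irr_indep_extend[OF V Z(3) empty_subsetI indep_empty] by metis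
  show ?thesis by (rule that[OF K(1,2) I(1) dominant_mono[OF I(2) order_refl Z(1)] I(3)])
qed

lemma aclosed_zero_Int:
  assumes "aclosed V Y" "g \<in> poly_fun V"
  shows "aclosed V {y \<in> Y. g y = 0}"
proof -
  have "aclosed V (Y \<inter> {y. \<forall>q\<in>{g}. q y = 0})"
    by (intro aclosed_Int aclosedI assms) (use assms in simp)
  then show ?thesis by (simp add: Int_def)
qed

text \<open>A system of parameters of the section together with \<open>g\<close> is one of the cone: this is the case of Krull's
  principal ideal theorem that is needed.\<close>

lemma cone_hypersurface:
  assumes V: "finite V" and Y: "aclosed V Y" "conic Y" and g: "g \<in> poly_fun V" "homog d g" "d \<ge> 1"
    and J: "J \<subseteq> V" "indep J Y"
  obtains I where "I \<subseteq> V" "indep I {y \<in> Y. g y = 0}" "card J \<le> Suc (card I)"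
proof -
  let ?Y = "{y \<in> Y. g y = 0}"
  obtain y where y: "y \<in> Y" using Y by (auto simp: conic_def)
  have "dilate 0 y \<in> ?Y" using y Y(2) homogD[OF g(2), of 0 y] g(3) by (simp add: conic_def)
  then have "conic ?Y" using Y(2) homogD[OF g(2)] unfolding conic_def by auto
  then obtain K L I where K: "K \<subseteq> V" "cuts_out V K L ?Y" and I: "I \<subseteq> V" "indep I ?Y" "card K \<le> card I"
    by (rule cone_parameters[OF V aclosed_zero_Int[OF Y(1) g(1)]])
  have lin: "linform V (\<lambda>x. L x k)" if "k \<in> K" for k using K(2) that by (simp add: cuts_out_def)
  \<comment> \<open>The index \<open>None\<close> stands for \<open>g\<close> and
    \<open>Some k\<close> for the linear forms, which makes \<open>Suc (card K)\<close> forms on the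
    whole cone.\<close>
  define g' where "g' = (\<lambda>k x. case k of None \<Rightarrow> g x | Some k \<Rightarrow> L x k)"
  define e where "e k = (case k of None \<Rightarrow> d | Some k \<Rightarrow> 1)" for k :: "'a option"
  define K' where "K' = insert None (Some ` K)"
  have finK: "finite K" using K(1) V by (rule finite_subset)
  have "card J \<le> card K'"
  proof (rule indep_card_le_forms[where g=g' and e=e, OF V _ Y])
    show "finite K'" using finK by (simp add: K'_def)
    show "g' k \<in> poly_fun V" "homog (e k) (g' k)" "e k \<ge> 1" if "k \<in> K'" for k
      using that g lin linform_poly_fun[OF lin] by (auto simp: K'_def g'_def e_def linform_def)
    show "\<forall>y\<in>Y. (\<forall>k\<in>K'. g' k y = 0) \<longrightarrow> (\<forall>i\<in>V. y i = 0)"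
      using K(2) by (simp add: K'_def g'_def cuts_out_def)
  qed (use J in auto)
  also have "\<dots> = Suc (card K)" using finK by (simp add: K'_def card_image)
  finally show ?thesis using I by (intro that[of I]) auto
qed

section \<open>Semicontinuity of the dimension of fibres\<close>

lemma poly_fun_continuous: "p \<in> poly_fun V \<Longrightarrow> continuous_on UNIV p"
  by (induction rule: poly_fun_induct) (auto intro!: continuous_intros continuous_on_product_coordinates)

lemma closed_aclosed:
  assumes "aclosed V X"
  shows "closed X"
proof -
  obtain Q where Q: "Q \<subseteq> poly_fun V" "X = {x. \<forall>q\<in>Q. q x = 0}"
    using assms unfolding aclosed_def by (elim exE conjE)
  have "closed {x. q x = 0}" if "q \<in> Q" for q
    using Q(1) that poly_fun_continuous[of q V] by (intro closed_Collect_eq) auto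
  then have "closed (\<Inter>q\<in>Q. {x. q x = 0})" by (intro closed_INT) auto
  moreover have "X = (\<Inter>q\<in>Q. {x. q x = 0})" using Q(2) by auto
  ultimately show ?thesis by simp
qed

text \<open>The values of \<open>c\<close> on \<open>B\<close> are discarded: fibres stay in the
  same space of points and are closed in the coordinates outside \<open>B\<close>.\<close>

abbreviation fibre :: "('i \<Rightarrow> complex) set \<Rightarrow> 'i set \<Rightarrow> ('i \<Rightarrow> complex) \<Rightarrow> ('i \<Rightarrow> complex) set" where
  "fibre X B t \<equiv> {c. override_on c t B \<in> X}"

lemma poly_fun_if: "(b \<Longrightarrow> p \<in> poly_fun V) \<Longrightarrow> (\<not> b \<Longrightarrow> q \<in> poly_fun V) \<Longrightarrow> (\<lambda>x. if b then p x else q x) \<in> poly_fun V"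
  by (cases b) simp_all

lemma poly_fun_override: "p \<in> poly_fun V \<Longrightarrow> (\<lambda>c. p (override_on c t B)) \<in> poly_fun (V - B)"
  by (rule poly_fun_subst[where q="\<lambda>c. override_on c t B"]) (auto simp: override_on_def intro!: poly_fun_if)

lemma poly_fun_override': "p \<in> poly_fun V \<Longrightarrow> (\<lambda>t. p (override_on c t B)) \<in> poly_fun (V \<inter> B)"
  by (rule poly_fun_subst[where q="\<lambda>t. override_on c t B"]) (auto simp: override_on_def intro!: poly_fun_if)

lemma aclosed_fibre:
  assumes "aclosed V X"
  shows "aclosed (V - B) (fibre X B t)"
proof -
  obtain Q where Q: "Q \<subseteq> poly_fun V" "X = {x. \<forall>q\<in>Q. q x = 0}"
    using assms unfolding aclosed_def by (elim exE conjE)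
  have "aclosed (V - B) {c. \<forall>q\<in>(\<lambda>q c. q (override_on c t B)) ` Q. q c = 0}"
    by (rule aclosedI) (use poly_fun_override[OF subsetD[OF Q(1)]] in auto)
  then show ?thesis by (simp add: Q(2))
qed

text \<open>Generic values of the coordinates \<open>I\<close> lift to \<open>X\<close>. Fixing
  those in \<open>B\<close> to \<open>t\<close> leaves \<open>h\<close> a nonzero polynomial in the
  others, as its value at \<open>t\<close> itself shows.\<close>

lemma indep_fibre_generic:
  assumes V: "finite V" and X: "aclosed V X" and I: "I \<subseteq> V" "indep I X" and B: "B \<subseteq> I"
  obtains h where "h \<in> poly_fun I" "\<exists>x. h x \<noteq> 0" "\<forall>t. h t \<noteq> 0 \<longrightarrow> indep (I - B) (fibre X B t)"
proof -
  obtain Z where Z: "Z \<subseteq> X" "aclosed V Z" "irr V Z" "indep I Z" by (rule indep_irr_subset[OF V X I])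
  obtain h where h: "h \<in> poly_fun I" "\<exists>x. h x \<noteq> 0" "\<forall>x. h x \<noteq> 0 \<longrightarrow> (\<exists>z\<in>Z. \<forall>i\<in>I. z i = x i)"
    by (rule irr_generic_point[OF V Z(2,3) I(1) Z(4)])
  have "indep (I - B) (fibre X B t)" if t: "h t \<noteq> 0" for t
    unfolding dominant_def
  proof (intro ballI impI)
    fix p assume p: "p \<in> poly_fun (I - B)" "\<forall>z\<in>fibre X B t. p z = 0"
    have "p x * h (override_on x t B) = 0" for x
    proof (cases "h (override_on x t B) = 0")
      case False
      then obtain z where z: "z \<in> Z" "\<forall>i\<in>I. z i = override_on x t B i" using h(3) by blast
      have "override_on z t B = z" using z(2) B by (auto simp: override_on_def fun_eq_iff)
      then have "p z = 0" using p(2) z(1) Z(1) by auto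
      moreover have "p x = p z" by (rule poly_fun_cong[OF p(1)]) (use z(2) in \<open>simp add: override_on_def\<close>)
      ultimately show ?thesis by simp
    qed simp
    then have "(\<forall>x. p x = 0) \<or> (\<forall>x. h (override_on x t B) = 0)"
      by (rule poly_fun_domain[OF p(1) poly_fun_override[OF h(1)]])
    moreover have "override_on t t B = t" by (simp add: override_on_def)
    ultimately show "\<forall>x. p x = 0" using t by metis
  qed
  then show ?thesis using h(1,2) by (intro that[of h]) auto
qed

text \<open>Tychonoff's theorem. In the application the radius is 0 outside a finite set of
  coordinates.\<close>

lemma compact_box:
  fixes lo :: "'i \<Rightarrow> complex" and r :: "'i \<Rightarrow> real"
  shows "compact {c. \<forall>i. c i \<in> cball (lo i) (r i)}"
proof -
  have "compactin (product_topology (\<lambda>i. euclidean) UNIV) (PiE UNIV (\<lambda>i. cball (lo i) (r i)))"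
    unfolding compactin_PiE by simp
  moreover have "PiE UNIV (\<lambda>i. cball (lo i) (r i)) = {c. \<forall>i. c i \<in> cball (lo i) (r i)}"
    by (auto simp: PiE_UNIV_domain)
  ultimately show ?thesis by (simp add: euclidean_product_topology)
qed

text \<open>The reason is compactness of the unit sphere.\<close>

lemma cuts_out_nearby:
  assumes V: "finite V" and B: "B \<subseteq> V" and X: "aclosed V X" and cone: "\<And>t. conic (fibre X B t)"
    and K: "finite K" "cuts_out (V - B) K L (fibre X B t0)"
  shows "\<exists>\<epsilon>>0. \<forall>t. (\<forall>j\<in>B. norm (t j - t0 j) < \<epsilon>) \<longrightarrow> cuts_out (V - B) K L (fibre X B t)"
proof -
  have finB: "finite B" and finV': "finite (V - B)" using V B finite_subset by auto
  have lin: "linform (V - B) (\<lambda>x. L x k)" if "k \<in> K" for k using K(2) that by (simp add: cuts_out_def)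
  \<comment> \<open>Unit vectors, in fibres over the unit box around \<open>t0\<close>, on which all
    forms vanish. None lies over \<open>t0\<close>, so by compactness the distance \<open>f\<close>
    from \<open>t0\<close> has a positive lower bound on \<open>S\<close>.\<close>
  define S where "S = {c. \<forall>i. c i \<in> cball (if i \<in> B then t0 i else 0) (if i \<in> V then 1 else 0)} \<inter>
    (X \<inter> ({c. (\<Sum>i\<in>V - B. norm (c i)) = 1} \<inter> (\<Inter>k\<in>K. {c. L c k = 0})))"
  define f where "f c = (\<Sum>j\<in>B. norm (c j - t0 j))" for c :: "'a \<Rightarrow> complex"
  have "closed {c. L c k = 0}" if "k \<in> K" for k
    by (intro closed_Collect_eq poly_fun_continuous[OF linform_poly_fun[OF lin[OF that]]]) auto
  moreover have "closed {c :: 'a \<Rightarrow> complex. (\<Sum>i\<in>V - B. norm (c i)) = 1}"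
    by (intro closed_Collect_eq continuous_intros continuous_on_product_coordinates)
  ultimately have S: "compact S"
    unfolding S_def by (intro compact_Int_closed compact_box closed_Int closed_INT closed_aclosed[OF X]) auto
  have cont: "continuous_on S f"
    unfolding f_def
    by (intro continuous_intros continuous_on_subset[OF continuous_on_product_coordinates]) auto
  have pos: "f c > 0" if c: "c \<in> S" for c
  proof (rule ccontr)
    assume "\<not> f c > 0"
    then have "f c = 0" unfolding f_def by (simp add: not_less order_antisym sum_nonneg)
    then have "\<forall>j\<in>B. c j = t0 j" unfolding f_def using finB by (simp add: sum_nonneg_eq_0_iff)
    then have "override_on c t0 B = c" by (auto simp: override_on_def fun_eq_iff)
    then have "c \<in> fibre X B t0" using c by (simp add: S_def)
    moreover have "\<forall>k\<in>K. L c k = 0" using c by (simp add: S_def)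
    ultimately have "\<forall>i\<in>V - B. c i = 0" using K(2) by (simp add: cuts_out_def)
    then have "(\<Sum>i\<in>V - B. norm (c i)) = 0" by simp
    then show False using c by (simp add: S_def)
  qed
  have "\<exists>\<mu>>0. \<forall>c\<in>S. \<mu> \<le> f c"
  proof (cases "S = {}")
    case False
    obtain c where "c \<in> S" "\<forall>c'\<in>S. f c \<le> f c'" using continuous_attains_inf[OF S False cont] by blast
    then show ?thesis using pos by blast
  qed (auto intro: exI[of _ 1])
  then obtain \<mu> where \<mu>: "\<mu> > 0" "\<forall>c\<in>S. \<mu> \<le> f c" by blast
  \<comment> \<open>The bound 1 keeps \<open>t\<close> inside the box of \<open>S\<close>; the
    summand 1 in the denominator makes the total distance strictly less than \<open>\<mu>\<close>,
    also for empty \<open>B\<close>.\<close>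
  define \<epsilon> where "\<epsilon> = min 1 (\<mu> / (real (card B) + 1))"
  have "\<epsilon> > 0" using \<mu>(1) by (simp add: \<epsilon>_def)
  moreover have "cuts_out (V - B) K L (fibre X B t)" if t: "\<forall>j\<in>B. norm (t j - t0 j) < \<epsilon>" for t
    unfolding cuts_out_def
  proof (intro conjI ballI impI lin)
    fix c i assume c: "c \<in> fibre X B t" and z: "\<forall>k\<in>K. L c k = 0" and i: "i \<in> V - B"
    show "c i = 0"
    proof (rule ccontr)
      assume "c i \<noteq> 0"
      define N where "N = (\<Sum>i\<in>V - B. norm (c i))"
      have le: "norm (c j) \<le> N" if "j \<in> V - B" for j
        unfolding N_def by (rule member_le_sum) (use that finV' in auto)
      have "N > 0" using le[OF i] \<open>c i \<noteq> 0\<close> by (smt (verit) zero_less_norm_iff)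
      define c1 where "c1 = dilate (complex_of_real (1 / N)) c"
      have c1: "c1 \<in> fibre X B t" using cone[of t] c unfolding conic_def c1_def by blast
      have n1: "norm (c1 j) = norm (c j) / N" for j
        using \<open>N > 0\<close> by (simp add: c1_def dilate_def norm_divide norm_mult)
      \<comment> \<open>The unit vector \<open>c1\<close> placed over \<open>t\<close>, with value 0
        at the indices outside \<open>V\<close> so that it lies in the box.\<close>
      define c2 where "c2 j = (if j \<in> V then override_on c1 t B j else 0)" for j
      have c2V: "c2 j = c1 j" if "j \<in> V - B" for j using that by (simp add: c2_def override_on_def)
      have c2B: "c2 j = t j" if "j \<in> B" for j using that B by (auto simp: c2_def override_on_def)
      have "c2 \<in> X"
        by (rule aclosed_cong[OF X, of "override_on c1 t B"]) (use c1 in \<open>auto simp: c2_def\<close>)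
      moreover have "L c2 k = 0" if k: "k \<in> K" for k
      proof -
        have "L c2 k = L c1 k" by (rule poly_fun_cong[OF linform_poly_fun[OF lin[OF k]]]) (rule c2V)
        also have "\<dots> = 0" using lin[OF k] z k by (simp add: linform_def homog_def c1_def)
        finally show ?thesis .
      qed
      moreover have "(\<Sum>i\<in>V - B. norm (c2 i)) = 1"
      proof -
        have "(\<Sum>i\<in>V - B. norm (c2 i)) = (\<Sum>i\<in>V - B. norm (c i) / N)"
          by (intro sum.cong) (simp_all add: c2V n1)
        also have "\<dots> = 1" using \<open>N > 0\<close> by (simp add: N_def flip: sum_divide_distrib)
        finally show ?thesis .
      qed
      moreover have "c2 j \<in> cball (if j \<in> B then t0 j else 0) (if j \<in> V then 1 else 0)" for j
      proof (cases "j \<in> B")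
        case True
        then have "norm (t j - t0 j) < 1" using t by (auto simp: \<epsilon>_def)
        then show ?thesis using True B c2B[OF True] by (auto simp: dist_norm norm_minus_commute)
      next
        case False
        then show ?thesis using le[of j] \<open>N > 0\<close> c2V[of j] n1[of j] by (simp add: c2_def)
      qed
      ultimately have "c2 \<in> S" unfolding S_def by simp
      then have "\<mu> \<le> f c2" using \<mu>(2) by blast
      also have "f c2 = (\<Sum>j\<in>B. norm (t j - t0 j))" unfolding f_def by (intro sum.cong) (simp_all add: c2B)
      also have "\<dots> \<le> (\<Sum>j\<in>B. \<epsilon>)" by (intro sum_mono) (use t in auto)
      also have "\<dots> = real (card B) * \<epsilon>" by simp
      also have "\<dots> \<le> real (card B) * (\<mu> / (real (card B) + 1))"
        by (intro mult_left_mono) (simp_all add: \<epsilon>_def)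
      also have "\<dots> < \<mu>" using \<mu>(1) by (simp add: field_simps)
      finally show False by simp
    qed
  qed
  ultimately show ?thesis by blast
qed

text \<open>On the line through \<open>t0\<close> and a point where \<open>h\<close> is nonzero,
  \<open>h\<close> has finitely many roots, and arbitrarily small parameters avoid them.\<close>

lemma poly_fun_nonzero_nearby:
  assumes h: "h \<in> poly_fun I" "h w \<noteq> 0" and "finite B" "\<epsilon> > 0"
  shows "\<exists>t. h t \<noteq> 0 \<and> (\<forall>j\<in>B. norm (t j - t0 j) < \<epsilon>)"
proof -
  obtain P where P: "\<And>l. h (\<lambda>i. t0 i + l * (w i - t0 i)) = poly P l" using poly_fun_line[OF h(1)] by blast
  have "poly P 1 \<noteq> 0" using P[of 1] h(2) by simp
  then have "P \<noteq> 0" by auto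
  define \<delta> where "\<delta> = \<epsilon> / (1 + (\<Sum>j\<in>B. norm (w j - t0 j)))"
  have pos: "1 + (\<Sum>j\<in>B. norm (w j - t0 j)) > 0" by (smt (verit) norm_ge_zero sum_nonneg)
  then have "\<delta> > 0" using assms(4) by (simp add: \<delta>_def)
  then have "infinite (complex_of_real ` {0<..<\<delta>})"
    using finite_image_iff[of complex_of_real "{0<..<\<delta>}"] by (simp add: inj_on_def)
  then obtain l where l: "l \<in> complex_of_real ` {0<..<\<delta>}" "poly P l \<noteq> 0"
    using poly_roots_finite[OF \<open>P \<noteq> 0\<close>] finite_subset[of "complex_of_real ` {0<..<\<delta>}" "{x. poly P x = 0}"] by blast
  then have nl: "norm l < \<delta>" by auto
  have "norm (l * (w j - t0 j)) < \<epsilon>" if j: "j \<in> B" for j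
  proof -
    have "norm (w j - t0 j) \<le> (\<Sum>j\<in>B. norm (w j - t0 j))"
      by (rule member_le_sum[where f="\<lambda>j. norm (w j - t0 j)"]) (use j assms(3) in auto)
    then have "norm (l * (w j - t0 j)) \<le> norm l * (1 + (\<Sum>j\<in>B. norm (w j - t0 j)))"
      unfolding norm_mult by (intro mult_left_mono) auto
    also have "\<dots> < \<delta> * (1 + (\<Sum>j\<in>B. norm (w j - t0 j)))" by (rule mult_strict_right_mono[OF nl pos])
    also have "\<dots> = \<epsilon>" using pos by (simp add: \<delta>_def)
    finally show ?thesis .
  qed
  then show ?thesis using P[of l] l(2) by (intro exI[of _ "\<lambda>i. t0 i + l * (w i - t0 i)"]) simp
qed

text \<open>Linear forms that cut out the origin in the special fibre do so in a generic fibre close to it, and their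
  number bounds the dimension of that fibre.\<close>

lemma indep_every_fibre:
  assumes V: "finite V" and X: "aclosed V X" and cone: "\<And>t. conic (fibre X B t)"
    and I: "I \<subseteq> V" "indep I X" and B: "B \<subseteq> I"
  obtains I' where "I' \<subseteq> V - B" "indep I' (fibre X B t0)" "card I \<le> card I' + card B"
proof -
  have finV': "finite (V - B)" using V by simp
  obtain h where h: "h \<in> poly_fun I" "\<exists>x. h x \<noteq> 0" "\<forall>t. h t \<noteq> 0 \<longrightarrow> indep (I - B) (fibre X B t)"
    by (rule indep_fibre_generic[OF V X I B])
  obtain K L I' where K: "K \<subseteq> V - B" "cuts_out (V - B) K L (fibre X B t0)"
    and I': "I' \<subseteq> V - B" "indep I' (fibre X B t0)" "card K \<le> card I'"
    by (rule cone_parameters[OF finV' aclosed_fibre[OF X] cone])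
  have BV: "B \<subseteq> V" using B I(1) by simp
  have finI: "finite I" using I(1) V by (rule finite_subset)
  have finK: "finite K" using K(1) finV' by (rule finite_subset)
  obtain \<epsilon> where \<epsilon>: "\<epsilon> > 0"
    "\<forall>t. (\<forall>j\<in>B. norm (t j - t0 j) < \<epsilon>) \<longrightarrow> cuts_out (V - B) K L (fibre X B t)"
    using cuts_out_nearby[OF V BV X cone finK K(2)] by blast
  obtain w where w: "h w \<noteq> 0" using h(2) by blast
  have finB: "finite B" using B finI by (rule finite_subset)
  obtain t where t: "h t \<noteq> 0" "\<forall>j\<in>B. norm (t j - t0 j) < \<epsilon>"
    using poly_fun_nonzero_nearby[OF h(1) w finB \<epsilon>(1)] by blast
  have cut: "cuts_out (V - B) K L (fibre X B t)" using \<epsilon>(2) t(2) by blast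
  have lin: "linform (V - B) (\<lambda>x. L x k)" if "k \<in> K" for k using cut that by (simp add: cuts_out_def)
  have "card (I - B) \<le> card K"
  proof (rule indep_card_le_forms[where g="\<lambda>k x. L x k" and e="\<lambda>_. 1", OF finV' finK aclosed_fibre[OF X] cone])
    show "\<forall>y\<in>fibre X B t. (\<forall>k\<in>K. L y k = 0) \<longrightarrow> (\<forall>i\<in>V - B. y i = 0)"
      using cut by (simp add: cuts_out_def)
    show "indep (I - B) (fibre X B t)" using h(3) t(1) by blast
  qed (use I lin linform_poly_fun[OF lin] in \<open>auto simp: linform_def\<close>)
  moreover have "card I = card (I - B) + card B"
    using card_Diff_subset[OF finB B] card_mono[OF finI B] by simp
  ultimately show ?thesis using I' by (intro that[of I']) auto
qed

text \<open>Only finitely many sets \<open>I\<close> occur, so \<open>J\<close> is still independent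
  on the base points that share one of them. A relation on \<open>X\<close> then vanishes
  identically first along these fibres and afterwards along the base.\<close>

lemma indep_total:
  assumes F: "finite \<F>" "\<And>I. I \<in> \<F> \<Longrightarrow> I \<inter> B = {}" and J: "J \<subseteq> B" "indep J \<Theta>"
    and fib: "\<And>t. t \<in> \<Theta> \<Longrightarrow> \<exists>I\<in>\<F>. indep I (fibre X B t)"
  obtains I where "I \<in> \<F>" "indep (J \<union> I) X"
proof -
  have "indep J (\<Union>I\<in>\<F>. {t \<in> \<Theta>. indep I (fibre X B t)})"
    by (rule dominant_mono[OF J(2) order_refl]) (use fib in auto)
  from dominant_UN[OF F(1) this] obtain I where I: "I \<in> \<F>" "indep J {t \<in> \<Theta>. indep I (fibre X B t)}"
    by (elim bexE)
  have "indep (J \<union> I) X"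
    unfolding dominant_def
  proof (intro ballI impI allI)
    fix p x assume p: "p \<in> poly_fun (J \<union> I)" "\<forall>z\<in>X. p z = 0"
    have JB: "(J \<union> I) \<inter> B = J" "(J \<union> I) - B = I" using J(1) F(2)[OF I(1)] by auto
    have zero: "p (override_on x t B) = 0" if "t \<in> \<Theta>" "indep I (fibre X B t)" for t
      by (rule dominantD[OF that(2), of "\<lambda>c. p (override_on c t B)"])
        (use poly_fun_override[OF p(1), of t B] p(2) JB in auto)
    \<comment> \<open>With the fibre coordinates fixed to those of \<open>x\<close>, the relation
      vanishes at all base points \<open>t\<close>; the choice \<open>t = x\<close> recovers
      \<open>p x\<close>.\<close>
    have "p (override_on x x B) = 0"
      by (rule dominantD[OF I(2), of "\<lambda>t. p (override_on x t B)"])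
        (use poly_fun_override'[OF p(1), of x B] zero JB in auto)
    then show "p x = 0" by (simp add: override_on_def)
  qed
  then show ?thesis using I(1) by (intro that[of I])
qed

section \<open>Kernels of a matrix and of its transpose\<close>

text \<open>A maximal set of linearly independent rows: by maximality every other row is a
  combination of them.\<close>

lemma row_basis:
  fixes m :: "'a \<Rightarrow> 'b \<Rightarrow> complex"
  assumes "finite R"
  obtains P where "P \<subseteq> R" "\<And>a. (\<forall>k\<in>C. (\<Sum>r\<in>P. a r * m r k) = 0) \<Longrightarrow> \<forall>r\<in>P. a r = 0"
    "\<forall>s\<in>R - P. \<exists>b. \<forall>k\<in>C. m s k = (\<Sum>r\<in>P. b r * m r k)"
proof -
  define ind where "ind P \<longleftrightarrow> (\<forall>a. (\<forall>k\<in>C. (\<Sum>r\<in>P. a r * m r k) = 0) \<longrightarrow> (\<forall>r\<in>P. a r = 0))" for P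
  define F where "F = {P. P \<subseteq> R \<and> ind P}"
  have "finite F" "{} \<in> F" using assms by (auto simp: F_def ind_def)
  then obtain P where P: "P \<in> F" "\<forall>P'\<in>F. P \<subseteq> P' \<longrightarrow> P = P'"
    using finite_has_maximal[of F] by auto
  have PR: "P \<subseteq> R" and indP: "ind P" using P(1) by (auto simp: F_def)
  have finP: "finite P" using PR assms by (rule finite_subset)
  have "\<exists>b. \<forall>k\<in>C. m s k = (\<Sum>r\<in>P. b r * m r k)" if s: "s \<in> R - P" for s
  proof -
    have "insert s P \<notin> F" using P(2) s by auto
    then have "\<not> ind (insert s P)" using PR s by (auto simp: F_def)
    then obtain a where a: "\<forall>k\<in>C. (\<Sum>r\<in>insert s P. a r * m r k) = 0" "\<exists>r\<in>insert s P. a r \<noteq> 0"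
      unfolding ind_def by auto
    have sum: "a s * m s k + (\<Sum>r\<in>P. a r * m r k) = 0" if "k \<in> C" for k
      using a(1) that s finP by simp
    have "a s \<noteq> 0"
    proof
      assume "a s = 0"
      then have "\<forall>k\<in>C. (\<Sum>r\<in>P. a r * m r k) = 0" using sum by simp
      then have "\<forall>r\<in>P. a r = 0" using indP unfolding ind_def by blast
      then show False using a(2) \<open>a s = 0\<close> by auto
    qed
    have "m s k = (\<Sum>r\<in>P. (- a r / a s) * m r k)" if "k \<in> C" for k
    proof -
      have "a s * m s k = - (\<Sum>r\<in>P. a r * m r k)" using sum[OF that] by (simp add: eq_neg_iff_add_eq_0)
      then have "m s k = - (\<Sum>r\<in>P. a r * m r k) / a s" using \<open>a s \<noteq> 0\<close> by (simp add: field_simps)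
      then show ?thesis by (simp add: sum_divide_distrib sum_negf)
    qed
    then show ?thesis by (intro exI[of _ "\<lambda>r. - a r / a s"]) simp
  qed
  moreover have "\<forall>r\<in>P. a r = 0" if "\<forall>k\<in>C. (\<Sum>r\<in>P. a r * m r k) = 0" for a
    using indP that unfolding ind_def by blast
  ultimately show ?thesis using PR by (intro that[of P]) auto
qed

text \<open>A coordinate that is algebraic over \<open>J\<close> is a root of a polynomial whose
  leading coefficient depends on \<open>J\<close> only; \<open>a\<close> is the product of these
  coefficients.\<close>

lemma algebraic_coordinates_finite:
  assumes "finite D" "J \<inter> D = {}" "indep J Z" "\<And>j. j \<in> D \<Longrightarrow> \<not> indep (insert j J) Z"
  shows "\<exists>a\<in>poly_fun J. (\<exists>x. a x \<noteq> 0) \<and> (\<forall>x. a x \<noteq> 0 \<longrightarrow>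
    (\<forall>j\<in>D. finite {z j | z. z \<in> Z \<and> (\<forall>i\<in>J. z i = x i)}))"
proof -
  have one: "\<exists>a. a \<in> poly_fun J \<and> (\<exists>x. a x \<noteq> 0) \<and> (\<forall>x. a x \<noteq> 0 \<longrightarrow>
      finite {z j | z. z \<in> Z \<and> (\<forall>i\<in>J. z i = x i)})" if j: "j \<in> D" for j
  proof -
    obtain a n r where a: "a \<in> poly_fun J" "\<exists>z\<in>Z. a z \<noteq> 0" "n > 0" "r \<in> updeg J j n"
      "\<forall>z\<in>Z. a z * z j ^ n + r z = 0"
      by (rule not_indep_insert[OF assms(3) assms(4)[OF j]])
    have jJ: "j \<notin> J" using j assms(2) by auto
    have "finite {z j | z. z \<in> Z \<and> (\<forall>i\<in>J. z i = x i)}" if x: "a x \<noteq> 0" for x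
    proof -
      obtain R where R: "\<forall>k\<ge>n. coeff R k = 0" "\<forall>\<xi>. r (x(j := \<xi>)) = poly R \<xi>"
        using updeg_poly[OF a(4) jJ, of x] by (elim exE conjE)
      have "coeff (monom (a x) n + R) n \<noteq> 0" using R(1) x by simp
      then have "monom (a x) n + R \<noteq> 0" by (metis coeff_0)
      then have fin: "finite {\<xi>. poly (monom (a x) n + R) \<xi> = 0}" by (rule poly_roots_finite)
      show ?thesis
      proof (rule finite_subset[OF _ fin], rule subsetI)
        fix \<xi> assume "\<xi> \<in> {z j | z. z \<in> Z \<and> (\<forall>i\<in>J. z i = x i)}"
        then obtain z where z: "z \<in> Z" "\<forall>i\<in>J. z i = x i" "\<xi> = z j" by blast
        have "a z = a x" by (rule poly_fun_cong[OF a(1)]) (use z in simp)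
        moreover have "r z = r (x(j := z j))" by (rule poly_fun_cong[OF updeg_poly_fun[OF a(4)]]) (use z in auto)
        ultimately have "poly (monom (a x) n + R) \<xi> = 0"
          using a(5) z(1,3) R(2) by (simp only: poly_add poly_monom) metis
        then show "\<xi> \<in> {\<xi>. poly (monom (a x) n + R) \<xi> = 0}" by (rule CollectI)
      qed
    qed
    then show ?thesis using a(1,2) by (intro exI[of _ a]) auto
  qed
  define a where "a j = (SOME a. a \<in> poly_fun J \<and> (\<exists>x. a x \<noteq> 0) \<and> (\<forall>x. a x \<noteq> 0 \<longrightarrow>
      finite {z j | z. z \<in> Z \<and> (\<forall>i\<in>J. z i = x i)}))" for j
  have a: "a j \<in> poly_fun J \<and> (\<exists>x. a j x \<noteq> 0) \<and> (\<forall>x. a j x \<noteq> 0 \<longrightarrow>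
      finite {z j | z. z \<in> Z \<and> (\<forall>i\<in>J. z i = x i)})" if "j \<in> D" for j
    unfolding a_def by (rule someI_ex[OF one[OF that]])
  have "(\<lambda>x. \<Prod>j\<in>D. a j x) \<in> poly_fun J" by (intro poly_fun_prod) (use a in blast)
  moreover have "\<exists>x. (\<Prod>j\<in>D. a j x) \<noteq> 0"
    by (rule poly_fun_prod_nonzero[OF assms(1), of a J]) (use a in blast)+
  ultimately show ?thesis
    using a assms(1) by (intro bexI[where x="\<lambda>x. \<Prod>j\<in>D. a j x" and A="poly_fun J"]) auto
qed

text \<open>Fibred over \<open>V0\<close>, the two varieties consist of the kernels of a matrix and of its transpose.
  As these kernels have codimension the rank of the matrix, both varieties have the same codimension.
  This is the invariance of the geometric rank under exchanging the last two factors.\<close>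

lemma exchange_dimension:
  fixes M :: "'i \<Rightarrow> 'i \<Rightarrow> ('i \<Rightarrow> complex) \<Rightarrow> complex"
  assumes fin: "finite V0" "finite R" "finite C" and disj: "V0 \<inter> R = {}" "V0 \<inter> C = {}"
    and M: "\<And>r k. r \<in> R \<Longrightarrow> k \<in> C \<Longrightarrow> M r k \<in> poly_fun V0"
    and I1: "I1 \<subseteq> V0 \<union> C" "indep I1 {c. \<forall>r\<in>R. (\<Sum>k\<in>C. M r k c * c k) = 0}"
  obtains I2 where "I2 \<subseteq> V0 \<union> R" "indep I2 {c. \<forall>k\<in>C. (\<Sum>r\<in>R. M r k c * c r) = 0}"
    "card I1 + card R \<le> card I2 + card C"
proof -
  define X1 where "X1 = {c. \<forall>r\<in>R. (\<Sum>k\<in>C. M r k c * c k) = 0}"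
  define X2 where "X2 = {c. \<forall>k\<in>C. (\<Sum>r\<in>R. M r k c * c r) = 0}"
  let ?V = "V0 \<union> C"
  have finV: "finite ?V" using fin by simp
  have "aclosed ?V {c. \<forall>q\<in>(\<lambda>r c. \<Sum>k\<in>C. M r k c * c k) ` R. q c = 0}"
    by (rule aclosedI) (auto intro!: poly_fun_sum poly_fun_mult poly_fun_coord poly_fun_mono[OF M])
  then have X1: "aclosed ?V X1" by (simp add: X1_def)
  obtain Z where Z: "Z \<subseteq> X1" "aclosed ?V Z" "irr ?V Z" "indep I1 Z"
    by (rule indep_irr_subset[OF finV X1 I1(1) I1(2)[folded X1_def]])
  have "Z \<noteq> {}" using Z(3) by (simp add: irr_def)
  \<comment> \<open>Coordinates adapted to the projection to \<open>V0\<close>: \<open>J\<close> for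
    the image and then \<open>J2\<close> for the kernels, so that \<open>card J + card J2\<close> is
    at least \<open>card I1\<close>.\<close>
  obtain J where J: "J \<subseteq> V0" "indep J Z" "\<forall>j\<in>V0 - J. \<not> indep (insert j J) Z"
    by (rule indep_extend[OF fin(1) empty_subsetI indep_empty[OF \<open>Z \<noteq> {}\<close>]])
  have finI1: "finite I1" using I1(1) finV by (rule finite_subset)
  have JV: "J \<subseteq> ?V" using J(1) by auto
  obtain I where I: "J \<subseteq> I" "I \<subseteq> ?V" "indep I Z" "card I1 \<le> card I"
    using irr_indep_extend[OF finV Z(3) JV J(2) grows_indep[OF finI1 Z(4) I1(1)]] by metis
  define J2 where "J2 = I \<inter> C"
  have IV0: "I \<inter> V0 = J"
  proof
    show "I \<inter> V0 \<subseteq> J"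
    proof
      fix j assume j: "j \<in> I \<inter> V0"
      show "j \<in> J"
      proof (rule ccontr)
        assume "j \<notin> J"
        moreover have "indep (insert j J) Z" by (rule dominant_mono[OF I(3)]) (use I(1) j in auto)
        ultimately show False using J(3) j by auto
      qed
    qed
  qed (use I(1) J(1) in auto)
  have IJ: "I = J \<union> J2" "J \<inter> J2 = {}" using I(2) IV0 disj J(1) by (auto simp: J2_def)
  have J2C: "J2 \<subseteq> C" by (auto simp: J2_def)
  obtain h where h: "h \<in> poly_fun I" "\<exists>x. h x \<noteq> 0" "\<forall>x. h x \<noteq> 0 \<longrightarrow> (\<exists>z\<in>Z. \<forall>i\<in>I. z i = x i)"
    by (rule irr_generic_point[OF finV Z(2,3) I(2,3)])
  have "\<exists>a\<in>poly_fun J. (\<exists>x. a x \<noteq> 0) \<and> (\<forall>x. a x \<noteq> 0 \<longrightarrow>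
      (\<forall>j\<in>V0 - J. finite {z j | z. z \<in> Z \<and> (\<forall>i\<in>J. z i = x i)}))"
    by (rule algebraic_coordinates_finite) (use fin J in auto)
  then obtain a where a: "a \<in> poly_fun J" "\<exists>x. a x \<noteq> 0"
    and afin: "\<forall>x. a x \<noteq> 0 \<longrightarrow> (\<forall>j\<in>V0 - J. finite {z j | z. z \<in> Z \<and> (\<forall>i\<in>J. z i = x i)})"
    by (elim bexE conjE)
  define dep where "dep P s c b \<longleftrightarrow> (\<forall>k\<in>C. M s k c = (\<Sum>r\<in>P. b r * M r k c))" for P s c and b :: "'i \<Rightarrow> complex"
  \<comment> \<open>Kernels of dimension at least \<open>card J2\<close> force rank at most
    \<open>card C - card J2\<close>. Over \<open>\<Theta>\<close> the rows of such a set
    \<open>P\<close> span all rows.\<close>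
  define \<P> where "\<P> = {P. P \<subseteq> R \<and> card P + card J2 \<le> card C}"
  define \<Theta> where "\<Theta> = (\<Union>P\<in>\<P>. {c. \<forall>s\<in>R - P. \<exists>b. dep P s c b})"
  have "indep J \<Theta>"
  proof (rule ccontr)
    assume "\<not> indep J \<Theta>"
    then obtain p where p: "p \<in> poly_fun J" "\<forall>z\<in>\<Theta>. p z = 0" "\<exists>x. p x \<noteq> 0" by (rule not_dominantE)
    have ap: "(\<lambda>x. a x * p x) \<in> poly_fun I" using poly_fun_mono[OF a(1) I(1)] poly_fun_mono[OF p(1) I(1)] by (rule poly_fun_mult)
    have "\<exists>x. a x * p x * h x \<noteq> 0"
    proof (rule ccontr)
      assume "\<not> ?thesis"
      then have "(a x * p x) * h x = 0" for x by simp
      from poly_fun_domain[OF ap h(1) this] have "a x * p x = 0" for x using h(2) by auto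
      from poly_fun_domain[OF a(1) p(1) this] show False using a(2) p(3) by auto
    qed
    then obtain x0 where x0: "a x0 \<noteq> 0" "p x0 \<noteq> 0" "h x0 \<noteq> 0" by auto
    define N where "N = {z \<in> Z. \<forall>i\<in>J. z i = x0 i}"
    have indN: "indep J2 N"
      unfolding dominant_def
    proof (intro ballI impI)
      fix q assume q: "q \<in> poly_fun J2" "\<forall>z\<in>N. q z = 0"
      have "(\<lambda>u. h (override_on x0 u J2)) \<in> poly_fun J2"
        using poly_fun_override'[OF h(1), of x0 J2] by (simp add: IJ Int_absorb1)
      moreover have "q u * h (override_on x0 u J2) = 0" for u
      proof (cases "h (override_on x0 u J2) = 0")
        case False
        then obtain z where z: "z \<in> Z" "\<forall>i\<in>I. z i = override_on x0 u J2 i" using h(3) by blast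
        have "z \<in> N" using z IJ by (auto simp: N_def override_on_def)
        moreover have "q u = q z" by (rule poly_fun_cong[OF q(1)]) (use z(2) IJ in \<open>simp add: override_on_def\<close>)
        ultimately show ?thesis using q(2) by simp
      qed simp
      ultimately have "(\<forall>u. q u = 0) \<or> (\<forall>u. h (override_on x0 u J2) = 0)" by (rule poly_fun_domain[OF q(1)])
      moreover have "override_on x0 x0 J2 = x0" by (simp add: override_on_def)
      ultimately show "\<forall>x. q x = 0" using x0(3) by metis
    qed
    \<comment> \<open>Since \<open>a x0\<close> is nonzero, the points of \<open>Z\<close> over
      \<open>x0\<close> have only finitely many projections to \<open>V0\<close>; over one of these
      \<open>J2\<close> is still independent.\<close>
    define \<B> where "\<B> = (\<lambda>z. restrict z V0) ` N"
    have "\<B> \<subseteq> (\<Pi>\<^sub>E j\<in>V0. if j \<in> J then {x0 j} else {z j | z. z \<in> Z \<and> (\<forall>i\<in>J. z i = x0 i)})"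
      unfolding \<B>_def N_def by auto
    moreover have "finite (\<Pi>\<^sub>E j\<in>V0. if j \<in> J then {x0 j} else {z j | z. z \<in> Z \<and> (\<forall>i\<in>J. z i = x0 i)})"
      by (rule finite_PiE[OF fin(1)]) (use afin x0(1) in auto)
    ultimately have "finite \<B>" by (rule finite_subset)
    moreover have "indep J2 (\<Union>b\<in>\<B>. {z \<in> N. restrict z V0 = b})"
      by (rule dominant_mono[OF indN order_refl]) (auto simp: \<B>_def)
    ultimately have "\<exists>b\<in>\<B>. indep J2 {z \<in> N. restrict z V0 = b}" by (rule dominant_UN)
    then obtain z0 where z0: "z0 \<in> N" "indep J2 {z \<in> N. restrict z V0 = restrict z0 V0}"
      by (auto simp: \<B>_def)
    define Nb where "Nb = {z \<in> N. restrict z V0 = restrict z0 V0}"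
    define m where "m r k = M r k z0" for r k
    have mz: "(\<Sum>k\<in>C. m r k * z k) = 0" if "z \<in> Nb" "r \<in> R" for z r
    proof -
      have "z i = z0 i" if "i \<in> V0" for i
        using \<open>z \<in> Nb\<close> that unfolding Nb_def by (metis (mono_tags, lifting) mem_Collect_eq restrict_apply')
      then have "m r k = M r k z" if "k \<in> C" for k
        unfolding m_def by (intro poly_fun_cong[OF M[OF \<open>r \<in> R\<close> that]]) simp
      moreover have "z \<in> X1" using that Z(1) by (auto simp: Nb_def N_def)
      ultimately show ?thesis using \<open>r \<in> R\<close> by (simp add: X1_def)
    qed
    obtain P where P: "P \<subseteq> R" "\<And>a. (\<forall>k\<in>C. (\<Sum>r\<in>P. a r * m r k) = 0) \<Longrightarrow> \<forall>r\<in>P. a r = 0"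
      "\<forall>s\<in>R - P. \<exists>b. \<forall>k\<in>C. m s k = (\<Sum>r\<in>P. b r * m r k)"
      using row_basis[OF fin(2), of C m] by blast
    have finP: "finite P" using P(1) fin(2) by (rule finite_subset)
    \<comment> \<open>Otherwise some nontrivial combination of the independent rows is supported in
      \<open>J2\<close>. It annihilates \<open>Nb\<close>, hence is a linear relation among the
      coordinates in \<open>J2\<close>.\<close>
    have "card P \<le> card (C - J2)"
    proof (rule ccontr)
      assume "\<not> ?thesis"
      then obtain w where w: "\<exists>r\<in>P. w r \<noteq> 0" "\<forall>k\<in>C - J2. (\<Sum>r\<in>P. w r * m r k) = 0"
        using more_unknowns[of "C - J2" P m] fin(3) finP by auto
      define v where "v k = (\<Sum>r\<in>P. w r * m r k)" for k
      have "(\<Sum>k\<in>J2. v k * z k) = 0" if z: "z \<in> Nb" for z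
      proof -
        have "(\<Sum>k\<in>J2. v k * z k) = (\<Sum>k\<in>C. v k * z k)"
          by (rule sum.mono_neutral_left[OF fin(3) J2C]) (use w(2) in \<open>auto simp: v_def\<close>)
        also have "\<dots> = (\<Sum>k\<in>C. \<Sum>r\<in>P. w r * (m r k * z k))"
          by (simp add: v_def sum_distrib_right mult.assoc)
        also have "\<dots> = (\<Sum>r\<in>P. w r * (\<Sum>k\<in>C. m r k * z k))"
          by (subst sum.swap) (simp add: sum_distrib_left)
        also have "\<dots> = 0" using mz[OF z] P(1) by (intro sum.neutral) auto
        finally show ?thesis .
      qed
      moreover have "(\<lambda>z. \<Sum>k\<in>J2. v k * z k) \<in> poly_fun J2" by (intro poly_fun_sum poly_fun_mult poly_fun_const poly_fun_coord)
      ultimately have lin: "(\<Sum>k\<in>J2. v k * z k) = 0" for z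
        using dominantD[OF z0(2)[folded Nb_def], of "\<lambda>z. \<Sum>k\<in>J2. v k * z k"] by blast
      have "v k = 0" if k: "k \<in> J2" for k
      proof -
        have "finite J2" using J2C fin(3) by (rule finite_subset)
        then have "(\<Sum>l\<in>J2. v l * (if l = k then 1 else 0)) = v k"
          using k by (simp add: if_distrib[of "\<lambda>x. _ * x"] sum.delta cong: if_cong)
        then show ?thesis using lin[of "\<lambda>l. if l = k then 1 else 0"] by simp
      qed
      then have "\<forall>k\<in>C. (\<Sum>r\<in>P. w r * m r k) = 0" using w(2) by (auto simp: v_def)
      then show False using P(2)[of w] w(1) by blast
    qed
    moreover have "card (C - J2) + card J2 = card C"
      using card_Diff_subset[OF finite_subset[OF J2C fin(3)] J2C] card_mono[OF fin(3) J2C] by simp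
    ultimately have "P \<in> \<P>" using P(1) by (simp add: \<P>_def)
    moreover have "\<forall>s\<in>R - P. \<exists>b. dep P s z0 b" using P(3) by (simp add: dep_def m_def)
    ultimately have "z0 \<in> \<Theta>" unfolding \<Theta>_def by blast
    then have "p z0 = 0" using p(2) by blast
    moreover have "p z0 = p x0" by (rule poly_fun_cong[OF p(1)]) (use z0(1) in \<open>simp add: N_def\<close>)
    ultimately show False using x0(2) by simp
  qed
  have fib: "\<exists>K\<in>(\<lambda>P. R - P) ` \<P>. indep K (fibre X2 V0 t)" if t: "t \<in> \<Theta>" for t
  proof -
    obtain P where P: "P \<in> \<P>" "\<forall>s\<in>R - P. \<exists>b. dep P s t b"
      using t unfolding \<Theta>_def by (elim UN_E CollectE)
    from bchoice[OF P(2)] obtain b where b: "\<forall>s\<in>R - P. dep P s t (b s)" by (elim exE)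
    have PR: "P \<subseteq> R" using P(1) by (simp add: \<P>_def)
    have finP: "finite P" using PR fin(2) by (rule finite_subset)
    have "indep (R - P) (fibre X2 V0 t)"
      unfolding dominant_def
    proof (intro ballI impI allI)
      fix q x assume q: "q \<in> poly_fun (R - P)" "\<forall>z\<in>fibre X2 V0 t. q z = 0"
      \<comment> \<open>A vector in the kernel of the transpose with arbitrary entries outside
        \<open>P\<close>: the entries in \<open>P\<close> compensate for the dependent rows.\<close>
      define c where "c r = (if r \<in> P then - (\<Sum>s\<in>R - P. x s * b s r) else x r)" for r
      have Mt: "M r k (override_on c t V0) = M r k t" if "r \<in> R" "k \<in> C" for r k
        by (rule poly_fun_cong[OF M[OF that]]) simp
      have cR: "override_on c t V0 r = c r" if "r \<in> R" for r using that disj by (auto simp: override_on_def)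
      have "(\<Sum>r\<in>R. M r k t * c r) = 0" if k: "k \<in> C" for k
      proof -
        have "(\<Sum>r\<in>P. M r k t * c r) = - (\<Sum>r\<in>P. \<Sum>s\<in>R - P. x s * (b s r * M r k t))"
          by (simp add: c_def sum_distrib_left sum_negf ac_simps)
        also have "\<dots> = - (\<Sum>s\<in>R - P. x s * (\<Sum>r\<in>P. b s r * M r k t))"
          by (subst sum.swap) (simp add: sum_distrib_left)
        also have "\<dots> = - (\<Sum>s\<in>R - P. M s k t * c s)"
          using b k by (simp add: dep_def c_def mult.commute)
        finally show ?thesis
          using sum.subset_diff[OF PR fin(2), of "\<lambda>r. M r k t * c r"] by simp
      qed
      then have "override_on c t V0 \<in> X2" by (simp add: X2_def Mt cR)
      then have "q c = 0" using q(2) by simp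
      moreover have "q x = q c" by (rule poly_fun_cong[OF q(1)]) (simp add: c_def)
      ultimately show "q x = 0" by simp
    qed
    then show ?thesis using P(1) by blast
  qed
  have "finite \<P>" using fin(2) by (simp add: \<P>_def)
  then have finF: "finite ((\<lambda>P. R - P) ` \<P>)" by simp
  have disjF: "K \<inter> V0 = {}" if "K \<in> (\<lambda>P. R - P) ` \<P>" for K using that disj by auto
  obtain K where K: "K \<in> (\<lambda>P. R - P) ` \<P>" "indep (J \<union> K) X2"
    by (rule indep_total[OF finF disjF J(1) \<open>indep J \<Theta>\<close> fib])
  from K(1) obtain P where P: "P \<subseteq> R" "card P + card J2 \<le> card C" "K = R - P" by (auto simp: \<P>_def)
  have finJ: "finite J" using J(1) fin(1) by (rule finite_subset)
  have "card (J \<union> K) = card J + card (R - P)"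
    unfolding P(3) using finJ fin(2) J(1) disj by (intro card_Un_disjoint) auto
  moreover have "card I = card J + card J2"
    unfolding IJ(1) using finJ finite_subset[OF J2C fin(3)] IJ(2) by (intro card_Un_disjoint) auto
  moreover have "card R = card P + card (R - P)"
    using card_Diff_subset[OF finite_subset[OF P(1) fin(2)] P(1)] card_mono[OF fin(2) P(1)] by simp
  ultimately have "card I1 + card R \<le> card (J \<union> K) + card C" using I(4) P(2) by simp
  then show ?thesis using K(2) J(1) P(3) by (intro that[of "J \<union> K"]) (auto simp: X2_def)
qed

section \<open>Multilinear forms\<close>

text \<open>A tensor in coordinates: one point holds the coordinates of all arguments, and
  \<open>Bl j\<close> contains the indices for the \<open>j\<close>-th.\<close>

definition multilinear_form :: "(nat \<Rightarrow> 'i set) \<Rightarrow> nat set \<Rightarrow> (('i \<Rightarrow> complex) \<Rightarrow> complex) \<Rightarrow> bool" where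
  "multilinear_form Bl J F \<longleftrightarrow> (\<forall>c c'. (\<forall>i\<in>\<Union>(Bl ` J). c i = c' i) \<longrightarrow> F c = F c') \<and> (\<forall>j\<in>J. \<forall>c u v a.
    F (override_on c (\<lambda>i. u i + a * v i) (Bl j)) =
    F (override_on c u (Bl j)) + a * F (override_on c v (Bl j)))"

definition kernel_variety :: "(nat \<Rightarrow> 'i set) \<Rightarrow> (('i \<Rightarrow> complex) \<Rightarrow> complex) \<Rightarrow> nat \<Rightarrow> ('i \<Rightarrow> complex) set" where
  "kernel_variety Bl F k = {c. \<forall>u. F (override_on c u (Bl k)) = 0}"

text \<open>Dimension at least \<open>card W - r\<close>, witnessed by independent coordinates and
  written without subtraction.\<close>

definition codim_le :: "'i set \<Rightarrow> ('i \<Rightarrow> complex) set \<Rightarrow> nat \<Rightarrow> bool" where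
  "codim_le W X r \<longleftrightarrow> (\<exists>I\<subseteq>W. indep I X \<and> card W \<le> card I + r)"

lemma override_commute:
  "A \<inter> B = {} \<Longrightarrow> override_on (override_on c u A) v B = override_on (override_on c v B) u A"
  by (auto simp: override_on_def fun_eq_iff)

lemma override_self: "override_on c c A = c"
  by (simp add: override_on_def)

lemma multilinear_form_cong: "multilinear_form Bl J F \<Longrightarrow> (\<And>i. i \<in> \<Union>(Bl ` J) \<Longrightarrow> c i = c' i) \<Longrightarrow> F c = F c'"
  unfolding multilinear_form_def by meson

lemma multilinear_form_lin:
  "multilinear_form Bl J F \<Longrightarrow> j \<in> J \<Longrightarrow> F (override_on c (\<lambda>i. u i + a * v i) (Bl j)) =
    F (override_on c u (Bl j)) + a * F (override_on c v (Bl j))"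
  by (simp add: multilinear_form_def)

lemma multilinear_form_zero:
  assumes "multilinear_form Bl J F" "j \<in> J"
  shows "F (override_on c (\<lambda>_. 0) (Bl j)) = 0"
  using multilinear_form_lin[OF assms, of c "\<lambda>_. 0" 1 "\<lambda>_. 0"] by simp

lemma multilinear_form_dilate:
  assumes "multilinear_form Bl J F" "j \<in> J"
  shows "F (override_on c (dilate a v) (Bl j)) = a * F (override_on c v (Bl j))"
  using multilinear_form_lin[OF assms, of c "\<lambda>_. 0" a v] multilinear_form_zero[OF assms] by (simp add: dilate_def)

lemma multilinear_form_expand:
  assumes F: "multilinear_form Bl J F" "j \<in> J" and fin: "finite (Bl j)"
  shows "F (override_on c v (Bl j)) =
    (\<Sum>k\<in>Bl j. v k * F (override_on c (\<lambda>i. if i = k then 1 else 0) (Bl j)))"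
proof -
  have ext: "F (override_on c (\<lambda>i. if i \<in> S then v i else 0) (Bl j)) =
      (\<Sum>k\<in>S. v k * F (override_on c (\<lambda>i. if i = k then 1 else 0) (Bl j)))" if "finite S" for S
    using that
  proof (induction S rule: finite_induct)
    case empty
    then show ?case using multilinear_form_zero[OF F] by simp
  next
    case (insert k S)
    have "(\<lambda>i. if i \<in> insert k S then v i else 0) =
        (\<lambda>i. (if i \<in> S then v i else 0) + v k * (if i = k then 1 else 0))"
      using insert(2) by auto
    then show ?case using insert multilinear_form_lin[OF F, of c "\<lambda>i. if i \<in> S then v i else 0" "v k"] by simp
  qed
  have eq: "override_on c (\<lambda>i. if i \<in> Bl j then v i else 0) (Bl j) = override_on c v (Bl j)"
    by (auto simp: override_on_def)
  show ?thesis using ext[OF fin] unfolding eq .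
qed

section \<open>Kernel varieties of forms on disjoint finite blocks\<close>

context
  fixes Bl :: "nat \<Rightarrow> 'i set"
  assumes fin: "\<And>j. finite (Bl j)" and disj: "\<And>j k. j \<noteq> k \<Longrightarrow> Bl j \<inter> Bl k = {}"
begin

lemma blocks_remove: "\<Union>(Bl ` (J - {i})) = \<Union>(Bl ` J) - Bl i"
proof
  show "\<Union>(Bl ` (J - {i})) \<subseteq> \<Union>(Bl ` J) - Bl i"
  proof
    fix x assume "x \<in> \<Union>(Bl ` (J - {i}))"
    then obtain j where "j \<in> J" "j \<noteq> i" "x \<in> Bl j" by auto
    then show "x \<in> \<Union>(Bl ` J) - Bl i" using disj[of j i] by auto
  qed
qed auto

text \<open>Expanding one block at a time in its unit vectors turns the form into a
  polynomial.\<close>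

lemma multilinear_form_PF:
  assumes F: "multilinear_form Bl J F" and J: "finite J"
  shows "F \<in> poly_fun (\<Union>(Bl ` J))"
proof -
  have "(\<lambda>c. F (override_on y c (\<Union>(Bl ` K)))) \<in> poly_fun (\<Union>(Bl ` K))" if "finite K" "K \<subseteq> J" for K y
    using that
  proof (induction K arbitrary: y rule: finite_induct)
    case (insert k K)
    have dis: "\<Union>(Bl ` K) \<inter> Bl k = {}"
    proof -
      have "Bl i \<inter> Bl k = {}" if "i \<in> K" for i using disj[of i k] insert(2) that by metis
      then show ?thesis by blast
    qed
    have "F (override_on y c (\<Union>(Bl ` insert k K))) =
        (\<Sum>i\<in>Bl k. c i * F (override_on (override_on y (\<lambda>l. if l = i then 1 else 0) (Bl k)) c (\<Union>(Bl ` K))))" for c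
    proof -
      have "override_on y c (\<Union>(Bl ` insert k K)) = override_on (override_on y c (\<Union>(Bl ` K))) c (Bl k)"
        by (auto simp: override_on_def)
      then have "F (override_on y c (\<Union>(Bl ` insert k K))) =
          F (override_on (override_on y c (\<Union>(Bl ` K))) c (Bl k))" by (rule arg_cong)
      also have "\<dots> = (\<Sum>i\<in>Bl k. c i *
          F (override_on (override_on y c (\<Union>(Bl ` K))) (\<lambda>l. if l = i then 1 else 0) (Bl k)))"
        by (rule multilinear_form_expand[OF F _ fin]) (use insert in simp)
      finally show ?thesis using override_commute[OF dis, of y c] by simp
    qed
    moreover have "(\<lambda>c. \<Sum>i\<in>Bl k. c i *
        F (override_on (override_on y (\<lambda>l. if l = i then 1 else 0) (Bl k)) c (\<Union>(Bl ` K))))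
        \<in> poly_fun (\<Union>(Bl ` insert k K))"
    proof (rule poly_fun_sum, rule poly_fun_mult)
      fix i assume "i \<in> Bl k"
      then show "(\<lambda>c. c i) \<in> poly_fun (\<Union>(Bl ` insert k K))" by simp
      show "(\<lambda>c. F (override_on (override_on y (\<lambda>l. if l = i then 1 else 0) (Bl k)) c (\<Union>(Bl ` K))))
          \<in> poly_fun (\<Union>(Bl ` insert k K))"
        by (rule poly_fun_mono[OF insert.IH]) (use insert.prems in auto)
    qed
    ultimately show ?case by simp
  qed simp
  from this[OF J order_refl, of "\<lambda>_. 0"]
  have "(\<lambda>c. F (override_on (\<lambda>_. 0) c (\<Union>(Bl ` J)))) \<in> poly_fun (\<Union>(Bl ` J))" .
  moreover have "F (override_on (\<lambda>_. 0) c (\<Union>(Bl ` J))) = F c" for c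
    by (rule multilinear_form_cong[OF F]) (simp add: override_on_def)
  ultimately show ?thesis by simp
qed

lemma multilinear_form_contract:
  assumes "multilinear_form Bl J F" "i \<in> J"
  shows "multilinear_form Bl (J - {i}) (\<lambda>c. F (override_on c u (Bl i)))"
  unfolding multilinear_form_def
proof (intro conjI ballI allI impI)
  fix c c' :: "'i \<Rightarrow> complex" assume "\<forall>j\<in>\<Union>(Bl ` (J - {i})). c j = c' j"
  then show "F (override_on c u (Bl i)) = F (override_on c' u (Bl i))"
    unfolding blocks_remove by (intro multilinear_form_cong[OF assms(1)]) (simp add: override_on_def)
next
  fix j c v w a assume j: "j \<in> J - {i}"
  have comm: "override_on (override_on c x (Bl j)) u (Bl i) = override_on (override_on c u (Bl i)) x (Bl j)" for x
    by (rule override_commute) (use disj j in auto)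
  show "F (override_on (override_on c (\<lambda>i. v i + a * w i) (Bl j)) u (Bl i)) =
      F (override_on (override_on c v (Bl j)) u (Bl i)) +
      a * F (override_on (override_on c w (Bl j)) u (Bl i))"
    unfolding comm by (rule multilinear_form_lin[OF assms(1)]) (use j in simp)
qed

lemma multilinear_form_homog:
  assumes F: "multilinear_form Bl J F" and J: "finite J"
  shows "homog (card J) F"
  unfolding homog_def
proof (intro allI)
  fix a c
  have "F (\<lambda>i. if i \<in> \<Union>(Bl ` S) then a * c i else c i) = a ^ card S * F c" if "finite S" "S \<subseteq> J" for S
    using that
  proof (induction S rule: finite_induct)
    case (insert j S)
    define d where "d = (\<lambda>i. if i \<in> \<Union>(Bl ` S) then a * c i else c i)"
    have "i \<notin> \<Union>(Bl ` S)" if "i \<in> Bl j" for i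
    proof
      assume "i \<in> \<Union>(Bl ` S)"
      then obtain k where k: "k \<in> S" "i \<in> Bl k" by blast
      then have "j \<noteq> k" using insert(2) by auto
      from disj[OF this] show False using k(2) that by blast
    qed
    then have "(\<lambda>i. if i \<in> \<Union>(Bl ` insert j S) then a * c i else c i) = override_on d (dilate a d) (Bl j)"
      by (auto simp: d_def dilate_def override_on_def fun_eq_iff)
    then show ?case
      using insert multilinear_form_dilate[OF F, of j d a d] by (simp add: override_self d_def)
  qed simp
  from this[OF J order_refl]
  have "F (\<lambda>i. if i \<in> \<Union>(Bl ` J) then a * c i else c i) = a ^ card J * F c" .
  moreover have "F (dilate a c) = F (\<lambda>i. if i \<in> \<Union>(Bl ` J) then a * c i else c i)"
    by (rule multilinear_form_cong[OF F]) (simp add: dilate_def)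
  ultimately show "F (dilate a c) = a ^ card J * F c" by simp
qed

lemma aclosed_kernel_variety:
  assumes "multilinear_form Bl J F" "finite J"
  shows "aclosed (\<Union>(Bl ` (J - {k}))) (kernel_variety Bl F k)"
proof -
  have "aclosed (\<Union>(Bl ` (J - {k}))) {c. \<forall>q\<in>range (\<lambda>u c. F (override_on c u (Bl k))). q c = 0}"
    by (rule aclosedI) (use poly_fun_override[OF multilinear_form_PF[OF assms]] in \<open>auto simp: blocks_remove\<close>)
  then show ?thesis by (simp add: kernel_variety_def)
qed

text \<open>There is a factor besides \<open>k\<close>; the zero vector in it makes the form vanish,
  which puts the origin into the variety.\<close>

lemma conic_kernel_variety:
  assumes F: "multilinear_form Bl J F" and J: "finite J" "k \<in> J" "card J \<ge> 2"
  shows "conic (kernel_variety Bl F k)"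
  unfolding conic_def
proof (intro conjI ballI allI)
  have "J - {k} \<noteq> {}"
  proof
    assume "J - {k} = {}"
    then have "J \<subseteq> {k}" by auto
    then have "card J \<le> card {k}" by (intro card_mono) auto
    then show False using J(3) by simp
  qed
  then obtain j where j: "j \<in> J" "j \<noteq> k" by auto
  have "F (override_on (\<lambda>_. 0) u (Bl k)) = 0" for u
  proof -
    have "override_on (\<lambda>_. 0) u (Bl k) = override_on (override_on (\<lambda>_. 0) u (Bl k)) (\<lambda>_. 0) (Bl j)"
      using disj[OF j(2)] by (auto simp: override_on_def fun_eq_iff)
    then show ?thesis using multilinear_form_zero[OF F j(1), of "override_on (\<lambda>_. 0) u (Bl k)"] by simp
  qed
  then show "kernel_variety Bl F k \<noteq> {}" unfolding kernel_variety_def by blast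
next
  fix c a assume c: "c \<in> kernel_variety Bl F k"
  have "F (override_on (dilate a c) u (Bl k)) = 0" for u
    using homogD[OF multilinear_form_homog[OF multilinear_form_contract[OF F J(2), of u]], of a c] J(1) c by (simp add: kernel_variety_def)
  then show "dilate a c \<in> kernel_variety Bl F k" by (simp add: kernel_variety_def)
qed

lemma fibre_kernel_variety:
  assumes "i \<noteq> k"
  shows "fibre (kernel_variety Bl F k) (Bl i) t = kernel_variety Bl (\<lambda>c. F (override_on c t (Bl i))) k"
proof -
  have comm: "override_on (override_on c t (Bl i)) u (Bl k) = override_on (override_on c u (Bl k)) t (Bl i)" for c u
    by (rule override_commute[OF disj[OF assms]])
  have "c \<in> fibre (kernel_variety Bl F k) (Bl i) t \<longleftrightarrow> c \<in> kernel_variety Bl (\<lambda>c. F (override_on c t (Bl i))) k" for c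
    unfolding kernel_variety_def mem_Collect_eq comm ..
  then show ?thesis by blast
qed

text \<open>Here \<open>indep_total\<close> is applied over the whole factor \<open>i\<close>: all
  coordinates of its block are independent on the base, so only the fibres contribute to the
  codimension.\<close>

lemma codim_le_of_fibres:
  assumes F: "multilinear_form Bl J F" and i: "i \<in> J" "i \<noteq> k" and J: "finite J"
    and fib: "\<And>u. codim_le (\<Union>(Bl ` (J - {i} - {k}))) (kernel_variety Bl (\<lambda>c. F (override_on c u (Bl i))) k) r"
  shows "codim_le (\<Union>(Bl ` (J - {k}))) (kernel_variety Bl F k) r"
proof -
  let ?V = "\<Union>(Bl ` (J - {k}))" and ?W = "\<Union>(Bl ` (J - {i} - {k}))"
  have W: "?W = ?V - Bl i" by (metis blocks_remove Diff_insert Diff_insert2)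
  have finV: "finite ?V" using J fin by blast
  have Bi: "Bl i \<subseteq> ?V" using i by auto
  define \<F> where "\<F> = {I. I \<subseteq> ?W \<and> card ?W \<le> card I + r}"
  have "finite ?W" using finV by (simp add: W)
  then have "finite \<F>" by (simp add: \<F>_def)
  moreover have "I \<inter> Bl i = {}" if "I \<in> \<F>" for I using that by (auto simp: \<F>_def W)
  moreover have "indep (Bl i) UNIV" by (simp add: dominant_def)
  moreover have "\<exists>I\<in>\<F>. indep I (fibre (kernel_variety Bl F k) (Bl i) t)" for t
    unfolding fibre_kernel_variety[OF i(2)] using fib[of t] by (auto simp: codim_le_def \<F>_def)
  ultimately obtain I where I: "I \<in> \<F>" "indep (Bl i \<union> I) (kernel_variety Bl F k)"
    by (rule indep_total[where B="Bl i" and J="Bl i" and \<Theta>=UNIV, OF _ _ order_refl])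
  have IW: "I \<subseteq> ?W" using I(1) by (simp add: \<F>_def)
  have "card (Bl i \<union> I) = card (Bl i) + card I"
    using fin finite_subset[OF IW \<open>finite ?W\<close>] IW W by (intro card_Un_disjoint) auto
  moreover have "card ?V = card (Bl i) + card ?W"
    using card_Diff_subset[OF fin Bi] card_mono[OF finV Bi] by (simp add: W)
  ultimately have "card ?V \<le> card (Bl i \<union> I) + r" using I(1) by (simp add: \<F>_def)
  then show ?thesis using I(2) IW Bi W unfolding codim_le_def by (intro exI[of _ "Bl i \<union> I"]) auto
qed

lemma codim_le_exchange:
  assumes F: "multilinear_form Bl J F" and kl: "k \<in> J" "l \<in> J" "k \<noteq> l" and J: "finite J"
    and le: "codim_le (\<Union>(Bl ` (J - {k}))) (kernel_variety Bl F k) r"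
  shows "codim_le (\<Union>(Bl ` (J - {l}))) (kernel_variety Bl F l) r"
proof -
  let ?U = "\<Union>(Bl ` (J - {k} - {l}))"
  have V0: "?U = \<Union>(Bl ` J) - Bl k - Bl l" by (simp add: blocks_remove)
  have Vk: "\<Union>(Bl ` (J - {k})) = ?U \<union> Bl l" and Vl: "\<Union>(Bl ` (J - {l})) = ?U \<union> Bl k"
    using kl disj[OF kl(3)] by (auto simp: blocks_remove)
  have finV0: "finite ?U" using J fin by blast
  define e :: "'i \<Rightarrow> 'i \<Rightarrow> complex" where "e = (\<lambda>r i. if i = r then 1 else 0)"
  have expand: "F (override_on c v (Bl j)) = (\<Sum>i\<in>Bl j. v i * F (override_on c (e i) (Bl j)))"
    if "j \<in> J" for c v j
    using multilinear_form_expand[OF F that fin, of c v] by (simp add: e_def)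
  \<comment> \<open>The form is bilinear in the blocks \<open>k\<close> and \<open>l\<close>; this
    is its matrix, with entries depending on the other blocks.\<close>
  define M where "M r s c = F (override_on (override_on c (e r) (Bl k)) (e s) (Bl l))" for r s c
  have Mk: "F (override_on c u (Bl k)) = (\<Sum>r\<in>Bl k. u r * (\<Sum>s\<in>Bl l. M r s c * c s))" for c u
  proof -
    have "F (override_on c (e r) (Bl k)) = (\<Sum>s\<in>Bl l. M r s c * c s)" for r
    proof -
      have "override_on c (e r) (Bl k) = override_on (override_on c (e r) (Bl k)) c (Bl l)"
        using disj[OF kl(3)] by (auto simp: override_on_def fun_eq_iff)
      then have "F (override_on c (e r) (Bl k)) = F (override_on (override_on c (e r) (Bl k)) c (Bl l))"
        by simp
      also have "\<dots> = (\<Sum>s\<in>Bl l. M r s c * c s)"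
        by (subst expand[OF kl(2)]) (simp add: M_def mult.commute)
      finally show ?thesis .
    qed
    then show ?thesis using expand[OF kl(1), of c u] by simp
  qed
  have Ml: "F (override_on c u (Bl l)) = (\<Sum>s\<in>Bl l. u s * (\<Sum>r\<in>Bl k. M r s c * c r))" for c u
  proof -
    have "F (override_on c (e s) (Bl l)) = (\<Sum>r\<in>Bl k. M r s c * c r)" for s
    proof -
      have "override_on c (e s) (Bl l) = override_on (override_on c (e s) (Bl l)) c (Bl k)"
        using disj[OF kl(3)] by (auto simp: override_on_def fun_eq_iff)
      then have "F (override_on c (e s) (Bl l)) = F (override_on (override_on c (e s) (Bl l)) c (Bl k))"
        by simp
      also have "\<dots> = (\<Sum>r\<in>Bl k. M r s c * c r)"
      proof -
        have comm: "override_on (override_on c (e s) (Bl l)) (e r) (Bl k) =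
            override_on (override_on c (e r) (Bl k)) (e s) (Bl l)" for r
          by (rule override_commute) (use disj[OF kl(3)] in auto)
        show ?thesis by (subst expand[OF kl(1)]) (simp add: M_def comm mult.commute)
      qed
      finally show ?thesis .
    qed
    then show ?thesis using expand[OF kl(2), of c u] by simp
  qed
  have delta: "(\<Sum>r\<in>A. e r0 r * f r) = f r0" if "finite A" "r0 \<in> A" for A r0 and f :: "'i \<Rightarrow> complex"
    using that by (simp add: e_def if_distrib[of "\<lambda>x. x * _"] sum.delta cong: if_cong)
  have nk: "kernel_variety Bl F k = {c. \<forall>r\<in>Bl k. (\<Sum>s\<in>Bl l. M r s c * c s) = 0}"
  proof (intro set_eqI iffI)
    fix c assume c: "c \<in> kernel_variety Bl F k"
    have "(\<Sum>s\<in>Bl l. M r s c * c s) = 0" if "r \<in> Bl k" for r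
      using c Mk[of c "e r"] delta[OF fin that] by (simp add: kernel_variety_def)
    then show "c \<in> {c. \<forall>r\<in>Bl k. (\<Sum>s\<in>Bl l. M r s c * c s) = 0}" by simp
  qed (simp add: kernel_variety_def Mk)
  have nl: "kernel_variety Bl F l = {c. \<forall>s\<in>Bl l. (\<Sum>r\<in>Bl k. M r s c * c r) = 0}"
  proof (intro set_eqI iffI)
    fix c assume c: "c \<in> kernel_variety Bl F l"
    have "(\<Sum>r\<in>Bl k. M r s c * c r) = 0" if "s \<in> Bl l" for s
      using c Ml[of c "e s"] delta[OF fin that] by (simp add: kernel_variety_def)
    then show "c \<in> {c. \<forall>s\<in>Bl l. (\<Sum>r\<in>Bl k. M r s c * c r) = 0}" by simp
  qed (simp add: kernel_variety_def Ml)
  have kJ: "k \<in> J - {l}" and Jkl: "J - {l} - {k} = J - {k} - {l}" using kl by auto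
  have M_PF: "M r s \<in> poly_fun ?U" for r s
    using multilinear_form_PF[OF multilinear_form_contract[OF multilinear_form_contract[OF F kl(2)] kJ, of "e r" "e s"]] J
    unfolding Jkl M_def[abs_def] by simp
  obtain I where I: "I \<subseteq> ?U \<union> Bl l" "indep I (kernel_variety Bl F k)" "card (?U \<union> Bl l) \<le> card I + r"
    using le unfolding codim_le_def Vk by blast
  have V0kl: "?U \<inter> Bl k = {}" "?U \<inter> Bl l = {}" using V0 by auto
  obtain I2 where I2: "I2 \<subseteq> ?U \<union> Bl k" "indep I2 {c. \<forall>s\<in>Bl l. (\<Sum>r\<in>Bl k. M r s c * c r) = 0}"
    "card I + card (Bl k) \<le> card I2 + card (Bl l)"
    by (rule exchange_dimension[OF finV0 fin fin V0kl M_PF I(1) I(2)[unfolded nk]])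
  have I2': "indep I2 (kernel_variety Bl F l)" using I2(2) by (simp only: nl)
  have "card (?U \<union> Bl l) = card ?U + card (Bl l)" "card (?U \<union> Bl k) = card ?U + card (Bl k)"
    by (rule card_Un_disjoint[OF finV0 fin V0kl(2)], rule card_Un_disjoint[OF finV0 fin V0kl(1)])
  then have "card (?U \<union> Bl k) \<le> card I2 + r" using I(3) I2(3) by simp
  then show ?thesis unfolding codim_le_def Vl using I2(1) I2' by blast
qed

text \<open>The blocks are disjoint, so one missed coordinate in each adds up. This is the source of
  the lower bound on the codimension of a component that dominates no factor.\<close>

lemma missing_blocks:
  assumes "finite S" "\<And>i. i \<in> S \<Longrightarrow> \<not> Bl i \<subseteq> I"
  shows "card S \<le> card (\<Union>(Bl ` S) - I)"
  using assms
proof (induction S rule: finite_induct)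
  case (insert i S)
  have "\<Union>(Bl ` insert i S) - I = (Bl i - I) \<union> (\<Union>(Bl ` S) - I)" by auto
  moreover have "(Bl i - I) \<inter> (\<Union>(Bl ` S) - I) = {}"
  proof -
    have "Bl i \<inter> Bl j = {}" if "j \<in> S" for j using disj[of i j] insert(2) that by metis
    then show ?thesis by blast
  qed
  moreover have "finite (\<Union>(Bl ` S) - I)" using insert(1) fin by blast
  ultimately have "card (\<Union>(Bl ` insert i S) - I) = card (Bl i - I) + card (\<Union>(Bl ` S) - I)"
    using fin by (simp add: card_Un_disjoint)
  moreover have "card (Bl i - I) > 0" using insert.prems[of i] fin by (simp add: card_gt_0_iff)
  moreover have "card S \<le> card (\<Union>(Bl ` S) - I)" by (rule insert.IH) (use insert.prems in simp)
  ultimately show ?case using insert(1,2) by simp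
qed simp

text \<open>Irreducibility of a product: the block \<open>B\<close> and the remaining coordinates
  are varied one after the other over \<open>Z\<close>.\<close>

lemma irr_mix:
  assumes "irr V Z"
  shows "irr V {override_on y z B | y z. y \<in> Z \<and> z \<in> Z}" (is "irr V ?W")
  unfolding irr_def
proof (intro conjI ballI impI)
  obtain z where "z \<in> Z" using assms by (auto simp: irr_def)
  then show "?W \<noteq> {}" by blast
next
  fix f g assume f: "f \<in> poly_fun V" and g: "g \<in> poly_fun V" and fg: "\<forall>w\<in>?W. f w * g w = 0"
  show "(\<forall>w\<in>?W. f w = 0) \<or> (\<forall>w\<in>?W. g w = 0)"
  proof (rule ccontr)
    assume "\<not> ?thesis"
    then obtain y0 z0 y1 z1 where yz: "y0 \<in> Z" "z0 \<in> Z" "f (override_on y0 z0 B) \<noteq> 0"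
      "y1 \<in> Z" "z1 \<in> Z" "g (override_on y1 z1 B) \<noteq> 0" by auto
    have fz: "(\<lambda>z. f (override_on y z B)) \<in> poly_fun V" "(\<lambda>z. g (override_on y z B)) \<in> poly_fun V" for y
      by (rule poly_fun_mono[OF poly_fun_override'[OF f]], simp, rule poly_fun_mono[OF poly_fun_override'[OF g]], simp)
    have fy: "(\<lambda>y. f (override_on y z B)) \<in> poly_fun V" "(\<lambda>y. g (override_on y z B)) \<in> poly_fun V" for z
      by (rule poly_fun_mono[OF poly_fun_override[OF f]], simp, rule poly_fun_mono[OF poly_fun_override[OF g]], simp)
    \<comment> \<open>A single block part \<open>z\<close> that serves both \<open>f\<close> over
      \<open>y0\<close> and \<open>g\<close> over \<open>y1\<close>; afterwards a common
      \<open>y\<close> is found in the same way.\<close>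
    have "\<exists>z\<in>Z. f (override_on y0 z B) * g (override_on y1 z B) \<noteq> 0"
      using irrD[OF assms fz(1)[of y0] fz(2)[of y1]] yz by blast
    then obtain z where z: "z \<in> Z" "f (override_on y0 z B) \<noteq> 0" "g (override_on y1 z B) \<noteq> 0" by auto
    have "\<exists>y\<in>Z. f (override_on y z B) * g (override_on y z B) \<noteq> 0"
      using irrD[OF assms fy(1)[of z] fy(2)[of z]] yz z by blast
    then show False using fg z(1) by blast
  qed
qed

lemma codim_le_contract_dominant:
  assumes F: "multilinear_form Bl J F" and J: "finite J" "k \<in> J" "card J \<ge> 3" and i: "i \<in> J" "i \<noteq> k"
    and I: "I \<subseteq> \<Union>(Bl ` (J - {k}))" "indep I (kernel_variety Bl F k)" "Bl i \<subseteq> I"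
      "card (\<Union>(Bl ` (J - {k}))) \<le> card I + r"
  shows "codim_le (\<Union>(Bl ` (J - {i} - {k}))) (kernel_variety Bl (\<lambda>c. F (override_on c u (Bl i))) k) r"
proof -
  let ?V = "\<Union>(Bl ` (J - {k}))"
  have W: "\<Union>(Bl ` (J - {i} - {k})) = ?V - Bl i" by (metis blocks_remove Diff_insert Diff_insert2)
  have finV: "finite ?V" using J fin by blast
  have cone: "conic (fibre (kernel_variety Bl F k) (Bl i) t)" for t
    unfolding fibre_kernel_variety[OF i(2)]
    by (rule conic_kernel_variety[OF multilinear_form_contract[OF F i(1)]]) (use J i in auto)
  obtain I' where I': "I' \<subseteq> ?V - Bl i" "indep I' (fibre (kernel_variety Bl F k) (Bl i) u)" "card I \<le> card I' + card (Bl i)"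
    by (rule indep_every_fibre[OF finV aclosed_kernel_variety[OF F J(1)] cone I(1-3)])
  have Bi: "Bl i \<subseteq> ?V" using i by auto
  have "card ?V = card (Bl i) + card (?V - Bl i)"
    using card_Diff_subset[OF fin Bi] card_mono[OF finV Bi] by simp
  then have "card (?V - Bl i) \<le> card I' + r" using I(4) I'(3) by simp
  then show ?thesis using I'(1,2) unfolding W fibre_kernel_variety[OF i(2)] codim_le_def by blast
qed

text \<open>The remaining case: no factor is dominated by the component \<open>Z\<close> of the kernel variety. Then
  the codimension of \<open>Z\<close> is so large that \<open>Z\<close> is dense in the set \<open>W\<close> of points obtained by combining
  a block of one point with the other blocks of another one, and the form vanishes on \<open>W\<close>.\<close>

lemma codim_le_contract_last:
  assumes F: "multilinear_form Bl J F" and J: "finite J" "k \<in> J" "l \<in> J" "k \<noteq> l" "card J \<ge> 3" and r: "r < card J"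
    and Z: "irr (\<Union>(Bl ` (J - {k}))) Z" "Z \<subseteq> kernel_variety Bl F k"
    and I: "I \<subseteq> \<Union>(Bl ` (J - {k}))" "indep I Z" "card (\<Union>(Bl ` (J - {k}))) \<le> card I + r"
    and nd: "\<And>i. i \<in> J - {k} \<Longrightarrow> \<not> indep (Bl i) Z"
  shows "codim_le (\<Union>(Bl ` (J - {k} - {l}))) (kernel_variety Bl (\<lambda>c. F (override_on c u (Bl k))) l) r"
proof -
  let ?V = "\<Union>(Bl ` (J - {k}))" and ?U = "\<Union>(Bl ` (J - {k} - {l}))"
  have finV: "finite ?V" using J(1) fin by blast
  have finV0: "finite ?U" using J(1) fin by blast
  have finI: "finite I" using I(1) finV by (rule finite_subset)
  have V0: "?U = ?V - Bl l" by (rule blocks_remove)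
  have Bl: "Bl l \<subseteq> ?V" using J by auto
  define W where "W = {override_on y z (Bl l) | y z. y \<in> Z \<and> z \<in> Z}"
  have irrW: "irr ?V W" unfolding W_def by (rule irr_mix[OF Z(1)])
  have ZW: "Z \<subseteq> W"
  proof
    fix z assume "z \<in> Z"
    then show "z \<in> W" unfolding W_def by (intro CollectI exI[of _ z]) (simp add: override_self)
  qed
  have ndW: "\<not> indep (Bl i) W" if i: "i \<in> J - {k}" for i
  proof -
    obtain p where p: "p \<in> poly_fun (Bl i)" "\<forall>z\<in>Z. p z = 0" "\<exists>x. p x \<noteq> 0" by (rule not_dominantE[OF nd[OF i]])
    have "p w = 0" if wW: "w \<in> W" for w
    proof -
      obtain y z where w: "w = override_on y z (Bl l)" "y \<in> Z" "z \<in> Z" using wW by (auto simp: W_def)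
      show ?thesis
      proof (cases "i = l")
        case True
        have "p w = p z" by (rule poly_fun_cong[OF p(1)]) (simp add: w True)
        then show ?thesis using p(2) w by simp
      next
        case False
        have "p w = p y" by (rule poly_fun_cong[OF p(1)]) (use disj[OF False] in \<open>auto simp: w override_on_def\<close>)
        then show ?thesis using p(2) w by simp
      qed
    qed
    then show ?thesis using p(1,3) by (auto simp: dominant_def)
  qed
  have cardJ: "card (J - {k}) = card J - 1" "card (J - {k} - {l}) = card J - 2" using J by auto
  have diffI: "card (?V - I) \<le> r"
    using I(1,3) card_Diff_subset[OF finI I(1)] by simp
  \<comment> \<open>Density of \<open>Z\<close> in \<open>W\<close>: a polynomial that separates
    them would give \<open>card I + 1\<close> independent coordinates on \<open>W\<close>. As
    \<open>W\<close> dominates no block either, these miss at least \<open>card J - 1\<close>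
    coordinates, whereas the bound on \<open>I\<close> leaves room for fewer.\<close>
  have vanish: "f w = 0" if f: "f \<in> poly_fun ?V" "\<forall>z\<in>Z. f z = 0" and w: "w \<in> W" for f w
  proof (rule ccontr)
    assume "f w \<noteq> 0"
    have g: "grows ?V W (Suc (card I))"
      by (rule grows_step[OF ZW irrW f(1)]) (use f w \<open>f w \<noteq> 0\<close> grows_indep[OF finI I(2,1)] in auto)
    have "W \<noteq> {}" using w by auto
    obtain I3 where I3: "I3 \<subseteq> ?V" "indep I3 W" "Suc (card I) \<le> card I3"
      by (rule irr_indep_extend[OF finV irrW empty_subsetI indep_empty[OF \<open>W \<noteq> {}\<close>] g])
    have finI3: "finite I3" using I3(1) finV by (rule finite_subset)
    have "\<not> Bl i \<subseteq> I3" if "i \<in> J - {k}" for i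
      using ndW[OF that] dominant_mono[OF I3(2) _ order_refl, of "Bl i"] by blast
    then have "card (J - {k}) \<le> card (?V - I3)" using J(1) by (intro missing_blocks) auto
    also have "\<dots> = card ?V - card I3" by (rule card_Diff_subset[OF finI3 I3(1)])
    finally show False using I3(3) I(3) r cardJ(1) J(5) by simp
  qed
  have notfull: "\<not> Bl i \<subseteq> I" if "i \<in> J - {k}" for i
    using nd[OF that] dominant_mono[OF I(2) _ order_refl, of "Bl i"] by blast
  \<comment> \<open>At most \<open>r \<le> card J - 1\<close> coordinates are missing from
    \<open>I\<close>, and at least one in each of the \<open>card J - 1\<close> blocks; so the block
    \<open>l\<close> misses exactly one.\<close>
  have "card (J - {k} - {l}) \<le> card (?U - I)" using J(1) notfull by (intro missing_blocks) auto
  moreover have "card (?V - I) = card (Bl l - I) + card (?U - I)"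
  proof -
    have "?V - I = (Bl l - I) \<union> (?U - I)" using V0 Bl by auto
    moreover have "(Bl l - I) \<inter> (?U - I) = {}" using V0 by auto
    ultimately show ?thesis using fin finV0 by (simp add: card_Un_disjoint)
  qed
  moreover have "card (Bl l - I) \<ge> 1"
    using notfull[of l] J fin by (simp add: Suc_le_eq card_gt_0_iff)
  ultimately have one: "card (Bl l - I) = 1" and V0I: "card (?U - I) + 1 \<le> r"
    using diffI cardJ(2) r J(5) by linarith+
  obtain b where b: "Bl l - I = {b}" using one by (rule card_1_singletonE)
  define G where "G = (\<lambda>c. F (override_on c u (Bl k)))"
  have mG: "multilinear_form Bl (J - {k}) G" unfolding G_def by (rule multilinear_form_contract[OF F J(2)])
  have GPF: "G \<in> poly_fun ?V" by (rule multilinear_form_PF[OF mG]) (use J in simp)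
  have lJ: "l \<in> J - {k}" using J by auto
  have cardJk: "card (J - {k}) \<ge> 2" using cardJ(1) J(5) by simp
  \<comment> \<open>Points at which the contracted form vanishes whatever point of \<open>Z\<close>
    fills the block \<open>l\<close>. By density of \<open>Z\<close> in \<open>W\<close> this cone
    contains \<open>Z\<close> and inherits its independent coordinates.\<close>
  define Y where "Y = {c. \<forall>q\<in>(\<lambda>z c. G (override_on c z (Bl l))) ` Z. q c = 0}"
  have Y: "aclosed ?U Y" unfolding Y_def V0 by (rule aclosedI) (use poly_fun_override[OF GPF] in auto)
  \<comment> \<open>The one extra equation belongs to the coordinate \<open>b\<close> that
    \<open>I\<close> misses in the block \<open>l\<close>.\<close>
  define g where "g = (\<lambda>c. G (override_on c (\<lambda>i. if i = b then 1 else 0) (Bl l)))"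
  have mg: "multilinear_form Bl (J - {k} - {l}) g" unfolding g_def by (rule multilinear_form_contract[OF mG lJ])
  have gPF: "g \<in> poly_fun ?U" by (rule multilinear_form_PF[OF mg]) (use J in simp)
  have homg: "homog (card (J - {k} - {l})) g" by (rule multilinear_form_homog[OF mg]) (use J in simp)
  have "conic Y"
    unfolding conic_def
  proof (intro conjI ballI allI)
    have "kernel_variety Bl G l \<noteq> {}" using conic_kernel_variety[OF mG _ lJ cardJk] J(1) by (simp add: conic_def)
    then show "Y \<noteq> {}" by (auto simp: Y_def kernel_variety_def)
    fix c a assume c: "c \<in> Y"
    have "G (override_on (dilate a c) z (Bl l)) = 0" if "z \<in> Z" for z
      using homogD[OF multilinear_form_homog[OF multilinear_form_contract[OF mG lJ, of z]], of a c] J(1) c that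
      by (simp add: Y_def)
    then show "dilate a c \<in> Y" by (simp add: Y_def)
  qed
  have "Z \<subseteq> Y"
  proof
    fix y assume y: "y \<in> Z"
    have "G (override_on y z (Bl l)) = 0" if "z \<in> Z" for z
    proof (rule vanish[OF GPF])
      show "\<forall>z\<in>Z. G z = 0" using Z(2) by (auto simp: G_def kernel_variety_def)
      show "override_on y z (Bl l) \<in> W" using y that by (auto simp: W_def)
    qed
    then show "y \<in> Y" by (simp add: Y_def)
  qed
  then have indY: "indep (I \<inter> ?U) Y" by (intro dominant_mono[OF I(2)]) auto
  obtain I2 where I2: "I2 \<subseteq> ?U" "indep I2 {y \<in> Y. g y = 0}" "card (I \<inter> ?U) \<le> Suc (card I2)"
    by (rule cone_hypersurface[OF finV0 Y \<open>conic Y\<close> gPF homg _ Int_lower2 indY])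
      (use cardJ(2) J(5) in simp)
  have sub: "{y \<in> Y. g y = 0} \<subseteq> kernel_variety Bl G l"
  proof
    fix c assume c: "c \<in> {y \<in> Y. g y = 0}"
    define v where "v i = G (override_on c (\<lambda>j. if j = i then 1 else 0) (Bl l))" for i
    have ex: "G (override_on c z (Bl l)) = (\<Sum>i\<in>Bl l. z i * v i)" for z
      using multilinear_form_expand[OF mG lJ fin, of c z] by (simp add: v_def)
    have "b \<in> Bl l" using b by auto
    have vb: "v b = 0" using c by (simp add: v_def g_def)
    have ex': "G (override_on c z (Bl l)) = (\<Sum>i\<in>Bl l - {b}. z i * v i)" for z
      unfolding ex using sum.remove[OF fin \<open>b \<in> Bl l\<close>, of "\<lambda>i. z i * v i"] vb by simp
    \<comment> \<open>A linear form in the coordinates of \<open>Bl l\<close> other than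
      \<open>b\<close> involves only coordinates in \<open>I\<close>; vanishing on \<open>Z\<close>,
      it vanishes identically.\<close>
    have "(\<lambda>z. \<Sum>i\<in>Bl l - {b}. z i * v i) \<in> poly_fun I"
      by (intro poly_fun_sum poly_fun_mult poly_fun_const poly_fun_coord) (use b in auto)
    moreover have "(\<Sum>i\<in>Bl l - {b}. z i * v i) = 0" if "z \<in> Z" for z
      using c that by (auto simp: Y_def simp flip: ex')
    ultimately have zero: "(\<Sum>i\<in>Bl l - {b}. z i * v i) = 0" for z
      using dominantD[OF I(2), of "\<lambda>z. \<Sum>i\<in>Bl l - {b}. z i * v i" z] by blast
    show "c \<in> kernel_variety Bl G l" by (simp add: kernel_variety_def ex' zero)
  qed
  have "indep I2 (kernel_variety Bl G l)" by (rule dominant_mono[OF I2(2) order_refl sub])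
  moreover have "card ?U \<le> card I2 + r"
  proof -
    have "card ?U = card (I \<inter> ?U) + card (?U - I)"
      using card_Int_Diff[OF finV0, of I] by (simp add: Int_commute)
    then show ?thesis using I2(3) V0I by simp
  qed
  ultimately show ?thesis using I2(1) unfolding codim_le_def G_def by blast
qed

lemma codim_le_iff_contract:
  assumes F: "multilinear_form Bl {1..n} F" and n: "n \<ge> 3" and r: "r < n"
  shows "codim_le (\<Union>(Bl ` ({1..n} - {n}))) (kernel_variety Bl F n) r \<longleftrightarrow>
    (\<exists>i\<in>{1..n}. \<forall>u. codim_le (\<Union>(Bl ` ({1..n} - {i} - {Max ({1..n} - {i})})))
      (kernel_variety Bl (\<lambda>c. F (override_on c u (Bl i))) (Max ({1..n} - {i}))) r)"
    (is "?L \<longleftrightarrow> ?R")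
proof
  let ?J = "{1..n}"
  have Max1: "Max ({1..n} - {i}) = n" if "i \<noteq> n" for i
    by (rule Max_eqI) (use n that in auto)
  have Max2: "Max ({1..n} - {n}) = n - 1" by (rule Max_eqI) (use n in auto)
  {
    assume ?R
    then obtain i where i: "i \<in> {1..n}" and le: "\<And>u. codim_le (\<Union>(Bl ` ({1..n} - {i} - {Max ({1..n} - {i})})))
      (kernel_variety Bl (\<lambda>c. F (override_on c u (Bl i))) (Max ({1..n} - {i}))) r" by blast
    show ?L
    proof (cases "i = n")
      case False
      show ?thesis by (rule codim_le_of_fibres[OF F i False]) (use le Max1[OF False] in simp_all)
    next
      case True
      \<comment> \<open>The fibres over the last factor are kernel varieties with respect to the
        factor \<open>n - 1\<close>, so the bound is first obtained for that kernel variety of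
        \<open>F\<close>.\<close>
      have "codim_le (\<Union>(Bl ` ({1..n} - {n - 1}))) (kernel_variety Bl F (n - 1)) r"
        by (rule codim_le_of_fibres[OF F i]) (use n True le Max2 in simp_all)
      then show ?thesis
        by (rule codim_le_exchange[OF F, rotated -1]) (use n in auto)
    qed
  next
    assume ?L
    let ?V = "\<Union>(Bl ` ({1..n} - {n}))"
    obtain I where I: "I \<subseteq> ?V" "indep I (kernel_variety Bl F n)" "card ?V \<le> card I + r"
      using \<open>?L\<close> by (auto simp: codim_le_def)
    have finV: "finite ?V" using fin by blast
    have finI: "finite I" using I(1) finV by (rule finite_subset)
    obtain Z where Z: "Z \<subseteq> kernel_variety Bl F n" "aclosed ?V Z" "irr ?V Z" "indep I Z"
      by (rule indep_irr_subset[OF finV aclosed_kernel_variety[OF F finite_atLeastAtMost] I(1,2)])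
    show ?R
    proof (cases "\<exists>i\<in>?J - {n}. indep (Bl i) Z")
      case True
      then obtain i where i: "i \<in> ?J" "i \<noteq> n" "indep (Bl i) Z" by blast
      have sub: "Bl i \<subseteq> ?V" using i by auto
      \<comment> \<open>The given independent set is replaced by one of at least the same size that
        contains the whole block.\<close>
      obtain I' where I': "Bl i \<subseteq> I'" "I' \<subseteq> ?V" "indep I' Z" "card I \<le> card I'"
        by (rule irr_indep_extend[OF finV Z(3) sub i(3) grows_indep[OF finI Z(4) I(1)]])
      have "codim_le (\<Union>(Bl ` (?J - {i} - {n}))) (kernel_variety Bl (\<lambda>c. F (override_on c u (Bl i))) n) r" for u
        by (rule codim_le_contract_dominant[OF F _ _ _ i(1,2) I'(2) dominant_mono[OF I'(3) order_refl Z(1)] I'(1)])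
          (use n I(3) I'(4) in auto)
      then show ?thesis using i(1) Max1[OF i(2)] by (intro bexI[where x=i]) simp_all
    next
      case False
      have "codim_le (\<Union>(Bl ` (?J - {n} - {n - 1}))) (kernel_variety Bl (\<lambda>c. F (override_on c u (Bl n))) (n - 1)) r" for u
        by (rule codim_le_contract_last[OF F _ _ _ _ _ _ Z(3,1) I(1) Z(4) I(3)]) (use n r False in auto)
      then show ?thesis using n Max2 by (intro bexI[where x=n]) simp_all
    qed
  }
qed

end

section \<open>Tensors in coordinates\<close>

locale coordinates = V: vector_space smul
  for smul :: "complex \<Rightarrow> 'v::ab_group_add \<Rightarrow> 'v" +
  fixes A B :: "nat \<Rightarrow> 'v set" and J0 :: "nat set"
  assumes B: "j \<in> J0 \<Longrightarrow> finite (B j)" "j \<in> J0 \<Longrightarrow> \<not> V.dependent (B j)"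
    "j \<in> J0 \<Longrightarrow> A j = V.span (B j)"
begin

text \<open>The tag \<open>j\<close> keeps the blocks disjoint even if bases overlap; outside
  \<open>J0\<close> a block is empty, so that all blocks are finite.\<close>

definition Bl :: "nat \<Rightarrow> (nat \<times> 'v) set" where
  "Bl j = (if j \<in> J0 then {j} \<times> B j else {})"

abbreviation coord_set :: "nat set \<Rightarrow> (nat \<times> 'v) set" where
  "coord_set J \<equiv> \<Union>(Bl ` J)"

text \<open>The functional with prescribed values on the basis, extended by 0 outside
  \<open>A j\<close> as \<open>dual_space\<close> demands.\<close>

definition functional :: "nat \<Rightarrow> (nat \<times> 'v \<Rightarrow> complex) \<Rightarrow> 'v \<Rightarrow> complex" where
  "functional j c = (\<lambda>v. if v \<in> A j then \<Sum>b\<in>B j. V.representation (B j) v b * c (j, b) else 0)"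

definition point :: "nat set \<Rightarrow> (nat \<times> 'v \<Rightarrow> complex) \<Rightarrow> nat \<Rightarrow> 'v \<Rightarrow> complex" where
  "point J c = (\<lambda>j\<in>J. functional j c)"

definition coord :: "(nat \<Rightarrow> 'v \<Rightarrow> complex) \<Rightarrow> nat \<times> 'v \<Rightarrow> complex" where
  "coord x = (\<lambda>(j, b). x j b)"

lemma finite_Bl: "finite (Bl j)"
  using B(1) by (simp add: Bl_def)

lemma disjoint_Bl: "j \<noteq> k \<Longrightarrow> Bl j \<inter> Bl k = {}"
  by (auto simp: Bl_def)

lemma card_Bl: "j \<in> J0 \<Longrightarrow> card (Bl j) = V.dim (A j)"
  using V.dim_span_eq_card_independent[OF B(2)] by (simp add: Bl_def B(3) card_cartesian_product_singleton)

lemma card_coord_set: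
  assumes "finite J" "J \<subseteq> J0"
  shows "card (coord_set J) = (\<Sum>j\<in>J. V.dim (A j))"
proof -
  have "card (coord_set J) = (\<Sum>j\<in>J. card (Bl j))"
    using assms(1) finite_Bl disjoint_Bl by (intro card_UN_disjoint) auto
  also have "\<dots> = (\<Sum>j\<in>J. V.dim (A j))" using assms(2) by (intro sum.cong) (auto simp: card_Bl)
  finally show ?thesis .
qed

lemma basis_subset: "j \<in> J0 \<Longrightarrow> b \<in> B j \<Longrightarrow> b \<in> A j"
  using V.span_base by (simp add: B(3))

lemma functional_dual:
  assumes j: "j \<in> J0"
  shows "functional j c \<in> dual_space smul (A j)"
  unfolding dual_space_def
proof (intro CollectI conjI ballI allI impI)
  fix u v assume uv: "u \<in> A j" "v \<in> A j"
  then have "u + v \<in> A j" using V.span_add by (simp add: B(3)[OF j])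
  then show "functional j c (u + v) = functional j c u + functional j c v"
    using uv V.representation_add[OF B(2)[OF j], of v u]
    by (simp add: functional_def B(3)[OF j] distrib_right sum.distrib)
next
  fix a v assume v: "v \<in> A j"
  then have "smul a v \<in> A j" using V.span_scale by (simp add: B(3)[OF j])
  then show "functional j c (smul a v) = a * functional j c v"
    using v V.representation_scale[OF B(2)[OF j], of v a]
    by (simp add: functional_def B(3)[OF j] sum_distrib_left mult.assoc)
qed (simp add: functional_def)

lemma functional_basis:
  assumes "j \<in> J0" "b \<in> B j"
  shows "functional j c b = c (j, b)"
proof -
  have "(\<Sum>b'\<in>B j. (if b = b' then 1 else 0) * c (j, b')) = (\<Sum>b'\<in>B j. if b = b' then c (j, b') else 0)"
    by (intro sum.cong) auto
  then show ?thesis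
    using assms basis_subset[OF assms] B(1)[OF assms(1)]
    by (simp add: functional_def V.representation_basis[OF B(2)] eq_commute cong: if_cong)
qed

lemma dual_expand:
  assumes j: "j \<in> J0" and f: "f \<in> dual_space smul (A j)" and v: "v \<in> A j"
  shows "f v = (\<Sum>b\<in>B j. V.representation (B j) v b * f b)"
proof -
  have add: "\<And>u v. u \<in> A j \<Longrightarrow> v \<in> A j \<Longrightarrow> f (u + v) = f u + f v"
    and scale: "\<And>c v. v \<in> A j \<Longrightarrow> f (smul c v) = c * f v"
    using f by (auto simp: dual_space_def)
  have zero: "f 0 = 0" using scale[of 0 0] V.span_zero by (simp add: B(3)[OF j])
  have sum: "f (\<Sum>b\<in>S. smul (a b) b) = (\<Sum>b\<in>S. a b * f b)" if "finite S" "S \<subseteq> B j" for S a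
    using that
  proof (induction S rule: finite_induct)
    case (insert b S)
    have "smul (a b) b \<in> A j" "(\<Sum>b\<in>S. smul (a b) b) \<in> A j"
      using insert.prems basis_subset[OF j] unfolding B(3)[OF j]
      by (auto intro!: V.span_scale V.span_sum)
    then show ?case using insert add scale basis_subset[OF j] by simp
  qed (simp add: zero)
  have "v = (\<Sum>b\<in>B j. smul (V.representation (B j) v b) b)"
    using V.sum_representation_eq[OF B(2)[OF j] _ B(1)[OF j] order_refl] v B(3)[OF j] by simp
  then have "f v = f (\<Sum>b\<in>B j. smul (V.representation (B j) v b) b)" by simp
  also have "\<dots> = (\<Sum>b\<in>B j. V.representation (B j) v b * f b)" by (rule sum[OF B(1)[OF j] order_refl])
  finally show ?thesis .
qed

lemma functional_dual_eq:
  assumes "j \<in> J0" "f \<in> dual_space smul (A j)" "\<And>b. b \<in> B j \<Longrightarrow> c (j, b) = f b"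
  shows "functional j c = f"
proof
  fix v
  show "functional j c v = f v"
  proof (cases "v \<in> A j")
    case True
    then show ?thesis using dual_expand[OF assms(1,2) True] assms(3) by (simp add: functional_def)
  next
    case False
    then show ?thesis using assms(2) by (simp add: functional_def dual_space_def)
  qed
qed

lemma functional_cong: "(\<And>b. b \<in> B j \<Longrightarrow> c (j, b) = c' (j, b)) \<Longrightarrow> functional j c = functional j c'"
  by (auto simp: functional_def intro!: sum.cong)

lemma functional_surj:
  assumes "j \<in> J0" "f \<in> dual_space smul (A j)"
  shows "functional j (\<lambda>(k, b). f b) = f"
  by (rule functional_dual_eq[OF assms]) simp

lemma point_dual_prod: "J \<subseteq> J0 \<Longrightarrow> point J c \<in> dual_prod smul A J"
  using functional_dual by (auto simp: point_def dual_prod_def)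

lemma point_coord:
  assumes "J \<subseteq> J0" "x \<in> dual_prod smul A J"
  shows "point J (coord x) = x"
proof
  fix j
  show "point J (coord x) j = x j"
  proof (cases "j \<in> J")
    case True
    then have "x j \<in> dual_space smul (A j)" using assms(2) by (auto simp: dual_prod_def)
    then show ?thesis using True assms(1) by (auto simp: point_def coord_def intro!: functional_dual_eq)
  next
    case False
    then show ?thesis using assms(2) by (auto simp: point_def dual_prod_def PiE_def extensional_def)
  qed
qed

lemma coord_point: "J \<subseteq> J0 \<Longrightarrow> i \<in> coord_set J \<Longrightarrow> coord (point J c) i = c i"
  by (auto simp: coord_def point_def Bl_def functional_basis split: if_splits)

lemma point_cong:
  assumes "\<And>i. i \<in> coord_set J \<Longrightarrow> c i = c' i" "J \<subseteq> J0"
  shows "point J c = point J c'"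
  unfolding point_def
proof (rule restrict_ext)
  fix j assume "j \<in> J"
  then show "functional j c = functional j c'" using assms by (intro functional_cong) (auto simp: Bl_def)
qed

lemma polyfuns_poly_fun:
  assumes J: "J \<subseteq> J0" and "p \<in> polyfuns A J"
  shows "\<exists>q\<in>poly_fun (coord_set J). \<forall>x\<in>dual_prod smul A J. p x = q (coord x)"
  using assms(2)
proof induction
  case (const c)
  show ?case by (rule bexI[OF _ poly_fun_const[of c]]) simp
next
  case (coord j v)
  have j: "j \<in> J0" using coord J by auto
  have "(\<lambda>c. \<Sum>b\<in>B j. V.representation (B j) v b * c (j, b)) \<in> poly_fun (coord_set J)"
    using coord j by (intro poly_fun_sum poly_fun_mult poly_fun_const poly_fun_coord) (auto simp: Bl_def)
  moreover have "\<forall>x\<in>dual_prod smul A J. x j v = (\<Sum>b\<in>B j. V.representation (B j) v b * coord x (j, b))"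
  proof
    fix x assume "x \<in> dual_prod smul A J"
    then have "x j \<in> dual_space smul (A j)" using coord(1) by (auto simp: dual_prod_def)
    then show "x j v = (\<Sum>b\<in>B j. V.representation (B j) v b * local.coord x (j, b))"
      using dual_expand[OF j _ coord(2)] by (simp add: coord_def)
  qed
  ultimately show ?case
    by (intro bexI[where x="\<lambda>c. \<Sum>b\<in>B j. V.representation (B j) v b * c (j, b)" and A="poly_fun (coord_set J)"])
next
  case (add p q)
  then obtain p' q' where "p' \<in> poly_fun (coord_set J)" "\<forall>x\<in>dual_prod smul A J. p x = p' (coord x)"
    "q' \<in> poly_fun (coord_set J)" "\<forall>x\<in>dual_prod smul A J. q x = q' (coord x)" by (elim bexE)
  then show ?case by (intro bexI[OF _ poly_fun_add[of p' _ q']]) simp_all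
next
  case (mult p q)
  then obtain p' q' where "p' \<in> poly_fun (coord_set J)" "\<forall>x\<in>dual_prod smul A J. p x = p' (coord x)"
    "q' \<in> poly_fun (coord_set J)" "\<forall>x\<in>dual_prod smul A J. q x = q' (coord x)" by (elim bexE)
  then show ?case by (intro bexI[OF _ poly_fun_mult[of p' _ q']]) simp_all
qed

lemma poly_fun_polyfuns:
  assumes J: "J \<subseteq> J0" and "q \<in> poly_fun (coord_set J)"
  shows "(\<lambda>x. q (coord x)) \<in> polyfuns A J"
  using assms(2)
proof (induction rule: poly_fun_induct)
  case (const c)
  show ?case by (rule polyfuns.const)
next
  case (var i p)
  then obtain j b where i: "i = (j, b)" "j \<in> J" "j \<in> J0" "b \<in> B j" by (auto simp: Bl_def split: if_splits)
  from polyfuns.mult[OF polyfuns.coord[where J=J and A=A, OF i(2) basis_subset[OF i(3,4)]] var(3)]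
  show ?case by (simp add: coord_def i(1))
next
  case (add p q)
  from polyfuns.add[OF add(3,4)] show ?case .
qed

section \<open>Zariski closed sets in coordinates\<close>

abbreviation pre :: "nat set \<Rightarrow> (nat \<Rightarrow> 'v \<Rightarrow> complex) set \<Rightarrow> (nat \<times> 'v \<Rightarrow> complex) set" where
  "pre J Z \<equiv> {c. point J c \<in> Z}"

definition img :: "nat set \<Rightarrow> (nat \<times> 'v \<Rightarrow> complex) set \<Rightarrow> (nat \<Rightarrow> 'v \<Rightarrow> complex) set" where
  "img J Y = {x \<in> dual_prod smul A J. coord x \<in> Y}"

lemma zariski_closed_subset: "zariski_closed smul A J Z \<Longrightarrow> Z \<subseteq> dual_prod smul A J"
  by (auto simp: zariski_closed_def)

lemma aclosed_pre:
  assumes J: "J \<subseteq> J0" and "zariski_closed smul A J Z"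
  shows "aclosed (coord_set J) (pre J Z)"
proof -
  obtain P where P: "P \<subseteq> polyfuns A J" "Z = {x \<in> dual_prod smul A J. \<forall>p\<in>P. p x = 0}"
    using assms(2) unfolding zariski_closed_def by (elim exE conjE)
  define Q where "Q = {q \<in> poly_fun (coord_set J). \<exists>p\<in>P. \<forall>x\<in>dual_prod smul A J. p x = q (coord x)}"
  have "c \<in> pre J Z \<longleftrightarrow> (\<forall>q\<in>Q. q c = 0)" for c
  proof
    assume c: "c \<in> pre J Z"
    show "\<forall>q\<in>Q. q c = 0"
    proof
      fix q assume "q \<in> Q"
      then obtain p where p: "q \<in> poly_fun (coord_set J)" "p \<in> P" "\<forall>x\<in>dual_prod smul A J. p x = q (coord x)"
        by (auto simp: Q_def)
      have "q c = q (coord (point J c))" by (rule poly_fun_cong[OF p(1)]) (simp add: coord_point[OF J])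
      also have "\<dots> = p (point J c)" using p(3) point_dual_prod[OF J] by simp
      also have "\<dots> = 0" using c p(2) P(2) by simp
      finally show "q c = 0" .
    qed
  next
    assume c: "\<forall>q\<in>Q. q c = 0"
    have "p (point J c) = 0" if p: "p \<in> P" for p
    proof -
      obtain q where q: "q \<in> poly_fun (coord_set J)" "\<forall>x\<in>dual_prod smul A J. p x = q (coord x)"
        using polyfuns_poly_fun[OF J, of p] P(1) p by blast
      then have "q \<in> Q" using p by (auto simp: Q_def)
      have "p (point J c) = q (coord (point J c))" using q(2) point_dual_prod[OF J] by simp
      also have "\<dots> = q c" by (rule poly_fun_cong[OF q(1)]) (simp add: coord_point[OF J])
      finally show ?thesis using c \<open>q \<in> Q\<close> by simp
    qed
    then show "c \<in> pre J Z" using point_dual_prod[OF J] P(2) by simp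
  qed
  then have "pre J Z = {c. \<forall>q\<in>Q. q c = 0}" by blast
  moreover have "aclosed (coord_set J) {c. \<forall>q\<in>Q. q c = 0}" by (rule aclosedI) (auto simp: Q_def)
  ultimately show ?thesis by simp
qed

lemma zariski_closed_img:
  assumes J: "J \<subseteq> J0" and "aclosed (coord_set J) Y"
  shows "zariski_closed smul A J (img J Y)"
proof -
  obtain Q where Q: "Q \<subseteq> poly_fun (coord_set J)" "Y = {x. \<forall>q\<in>Q. q x = 0}"
    using assms(2) unfolding aclosed_def by (elim exE conjE)
  show ?thesis unfolding zariski_closed_def
    by (rule exI[of _ "(\<lambda>q x. q (coord x)) ` Q"])
      (use poly_fun_polyfuns[OF J subsetD[OF Q(1)]] in \<open>auto simp: img_def Q(2)\<close>)
qed

lemma pre_img: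
  assumes J: "J \<subseteq> J0" and Y: "aclosed (coord_set J) Y"
  shows "pre J (img J Y) = Y"
proof -
  have "point J c \<in> img J Y \<longleftrightarrow> c \<in> Y" for c
  proof -
    have "coord (point J c) \<in> Y \<longleftrightarrow> c \<in> Y"
      using aclosed_cong[OF Y, of "coord (point J c)" c] aclosed_cong[OF Y, of c "coord (point J c)"]
        coord_point[OF J] by auto
    then show ?thesis using point_dual_prod[OF J] by (simp add: img_def)
  qed
  then show ?thesis by blast
qed

lemma coord_in_pre: "J \<subseteq> J0 \<Longrightarrow> x \<in> dual_prod smul A J \<Longrightarrow> coord x \<in> pre J Z \<longleftrightarrow> x \<in> Z"
  by (simp add: point_coord)

lemma irr_pre:
  assumes J: "J \<subseteq> J0" and Z: "irreducible_closed smul A J Z"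
  shows "irr (coord_set J) (pre J Z)"
  unfolding irr_def
proof (intro conjI ballI impI)
  have closed: "zariski_closed smul A J Z" using Z by (simp add: irreducible_closed_def)
  note ZJ = zariski_closed_subset[OF closed]
  obtain x where "x \<in> Z" using Z by (auto simp: irreducible_closed_def)
  then have "coord x \<in> pre J Z" using coord_in_pre[OF J] ZJ by blast
  then show "pre J Z \<noteq> {}" by blast
  fix p q assume p: "p \<in> poly_fun (coord_set J)" and q: "q \<in> poly_fun (coord_set J)" and pq: "\<forall>z\<in>pre J Z. p z * q z = 0"
  have cl: "zariski_closed smul A J (img J {c. \<forall>f\<in>{p}. f c = 0})"
    "zariski_closed smul A J (img J {c. \<forall>f\<in>{q}. f c = 0})"
    by (rule zariski_closed_img[OF J aclosedI], use p in simp, rule zariski_closed_img[OF J aclosedI], use q in simp)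
  have "Z \<subseteq> img J {c. \<forall>f\<in>{p}. f c = 0} \<union> img J {c. \<forall>f\<in>{q}. f c = 0}"
  proof
    fix x assume x: "x \<in> Z"
    then have "coord x \<in> pre J Z" using coord_in_pre[OF J] ZJ by blast
    then have "p (coord x) * q (coord x) = 0" using pq by blast
    then show "x \<in> img J {c. \<forall>f\<in>{p}. f c = 0} \<union> img J {c. \<forall>f\<in>{q}. f c = 0}"
      using x ZJ by (auto simp: img_def)
  qed
  then have "Z \<subseteq> img J {c. \<forall>f\<in>{p}. f c = 0} \<or> Z \<subseteq> img J {c. \<forall>f\<in>{q}. f c = 0}"
    using Z cl by (simp add: irreducible_closed_def)
  moreover have "\<forall>z\<in>pre J Z. f z = 0" if "f \<in> poly_fun (coord_set J)" "Z \<subseteq> img J {c. \<forall>f\<in>{f}. f c = 0}" for f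
  proof
    fix c assume "c \<in> pre J Z"
    then have "f (coord (point J c)) = 0" using that(2) by (auto simp: img_def)
    moreover have "f c = f (coord (point J c))"
      by (rule poly_fun_cong[OF that(1)]) (simp add: coord_point[OF J])
    ultimately show "f c = 0" by simp
  qed
  ultimately show "(\<forall>z\<in>pre J Z. p z = 0) \<or> (\<forall>z\<in>pre J Z. q z = 0)" using p q by blast
qed

lemma irreducible_img:
  assumes J: "J \<subseteq> J0" and Y: "aclosed (coord_set J) Y" "irr (coord_set J) Y"
  shows "irreducible_closed smul A J (img J Y)"
  unfolding irreducible_closed_def
proof (intro conjI allI impI)
  show "zariski_closed smul A J (img J Y)" by (rule zariski_closed_img[OF J Y(1)])
  have in_img: "point J c \<in> img J Y" if "c \<in> Y" for c using pre_img[OF J Y(1)] that by blast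
  show "img J Y \<noteq> {}" using Y(2) in_img by (auto simp: irr_def)
  fix Z1 Z2 assume Z: "zariski_closed smul A J Z1" "zariski_closed smul A J Z2" "img J Y \<subseteq> Z1 \<union> Z2"
  show "img J Y \<subseteq> Z1 \<or> img J Y \<subseteq> Z2"
  proof (rule ccontr)
    assume "\<not> ?thesis"
    then obtain x1 x2 where x: "x1 \<in> img J Y" "x1 \<notin> Z1" "x2 \<in> img J Y" "x2 \<notin> Z2" by blast
    have "coord x1 \<notin> pre J Z1" "coord x2 \<notin> pre J Z2"
      using x coord_in_pre[OF J] by (auto simp: img_def)
    obtain p where p: "p \<in> poly_fun (coord_set J)" "\<forall>z\<in>pre J Z1. p z = 0" "p (coord x1) \<noteq> 0"
      by (rule aclosed_separate[OF aclosed_pre[OF J Z(1)] \<open>coord x1 \<notin> pre J Z1\<close>])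
    obtain q where q: "q \<in> poly_fun (coord_set J)" "\<forall>z\<in>pre J Z2. q z = 0" "q (coord x2) \<noteq> 0"
      by (rule aclosed_separate[OF aclosed_pre[OF J Z(2)] \<open>coord x2 \<notin> pre J Z2\<close>])
    have "p c * q c = 0" if "c \<in> Y" for c
      using in_img[OF that] Z(3) p(2) q(2) by auto
    then have "(\<forall>c\<in>Y. p c = 0) \<or> (\<forall>c\<in>Y. q c = 0)" by (rule irrD[OF Y(2) p(1) q(1)])
    then show False using x(1,3) p(3) q(3) by (auto simp: img_def)
  qed
qed

text \<open>By \<open>irr_chain_indep\<close> and \<open>indep_irr_chain\<close> the Krull dimension
  is the largest number \<open>D\<close> of independent coordinates. Nonemptiness makes the empty
  set of coordinates independent, so that \<open>D\<close> exists.\<close>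

lemma zariski_codim_le_iff:
  assumes J: "J \<subseteq> J0" "finite J" and X: "zariski_closed smul A J X" "pre J X \<noteq> {}"
  shows "zariski_codim smul A J X \<le> enat r \<longleftrightarrow> codim_le (coord_set J) (pre J X) r"
proof -
  let ?V = "coord_set J" and ?X = "pre J X"
  have finV: "finite ?V" using J(2) finite_Bl by blast
  define S where "S = {enat m | m. \<exists>C :: nat \<Rightarrow> (nat \<Rightarrow> 'v \<Rightarrow> complex) set.
     (\<forall>l\<le>m. irreducible_closed smul A J (C l) \<and> C l \<subseteq> X) \<and> (\<forall>l<m. C l \<subset> C (Suc l))}"
  have dim: "zariski_dim smul A J X = Sup S" by (simp add: zariski_dim_def S_def)
  define T where "T = card ` {I. I \<subseteq> ?V \<and> indep I ?X}"
  have T: "finite T" "T \<noteq> {}" using finV indep_empty[OF X(2)] by (auto simp: T_def)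
  define D where "D = Max T"
  have "D \<in> T" unfolding D_def by (rule Max_in[OF T])
  then obtain I where I: "I \<subseteq> ?V" "indep I ?X" "card I = D" by (auto simp: T_def)
  have "Sup S = enat D"
  proof (rule antisym)
    show "Sup S \<le> enat D"
    proof (rule Sup_least)
      fix s assume "s \<in> S"
      then obtain m C where s: "s = enat m"
        and C: "\<And>l. l \<le> m \<Longrightarrow> irreducible_closed smul A J (C l) \<and> C l \<subseteq> X" "\<And>l. l < m \<Longrightarrow> C l \<subset> C (Suc l)"
        unfolding S_def by blast
      have cl: "zariski_closed smul A J (C l)" if "l \<le> m" for l
        using C(1)[OF that] by (simp add: irreducible_closed_def)
      have "irr_chain ?V ?X m"
        unfolding irr_chain_def
      proof (intro exI[of _ "\<lambda>l. pre J (C l)"] conjI allI impI)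
        fix l assume l: "l \<le> m"
        show "aclosed ?V (pre J (C l))" by (rule aclosed_pre[OF J(1) cl[OF l]])
        show "irr ?V (pre J (C l))" using irr_pre[OF J(1)] C(1)[OF l] by blast
        show "pre J (C l) \<subseteq> ?X" using C(1)[OF l] by blast
      next
        fix l assume l: "l < m"
        obtain x where x: "x \<in> C (Suc l)" "x \<notin> C l" using C(2)[OF l] by blast
        have "x \<in> dual_prod smul A J" using zariski_closed_subset[OF cl[of "Suc l"]] x(1) l by auto
        then have "coord x \<in> pre J (C (Suc l))" "coord x \<notin> pre J (C l)"
          using x coord_in_pre[OF J(1)] by blast+
        then show "pre J (C l) \<subset> pre J (C (Suc l))" using C(2)[OF l] by blast
      qed
      then obtain I' where I': "I' \<subseteq> ?V" "indep I' ?X" "m \<le> card I'" by (rule irr_chain_indep[OF finV])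
      have "card I' \<le> D" unfolding D_def by (rule Max_ge[OF T(1)]) (use I' in \<open>auto simp: T_def\<close>)
      then show "s \<le> enat D" using I'(3) s by simp
    qed
    have "irr_chain ?V ?X D" using indep_irr_chain[OF finV aclosed_pre[OF J(1) X(1)] I(1,2)] I(3) by simp
    then obtain C where C: "\<forall>l\<le>D. aclosed ?V (C l) \<and> irr ?V (C l) \<and> C l \<subseteq> ?X" "\<forall>l<D. C l \<subset> C (Suc l)"
      unfolding irr_chain_def by (elim exE conjE)
    have "enat D \<in> S"
      unfolding S_def
    proof (intro CollectI exI[of _ D] conjI exI[of _ "\<lambda>l. img J (C l)"] allI impI refl)
      fix l assume l: "l \<le> D"
      show "irreducible_closed smul A J (img J (C l))" using irreducible_img[OF J(1)] C(1) l by blast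
      show "img J (C l) \<subseteq> X"
      proof
        fix x assume "x \<in> img J (C l)"
        then have "x \<in> dual_prod smul A J" "coord x \<in> ?X" using C(1) l by (auto simp: img_def)
        then show "x \<in> X" using coord_in_pre[OF J(1)] by blast
      qed
    next
      fix l assume l: "l < D"
      have cl: "aclosed ?V (C l)" "aclosed ?V (C (Suc l))" using C(1) l by simp_all
      have sub: "C l \<subset> C (Suc l)" using C(2) l by simp
      have neq: "img J (C l) \<noteq> img J (C (Suc l))"
      proof
        assume eq: "img J (C l) = img J (C (Suc l))"
        have "C l = C (Suc l)" using pre_img[OF J(1) cl(1)] pre_img[OF J(1) cl(2)] unfolding eq by (rule subst)
        then show False using sub by blast
      qed
      have "img J (C l) \<subseteq> img J (C (Suc l))" using sub unfolding img_def by blast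
      then show "img J (C l) \<subset> img J (C (Suc l))" using neq by (rule psubsetI)
    qed
    then show "enat D \<le> Sup S" by (rule Sup_upper)
  qed
  then have "zariski_codim smul A J X = enat (card ?V - D)"
    by (simp add: zariski_codim_def dim card_coord_set[OF J(2,1)])
  moreover have "codim_le ?V ?X r \<longleftrightarrow> card ?V \<le> D + r"
  proof
    assume "codim_le ?V ?X r"
    then obtain I' where I': "I' \<subseteq> ?V" "indep I' ?X" "card ?V \<le> card I' + r" by (auto simp: codim_le_def)
    have "card I' \<le> D" unfolding D_def by (rule Max_ge[OF T(1)]) (use I' in \<open>auto simp: T_def\<close>)
    then show "card ?V \<le> D + r" using I'(3) by simp
  next
    assume "card ?V \<le> D + r"
    then show "codim_le ?V ?X r" using I by (auto simp: codim_le_def)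
  qed
  ultimately show ?thesis by auto
qed

lemma point_override:
  assumes "k \<in> J" "J \<subseteq> J0"
  shows "point J (override_on c u (Bl k)) = (point (J - {k}) c)(k := functional k u)"
proof
  fix j
  have "functional k (override_on c u (Bl k)) = functional k u"
    by (rule functional_cong) (use assms in \<open>auto simp: Bl_def\<close>)
  moreover have "functional j (override_on c u (Bl k)) = functional j c" if "j \<noteq> k"
    by (rule functional_cong) (use that in \<open>auto simp: Bl_def override_on_def\<close>)
  ultimately show "point J (override_on c u (Bl k)) j = ((point (J - {k}) c)(k := functional k u)) j"
    using assms(1) by (simp add: point_def)
qed

lemma multilinear_form_tensor:
  assumes J: "J \<subseteq> J0" and S: "is_tensor smul A J S"
  shows "multilinear_form Bl J (\<lambda>c. S (point J c))"
  unfolding multilinear_form_def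
proof (intro conjI allI impI ballI)
  fix c c' :: "nat \<times> 'v \<Rightarrow> complex" assume "\<forall>i\<in>coord_set J. c i = c' i"
  then have "point J c = point J c'" by (intro point_cong[OF _ J]) blast
  then show "S (point J c) = S (point J c')" by simp
next
  fix j c u v a assume j: "j \<in> J"
  have jJ0: "j \<in> J0" using j J by auto
  define x where "x = point J c"
  have x: "x \<in> dual_prod smul A J" unfolding x_def by (rule point_dual_prod[OF J])
  have upd: "(point (J - {j}) c)(j := f) = x(j := f)" for f
    by (auto simp: x_def point_def fun_eq_iff)
  have au: "functional j (\<lambda>i. a * v i) = (\<lambda>w. a * functional j v w)"
    by (auto simp: functional_def fun_eq_iff sum_distrib_left mult.left_commute)
  have lin: "functional j (\<lambda>i. u i + a * v i) = (\<lambda>w. functional j u w + functional j (\<lambda>i. a * v i) w)"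
    by (auto simp: functional_def fun_eq_iff distrib_left sum.distrib)
  have "S (x(j := (\<lambda>w. functional j u w + functional j (\<lambda>i. a * v i) w))) = S (x(j := functional j u)) + S (x(j := functional j (\<lambda>i. a * v i)))"
    using S x j functional_dual[OF jJ0] unfolding is_tensor_def by blast
  moreover have "S (x(j := functional j (\<lambda>i. a * v i))) = a * S (x(j := functional j v))"
    unfolding au using S x j functional_dual[OF jJ0] unfolding is_tensor_def by blast
  ultimately show "S (point J (override_on c (\<lambda>i. u i + a * v i) (Bl j))) =
      S (point J (override_on c u (Bl j))) + a * S (point J (override_on c v (Bl j)))"
    unfolding point_override[OF j J] upd lin by simp
qed

text \<open>The set in the definition of the geometric rank corresponds to the kernel variety, as
  the coordinate vectors \<open>u\<close> reach all functionals. With at least two factors it is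
  nonempty, so its Krull dimension is meaningful.\<close>

lemma geometric_rank_le_iff:
  assumes J: "J \<subseteq> J0" "finite J" "card J \<ge> 2" and S: "is_tensor smul A J S"
  shows "geometric_rank smul A J S \<le> enat r \<longleftrightarrow>
    codim_le (coord_set (J - {Max J})) (kernel_variety Bl (\<lambda>c. S (point J c)) (Max J)) r"
proof -
  define k where "k = Max J"
  have "J \<noteq> {}" using J(3) by auto
  then have k: "k \<in> J" unfolding k_def using J(2) by (intro Max_in)
  have kJ0: "k \<in> J0" and J': "J - {k} \<subseteq> J0" using k J by auto
  define F where "F c = S (point J c)" for c
  have F: "multilinear_form Bl J F" unfolding F_def by (rule multilinear_form_tensor[OF J(1) S])
  define X where "X = {x \<in> dual_prod smul A (J - {k}). \<forall>f\<in>dual_space smul (A k). S (x(k := f)) = 0}"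
  have pre: "pre (J - {k}) X = kernel_variety Bl F k"
  proof -
    have "c \<in> pre (J - {k}) X \<longleftrightarrow> c \<in> kernel_variety Bl F k" for c
    proof
      assume c: "c \<in> pre (J - {k}) X"
      then have "S ((point (J - {k}) c)(k := functional k u)) = 0" for u using functional_dual[OF kJ0] by (simp add: X_def)
      then show "c \<in> kernel_variety Bl F k" by (simp add: kernel_variety_def F_def point_override[OF k J(1)])
    next
      assume c: "c \<in> kernel_variety Bl F k"
      have "S ((point (J - {k}) c)(k := f)) = 0" if f: "f \<in> dual_space smul (A k)" for f
      proof -
        have "F (override_on c (\<lambda>(k, b). f b) (Bl k)) = 0" using c by (simp add: kernel_variety_def)
        then show ?thesis by (simp add: F_def point_override[OF k J(1)] functional_surj[OF kJ0 f])
      qed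
      then show "c \<in> pre (J - {k}) X" using point_dual_prod[OF J'] by (simp add: X_def)
    qed
    then show ?thesis by blast
  qed
  have "aclosed (coord_set (J - {k})) (kernel_variety Bl F k)"
    by (rule aclosed_kernel_variety[OF finite_Bl disjoint_Bl F J(2)])
  from zariski_closed_img[OF J' this] have "zariski_closed smul A (J - {k}) (img (J - {k}) (kernel_variety Bl F k))" .
  moreover have "img (J - {k}) (kernel_variety Bl F k) = X"
    unfolding img_def pre[symmetric] using point_coord[OF J'] by (auto simp: X_def)
  ultimately have X: "zariski_closed smul A (J - {k}) X" by simp
  have "kernel_variety Bl F k \<noteq> {}"
    using conic_kernel_variety[OF finite_Bl disjoint_Bl F J(2) k J(3)] by (simp add: conic_def)
  then have "zariski_codim smul A (J - {k}) X \<le> enat r \<longleftrightarrow> codim_le (coord_set (J - {k})) (kernel_variety Bl F k) r"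
    using zariski_codim_le_iff[OF J' _ X] J(2) pre by simp
  then show ?thesis
    by (simp add: geometric_rank_def Let_def X_def k_def F_def[abs_def])
qed

end

lemma fd_subspace_basis:
  assumes "vector_space smul" "fd_subspace smul V"
  shows "\<exists>B. finite B \<and> \<not> module.dependent smul B \<and> V = module.span smul B"
proof -
  interpret vector_space smul by (rule assms(1))
  obtain S where S: "finite S" "V = span S" using assms(2) by (auto simp: fd_subspace_def)
  obtain B where B: "B \<subseteq> S" "independent B" "span B = span S"
    using maximal_independent_subset[of S] span_eq by (metis span_superset subset_trans span_mono span_minimal subspace_span)
  then show ?thesis using S finite_subset by blast
qed

theorem proposition21:
  fixes smul :: "complex \<Rightarrow> 'v::ab_group_add \<Rightarrow> 'v"
    and A :: "nat \<Rightarrow> 'v set"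
    and T :: "(nat \<Rightarrow> 'v \<Rightarrow> complex) \<Rightarrow> complex"
    and n r :: nat
  assumes "vector_space smul"
    and "n \<ge> 3"
    and "\<And>i. i \<in> {1..n} \<Longrightarrow> fd_subspace smul (A i)"
    and "is_tensor smul A {1..n} T"
    and "r < n"
  shows "geometric_rank smul A {1..n} T \<le> enat r \<longleftrightarrow>
    (\<exists>i\<in>{1..n}. bounded_geometric_rank smul A ({1..n} - {i})
        (contract i T ` dual_space smul (A i)) r)"
proof -
  define B where "B i = (SOME B. finite B \<and> \<not> module.dependent smul B \<and> A i = module.span smul B)" for i
  have B: "finite (B i) \<and> \<not> module.dependent smul (B i) \<and> A i = module.span smul (B i)" if "i \<in> {1..n}" for i
    unfolding B_def by (rule someI_ex[OF fd_subspace_basis[OF assms(1) assms(3)[OF that]]])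
  interpret vector_space smul by (rule assms(1))
  interpret coordinates smul A B "{1..n}"
    by unfold_locales (use B in auto)
  define F where "F c = T (point {1..n} c)" for c
  have F: "multilinear_form Bl {1..n} F" unfolding F_def by (rule multilinear_form_tensor[OF order_refl assms(4)])
  have card: "card {1..n} \<ge> 2" using assms(2) by simp
  have Max: "Max {1..n} = n" by (rule Max_eqI) (use assms(2) in auto)
  have L: "geometric_rank smul A {1..n} T \<le> enat r \<longleftrightarrow> codim_le (coord_set ({1..n} - {n})) (kernel_variety Bl F n) r"
    using geometric_rank_le_iff[OF order_refl finite_atLeastAtMost card assms(4), of r]
    unfolding Max F_def[abs_def] .
  have R: "bounded_geometric_rank smul A ({1..n} - {i}) (contract i T ` dual_space smul (A i)) r \<longleftrightarrow>
      (\<forall>u. codim_le (coord_set ({1..n} - {i} - {Max ({1..n} - {i})}))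
        (kernel_variety Bl (\<lambda>c. F (override_on c u (Bl i))) (Max ({1..n} - {i}))) r)" if i: "i \<in> {1..n}" for i
  proof -
    let ?J = "{1..n} - {i}"
    have gr: "geometric_rank smul A ?J (contract i T f) \<le> enat r \<longleftrightarrow>
        codim_le (coord_set (?J - {Max ?J})) (kernel_variety Bl (\<lambda>c. contract i T f (point ?J c)) (Max ?J)) r"
      if f: "f \<in> dual_space smul (A i)" for f
      by (rule geometric_rank_le_iff[OF Diff_subset _ _ contract_is_tensor[OF assms(4) i f]])
        (use i assms(2) in auto)
    have eq: "(\<lambda>c. contract i T (functional i u) (point ?J c)) = (\<lambda>c. F (override_on c u (Bl i)))" for u
      unfolding contract_def F_def point_override[OF i order_refl] ..
    \<comment> \<open>The \<open>functional i u\<close> are exactly the elements of the dual space,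
      so the quantifier can run over coordinate vectors.\<close>
    have "(\<forall>f\<in>dual_space smul (A i). geometric_rank smul A ?J (contract i T f) \<le> enat r) \<longleftrightarrow>
        (\<forall>u. geometric_rank smul A ?J (contract i T (functional i u)) \<le> enat r)"
      using functional_dual[OF i] functional_surj[OF i] by metis
    then show ?thesis
      unfolding bounded_geometric_rank_def using gr[OF functional_dual[OF i]] eq by simp
  qed
  have "(\<exists>i\<in>{1..n}. bounded_geometric_rank smul A ({1..n} - {i}) (contract i T ` dual_space smul (A i)) r) \<longleftrightarrow>
      (\<exists>i\<in>{1..n}. \<forall>u. codim_le (coord_set ({1..n} - {i} - {Max ({1..n} - {i})}))
        (kernel_variety Bl (\<lambda>c. F (override_on c u (Bl i))) (Max ({1..n} - {i}))) r)"
    using R by (intro bex_cong) auto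
  then show ?thesis
    unfolding L using codim_le_iff_contract[OF finite_Bl disjoint_Bl F assms(2,5)] by simp
qed

end
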